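(* Let $G=G_1*_ZG_2$ be an amalgamated product with $G_1\neq Z\neq G_2$, where $Z$ is virtually $\mathbb Z$, and let $G$ act geometrically on a proper metric space $(X,d_X)$ that admits a consistent, conical, reversible, $G$-equivariant bicombing $\sigma$. Then there exists a separating pair of points in the boundary $\partial_\sigma X$, i.e. there are two points of $\partial_\sigma X$ whose removal leaves a disconnected space.
   Context: Proper means closed balls are compact. An action via isometries is geometric if $\{g: gK\cap K\ne\emptyset\}$ is finite for every compact $K$ and $G\backslash X$ is compact. "Virtually $\mathbb Z$" means containing an infinite cyclic subgroup of finite index. A (geodesic) bicombing on a geodesic metric space $(X,d)$ is a continuous map $\sigma\colon X\times X\times[0,1]\to X$ such that each $\sigma_{xy}:=\sigma(x,y,\cdot)$ is a constant speed geodesic from $x$ to $y$. It is consistent if $\operatorname{im}\sigma_{\sigma_{xy}(s),\sigma_{xy}(t)}=\operatorname{im}\sigma_{xy}|_{[s,t]}$ for all $x,y$ and $0\le s<t\le1$; conical if $d(\sigma_{xy}(t),\sigma_{x'y'}(t))\le(1-t)d(x,x')+t\,d(y,y')$ always; reversible if $\sigma_{xy}(t)=\sigma_{yx}(1-t)$ always; $G$-equivariant if $g\sigma_{xy}=\sigma_{gx,gy}$ for all $g\in G$. Boundary: a $\sigma$-ray is an isometric embedding $\xi\colon[0,\infty)\to X$ with $\operatorname{im}\sigma_{\xi(0)\xi(t)}=\operatorname{im}\xi|_{[0,t]}$ for all $t\ge0$. Two $\sigma$-rays $\xi,\zeta$ are asymptotic if $\sup_{t}d(\xi(t),\zeta(t))<\infty$.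 $\partial_\sigma X$ is the set of asymptoty classes of $\sigma$-rays; for each $o\in X$, each class $\bar x$ has a unique representative $\varrho_{o,\bar x}$ with $\varrho_{o,\bar x}(0)=o$. The topology on $\partial_\sigma X$ has as base the sets $\{\bar y\in\partial_\sigma X: d(\varrho_{o,\bar y}(t),\varrho_{o,\bar x}(t))<\epsilon\}$, $\bar x\in\partial_\sigma X$, $t\ge0$, $\epsilon>0$, for a fixed $o\in X$ (the topology does not depend on $o$). *)

theory Defs
  imports
    "HOL-Analysis.Analysis"
    "HOL-Algebra.Group_Action"
    "HOL-Algebra.Elementary_Groups"
begin

section \<open>Amalgamated products\<close>

text \<open>
  The pushout of \<open>G1\<close> and \<open>G2\<close> along \<open>i1 : Z \<rightarrow> G1\<close> and \<open>i2 : Z \<rightarrow> G2\<close>, given by its standard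
  presentation: words in the disjoint union of the two groups, modulo the smallest congruence
  that contains the multiplication tables of both factors and identifies \<open>i1 z\<close> with \<open>i2 z\<close>.
\<close>

definition amalgam_words :: "('a, 'p) monoid_scheme \<Rightarrow> ('b, 'q) monoid_scheme \<Rightarrow> ('a + 'b) list set"
  where "amalgam_words G1 G2 = lists (carrier G1 <+> carrier G2)"

inductive amalgam_cong ::
  "('a, 'p) monoid_scheme \<Rightarrow> ('b, 'q) monoid_scheme \<Rightarrow> ('c, 'r) monoid_scheme \<Rightarrow>
    ('c \<Rightarrow> 'a) \<Rightarrow> ('c \<Rightarrow> 'b) \<Rightarrow> ('a + 'b) list \<Rightarrow> ('a + 'b) list \<Rightarrow> bool"
  for G1 :: "('a, 'p) monoid_scheme" and G2 :: "('b, 'q) monoid_scheme"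
    and Z :: "('c, 'r) monoid_scheme" and i1 :: "'c \<Rightarrow> 'a" and i2 :: "'c \<Rightarrow> 'b"
where
  refl: "w \<in> amalgam_words G1 G2 \<Longrightarrow> amalgam_cong G1 G2 Z i1 i2 w w"
| sym: "amalgam_cong G1 G2 Z i1 i2 v w \<Longrightarrow> amalgam_cong G1 G2 Z i1 i2 w v"
| trans: "amalgam_cong G1 G2 Z i1 i2 u v \<Longrightarrow> amalgam_cong G1 G2 Z i1 i2 v w \<Longrightarrow>
    amalgam_cong G1 G2 Z i1 i2 u w"
| append: "amalgam_cong G1 G2 Z i1 i2 u v \<Longrightarrow> amalgam_cong G1 G2 Z i1 i2 u' v' \<Longrightarrow>
    amalgam_cong G1 G2 Z i1 i2 (u @ u') (v @ v')"
| one1: "amalgam_cong G1 G2 Z i1 i2 [Inl \<one>\<^bsub>G1\<^esub>] []"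
| one2: "amalgam_cong G1 G2 Z i1 i2 [Inr \<one>\<^bsub>G2\<^esub>] []"
| mult1: "x \<in> carrier G1 \<Longrightarrow> y \<in> carrier G1 \<Longrightarrow>
    amalgam_cong G1 G2 Z i1 i2 [Inl x, Inl y] [Inl (x \<otimes>\<^bsub>G1\<^esub> y)]"
| mult2: "x \<in> carrier G2 \<Longrightarrow> y \<in> carrier G2 \<Longrightarrow>
    amalgam_cong G1 G2 Z i1 i2 [Inr x, Inr y] [Inr (x \<otimes>\<^bsub>G2\<^esub> y)]"
| amalg: "z \<in> carrier Z \<Longrightarrow> amalgam_cong G1 G2 Z i1 i2 [Inl (i1 z)] [Inr (i2 z)]"

definition amalgam_rel ::
  "('a, 'p) monoid_scheme \<Rightarrow> ('b, 'q) monoid_scheme \<Rightarrow> ('c, 'r) monoid_scheme \<Rightarrow>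
    ('c \<Rightarrow> 'a) \<Rightarrow> ('c \<Rightarrow> 'b) \<Rightarrow> (('a + 'b) list \<times> ('a + 'b) list) set"
  where "amalgam_rel G1 G2 Z i1 i2 = {(v, w). amalgam_cong G1 G2 Z i1 i2 v w}"

definition amalgamated_product ::
  "('a, 'p) monoid_scheme \<Rightarrow> ('b, 'q) monoid_scheme \<Rightarrow> ('c, 'r) monoid_scheme \<Rightarrow>
    ('c \<Rightarrow> 'a) \<Rightarrow> ('c \<Rightarrow> 'b) \<Rightarrow> ('a + 'b) list set monoid"
  where "amalgamated_product G1 G2 Z i1 i2 =
    \<lparr>carrier = amalgam_words G1 G2 // amalgam_rel G1 G2 Z i1 i2,
     monoid.mult = (\<lambda>A B. \<Union>v\<in>A. \<Union>w\<in>B. amalgam_rel G1 G2 Z i1 i2 `` {v @ w}),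
     one = amalgam_rel G1 G2 Z i1 i2 `` {[]}\<rparr>"

definition virtually_Z :: "('a, 'p) monoid_scheme \<Rightarrow> bool"
  where "virtually_Z H \<longleftrightarrow>
    (\<exists>C. subgroup C H \<and> cyclic_group (H\<lparr>carrier := C\<rparr>) \<and> infinite C \<and> finite (rcosets\<^bsub>H\<^esub> C))"


section \<open>Geometric actions\<close>

definition proper_space :: "'x::metric_space itself \<Rightarrow> bool"
  where "proper_space _ \<longleftrightarrow> (\<forall>(x::'x) r. compact (cball x r))"

definition orbit_space :: "('g, 'm) monoid_scheme \<Rightarrow> ('g \<Rightarrow> 'x \<Rightarrow> 'x::topological_space) \<Rightarrow> 'x set topology"
  where "orbit_space G \<phi> =
    topology (\<lambda>U. U \<subseteq> orbits G UNIV \<phi> \<and> open {x. orbit G \<phi> x \<in> U})"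

lemma istopology_orbit_space:
  fixes \<phi> :: "'g \<Rightarrow> 'x \<Rightarrow> 'x::topological_space"
  shows "istopology (\<lambda>U. U \<subseteq> orbits G UNIV \<phi> \<and> open {x. orbit G \<phi> x \<in> U})"
proof -
  have *: "{x. orbit G \<phi> x \<in> \<Union>\<K>} = (\<Union>U\<in>\<K>. {x. orbit G \<phi> x \<in> U})" for \<K>
    by auto
  show ?thesis
    unfolding istopology_def
  proof (intro conjI allI impI)
    fix S T
    assume "S \<subseteq> orbits G UNIV \<phi> \<and> open {x. orbit G \<phi> x \<in> S}"
      and "T \<subseteq> orbits G UNIV \<phi> \<and> open {x. orbit G \<phi> x \<in> T}"
    then show "S \<inter> T \<subseteq> orbits G UNIV \<phi>" "open {x. orbit G \<phi> x \<in> S \<inter> T}"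
      by (auto simp: open_Collect_conj)
  next
    fix \<K>
    assume "\<forall>K\<in>\<K>. K \<subseteq> orbits G UNIV \<phi> \<and> open {x. orbit G \<phi> x \<in> K}"
    then show "\<Union>\<K> \<subseteq> orbits G UNIV \<phi>" "open {x. orbit G \<phi> x \<in> \<Union>\<K>}"
      unfolding * by blast+
  qed
qed

definition geometric_action :: "('g, 'm) monoid_scheme \<Rightarrow> ('g \<Rightarrow> 'x \<Rightarrow> 'x::metric_space) \<Rightarrow> bool"
  where "geometric_action G \<phi> \<longleftrightarrow>
    group_action G UNIV \<phi> \<and>
    (\<forall>g\<in>carrier G. \<forall>x y. dist (\<phi> g x) (\<phi> g y) = dist x y) \<and>
    (\<forall>K. compact K \<longrightarrow> finite {g \<in> carrier G. \<phi> g ` K \<inter> K \<noteq> {}}) \<and>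
    compact_space (orbit_space G \<phi>)"


section \<open>Bicombings\<close>

definition bicombing :: "('x::metric_space \<Rightarrow> 'x \<Rightarrow> real \<Rightarrow> 'x) \<Rightarrow> bool"
  where "bicombing \<sigma> \<longleftrightarrow>
    continuous_on (UNIV \<times> UNIV \<times> {0..1}) (\<lambda>(x, y, t). \<sigma> x y t) \<and>
    (\<forall>x y. \<sigma> x y 0 = x \<and> \<sigma> x y 1 = y \<and>
      (\<forall>s\<in>{0..1}. \<forall>t\<in>{0..1}. dist (\<sigma> x y s) (\<sigma> x y t) = \<bar>s - t\<bar> * dist x y))"

definition consistent :: "('x \<Rightarrow> 'x \<Rightarrow> real \<Rightarrow> 'x) \<Rightarrow> bool"
  where "consistent \<sigma> \<longleftrightarrow>
    (\<forall>x y s t. 0 \<le> s \<and> s < t \<and> t \<le> 1 \<longrightarrow>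
      \<sigma> (\<sigma> x y s) (\<sigma> x y t) ` {0..1} = \<sigma> x y ` {s..t})"

definition conical :: "('x::metric_space \<Rightarrow> 'x \<Rightarrow> real \<Rightarrow> 'x) \<Rightarrow> bool"
  where "conical \<sigma> \<longleftrightarrow>
    (\<forall>x y x' y'. \<forall>t\<in>{0..1}.
      dist (\<sigma> x y t) (\<sigma> x' y' t) \<le> (1 - t) * dist x x' + t * dist y y')"

definition reversible :: "('x \<Rightarrow> 'x \<Rightarrow> real \<Rightarrow> 'x) \<Rightarrow> bool"
  where "reversible \<sigma> \<longleftrightarrow> (\<forall>x y. \<forall>t\<in>{0..1}. \<sigma> x y t = \<sigma> y x (1 - t))"

definition equivariant ::
  "('g, 'm) monoid_scheme \<Rightarrow> ('g \<Rightarrow> 'x \<Rightarrow> 'x) \<Rightarrow> ('x \<Rightarrow> 'x \<Rightarrow> real \<Rightarrow> 'x) \<Rightarrow> bool"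
  where "equivariant G \<phi> \<sigma> \<longleftrightarrow>
    (\<forall>g\<in>carrier G. \<forall>x y. \<forall>t\<in>{0..1}. \<phi> g (\<sigma> x y t) = \<sigma> (\<phi> g x) (\<phi> g y) t)"


section \<open>The boundary\<close>

text \<open>
  Rays are maps with domain \<open>{0..}\<close>, hence extensional; otherwise representatives with a
  prescribed initial point would not be unique as functions on the reals.
\<close>

definition sigma_rays :: "('x::metric_space \<Rightarrow> 'x \<Rightarrow> real \<Rightarrow> 'x) \<Rightarrow> (real \<Rightarrow> 'x) set"
  where "sigma_rays \<sigma> = {\<xi> \<in> extensional {0..}.
    (\<forall>s\<ge>0. \<forall>t\<ge>0. dist (\<xi> s) (\<xi> t) = \<bar>s - t\<bar>) \<and>
    (\<forall>t\<ge>0. \<sigma> (\<xi> 0) (\<xi> t) ` {0..1} = \<xi> ` {0..t})}"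

definition asymptotic :: "(real \<Rightarrow> 'x::metric_space) \<Rightarrow> (real \<Rightarrow> 'x) \<Rightarrow> bool"
  where "asymptotic \<xi> \<zeta> \<longleftrightarrow> bdd_above ((\<lambda>t. dist (\<xi> t) (\<zeta> t)) ` {0..})"

definition sigma_boundary :: "('x::metric_space \<Rightarrow> 'x \<Rightarrow> real \<Rightarrow> 'x) \<Rightarrow> (real \<Rightarrow> 'x) set set"
  where "sigma_boundary \<sigma> =
    sigma_rays \<sigma> // {(\<xi>, \<zeta>). \<xi> \<in> sigma_rays \<sigma> \<and> \<zeta> \<in> sigma_rays \<sigma> \<and> asymptotic \<xi> \<zeta>}"

definition ray_from :: "'x \<Rightarrow> (real \<Rightarrow> 'x) set \<Rightarrow> real \<Rightarrow> 'x"
  where "ray_from p a = (THE \<xi>. \<xi> \<in> a \<and> \<xi> 0 = p)"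

definition boundary_topology ::
  "('x::metric_space \<Rightarrow> 'x \<Rightarrow> real \<Rightarrow> 'x) \<Rightarrow> 'x \<Rightarrow> (real \<Rightarrow> 'x) set topology"
  where "boundary_topology \<sigma> p = topology_generated_by
    {{b \<in> sigma_boundary \<sigma>. dist (ray_from p b t) (ray_from p a t) < \<epsilon>} | a t \<epsilon>.
      a \<in> sigma_boundary \<sigma> \<and> 0 \<le> t \<and> 0 < \<epsilon>}"

end

theory Submission
  imports Defs
begin

text \<open>
  Let \<open>g\<close> generate an infinite cyclic subgroup of finite index in \<open>Z\<close>, and let \<open>x\<close> be a point
  that \<open>g\<close> moves as little as possible.

  By conicality and reversibility the displacement of \<open>g\<^sup>2\<close> is at least twice that of \<open>g\<close>, so
  \<open>n \<mapsto> g\<^sup>n x\<close> is a geodesic up to scaling. It need not be a \<open>\<sigma>\<close>-line, but every segment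
  \<open>\<sigma>(x, g\<^sup>m x)\<close> stays uniformly close to the orbit. To see this, let \<open>F\<close> be the map that sends
  \<open>y\<close> to \<open>g\<^sup>-\<^sup>n \<sigma>(y, g\<^sup>m y)(n/m)\<close> on the set of points of minimal displacement. It is
  1-Lipschitz and commutes with the centralizer of \<open>g\<close>, which acts cocompactly on that set;
  a pigeonhole argument on conjugates shows that \<open>F\<close> is within bounded distance of an element \<open>a\<close>
  of the centre of the centralizer. By conicality, \<open>F\<^sup>k x\<close> is at most as far from \<open>x\<close> as a centred
  random walk on the orbit is on average after \<open>k\<close> steps, so its distance grows like the square
  root of \<open>k\<close>, whereas \<open>a\<^sup>k\<close> moves \<open>x\<close> at linear speed.
  Hence \<open>a\<close>, and with it \<open>F\<close>, moves \<open>x\<close> by a bounded amount. Consequently the \<open>Z\<close>-orbit of \<open>x\<close>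
  accumulates at exactly two boundary points.

  Normal forms split \<open>G\<close> into \<open>Z\<close> and the two sets of elements whose normal form starts in
  \<open>G\<^sub>1\<close> or in \<open>G\<^sub>2\<close>. Both sets are invariant under left multiplication by \<open>Z\<close>, contain elements
  arbitrarily far from \<open>Z\<close>, and can only be joined by passing near \<open>Z\<close>. So every ray which is
  not asymptotic to one of the two ends of the \<open>Z\<close>-orbit eventually stays on one side, both sides
  occur, and the side is a locally constant function of the boundary point.
\<close>

section \<open>Rays and the boundary\<close>

lemma asymptotic_iff: "asymptotic \<xi> \<zeta> \<longleftrightarrow> (\<exists>C. \<forall>t\<ge>0. dist (\<xi> t) (\<zeta> t) \<le> C)"
  unfolding asymptotic_def bdd_above_def by auto

lemma asymptotic_refl: "asymptotic \<xi> \<xi>"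
  unfolding asymptotic_iff by auto

lemma asymptotic_sym: "asymptotic \<xi> \<zeta> \<Longrightarrow> asymptotic \<zeta> \<xi>"
  unfolding asymptotic_iff by (simp add: dist_commute)

lemma asymptotic_trans:
  assumes "asymptotic \<xi> \<zeta>" "asymptotic \<zeta> \<eta>"
  shows "asymptotic \<xi> \<eta>"
proof -
  obtain C D where "\<And>t. t \<ge> 0 \<Longrightarrow> dist (\<xi> t) (\<zeta> t) \<le> C" "\<And>t. t \<ge> 0 \<Longrightarrow> dist (\<zeta> t) (\<eta> t) \<le> D"
    using assms unfolding asymptotic_iff by blast
  then have "dist (\<xi> t) (\<eta> t) \<le> C + D" if "t \<ge> 0" for t
    using dist_triangle[of "\<xi> t" "\<eta> t" "\<zeta> t"] that by (meson add_mono order_trans)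
  then show ?thesis unfolding asymptotic_iff by blast
qed

section \<open>Segments and rays of a conical, consistent bicombing\<close>

locale bicombed_space =
  fixes \<sigma> :: "'x::metric_space \<Rightarrow> 'x \<Rightarrow> real \<Rightarrow> 'x"
  assumes proper: "proper_space TYPE('x)"
    and bicombing: "bicombing \<sigma>"
    and consistent: "consistent \<sigma>"
    and conical: "conical \<sigma>"
begin

lemma sigma_0 [simp]: "\<sigma> x y 0 = x"
  and sigma_1 [simp]: "\<sigma> x y 1 = y"
  using bicombing unfolding bicombing_def by auto

lemma dist_sigma_sigma:
  assumes "0 \<le> s" "s \<le> 1" "0 \<le> t" "t \<le> 1"
  shows "dist (\<sigma> x y s) (\<sigma> x y t) = \<bar>s - t\<bar> * dist x y"
  using bicombing assms unfolding bicombing_def by auto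

lemma dist_start_sigma:
  assumes "0 \<le> t" "t \<le> 1"
  shows "dist x (\<sigma> x y t) = t * dist x y"
  using dist_sigma_sigma[of 0 t x y] assms by simp

lemma dist_sigma_end:
  assumes "0 \<le> t" "t \<le> 1"
  shows "dist (\<sigma> x y t) y = (1 - t) * dist x y"
  using dist_sigma_sigma[of t 1 x y] assms by simp

lemma sigma_same [simp]:
  assumes "0 \<le> t" "t \<le> 1"
  shows "\<sigma> x x t = x"
  using dist_start_sigma[OF assms, of x x] by simp

lemma conicalD:
  assumes "0 \<le> t" "t \<le> 1"
  shows "dist (\<sigma> x y t) (\<sigma> x' y' t) \<le> (1 - t) * dist x x' + t * dist y y'"
  using conical assms unfolding conical_def by auto

lemma dist_sigma_le:
  assumes "0 \<le> t" "t \<le> 1"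
  shows "dist z (\<sigma> x y t) \<le> (1 - t) * dist z x + t * dist z y"
  using conicalD[OF assms, of z z x y] assms by simp

lemma dist_sigma_from_le:
  assumes "0 \<le> t" "t \<le> 1"
  shows "dist (\<sigma> p x t) (\<sigma> p y t) \<le> t * dist x y"
  using conicalD[OF assms, of p x p y] by simp

text \<open>Consistency only equates images of geodesics. For \<open>x \<noteq> y\<close> the
  distance to \<open>x\<close> determines the parameter on \<open>\<sigma> x y\<close>, so the
  images determine the parametrizations. The case \<open>s = 0\<close> is apart because consistency
  speaks of nondegenerate intervals.\<close>

lemma sigma_initial_segment:
  assumes r: "0 \<le> r" "r \<le> 1" and s: "0 \<le> s" "s \<le> 1"
  shows "\<sigma> x (\<sigma> x y s) r = \<sigma> x y (r * s)"
proof (cases "s = 0 \<or> x = y")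
  case True
  then show ?thesis using r s by (auto simp: mult_le_one)
next
  case False
  then have "\<sigma> (\<sigma> x y 0) (\<sigma> x y s) ` {0..1} = \<sigma> x y ` {0..s}"
    using consistent s unfolding consistent_def by (smt (verit))
  moreover have "\<sigma> x (\<sigma> x y s) r \<in> \<sigma> x (\<sigma> x y s) ` {0..1}" using r by simp
  ultimately obtain r' where r': "0 \<le> r'" "r' \<le> s" "\<sigma> x (\<sigma> x y s) r = \<sigma> x y r'"
    by auto
  have "r * (s * dist x y) = r' * dist x y"
    using dist_start_sigma[OF r, of x "\<sigma> x y s"] dist_start_sigma[OF s, of x y]
      dist_start_sigma[of r' x y] r' s by auto
  then have "r' = r * s" using False by simp
  with r' show ?thesis by simp
qed

lemma raysD:
  assumes "\<xi> \<in> sigma_rays \<sigma>"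
  shows "\<xi> \<in> extensional {0..}" "0 \<le> s \<Longrightarrow> 0 \<le> t \<Longrightarrow> dist (\<xi> s) (\<xi> t) = \<bar>s - t\<bar>"
    and "0 \<le> t \<Longrightarrow> 0 \<le> r \<Longrightarrow> r \<le> 1 \<Longrightarrow> \<sigma> (\<xi> 0) (\<xi> t) r = \<xi> (r * t)"
proof -
  show "\<xi> \<in> extensional {0..}" using assms unfolding sigma_rays_def by auto
  have iso: "dist (\<xi> s) (\<xi> t) = \<bar>s - t\<bar>" if "0 \<le> s" "0 \<le> t" for s t
    using assms that unfolding sigma_rays_def by auto
  then show "0 \<le> s \<Longrightarrow> 0 \<le> t \<Longrightarrow> dist (\<xi> s) (\<xi> t) = \<bar>s - t\<bar>" .
  assume t: "0 \<le> t" and r: "0 \<le> r" "r \<le> 1"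
  have "\<sigma> (\<xi> 0) (\<xi> t) ` {0..1} = \<xi> ` {0..t}"
    using assms t unfolding sigma_rays_def by auto
  moreover have "\<sigma> (\<xi> 0) (\<xi> t) r \<in> \<sigma> (\<xi> 0) (\<xi> t) ` {0..1}" using r by simp
  ultimately obtain s where s: "0 \<le> s" "s \<le> t" "\<sigma> (\<xi> 0) (\<xi> t) r = \<xi> s" by auto
  have "s = r * t"
    using dist_start_sigma[OF r, of "\<xi> 0" "\<xi> t"] s iso[of 0 s] iso[of 0 t] t by simp
  with s show "\<sigma> (\<xi> 0) (\<xi> t) r = \<xi> (r * t)" by simp
qed

lemma raysI:
  assumes "\<xi> \<in> extensional {0..}"
    and iso: "\<And>s t. 0 \<le> s \<Longrightarrow> 0 \<le> t \<Longrightarrow> dist (\<xi> s) (\<xi> t) = \<bar>s - t\<bar>"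
    and ray: "\<And>t r. 0 \<le> t \<Longrightarrow> 0 \<le> r \<Longrightarrow> r \<le> 1 \<Longrightarrow> \<sigma> (\<xi> 0) (\<xi> t) r = \<xi> (r * t)"
  shows "\<xi> \<in> sigma_rays \<sigma>"
proof -
  have "\<sigma> (\<xi> 0) (\<xi> t) ` {0..1} = \<xi> ` {0..t}" if "0 \<le> t" for t
  proof -
    have "(\<lambda>r. r * t) ` {0..1} = {0..t}"
    proof (cases "t = 0")
      case False
      have "s \<in> (\<lambda>r. r * t) ` {0..1}" if "s \<in> {0..t}" for s
        by (rule image_eqI[of _ _ "s / t"]) (use that False \<open>0 \<le> t\<close> in auto)
      then show ?thesis using \<open>0 \<le> t\<close> by (auto simp: mult_left_le_one_le)
    qed (auto simp: image_constant_conv)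
    then have "\<xi> ` {0..t} = (\<lambda>r. \<xi> (r * t)) ` {0..1}"
      by (metis (no_types) image_image)
    also have "\<dots> = \<sigma> (\<xi> 0) (\<xi> t) ` {0..1}"
      by (rule image_cong) (use ray that in auto)
    finally show ?thesis by simp
  qed
  then show ?thesis using assms unfolding sigma_rays_def by auto
qed

text \<open>Conicality with a common start: at time \<open>s\<close> both rays are at parameter
  \<open>s / t\<close> of the segments to their points at time \<open>t\<close>.\<close>

lemma dist_rays_le:
  assumes "\<xi> \<in> sigma_rays \<sigma>" "\<zeta> \<in> sigma_rays \<sigma>" "\<xi> 0 = \<zeta> 0" "0 \<le> s" "s \<le> t" "0 < t"
  shows "dist (\<xi> s) (\<zeta> s) \<le> (s / t) * dist (\<xi> t) (\<zeta> t)"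
  using dist_sigma_from_le[of "s / t" "\<xi> 0" "\<xi> t" "\<zeta> t"] raysD(3)[OF assms(1), of t "s / t"]
    raysD(3)[OF assms(2), of t "s / t"] assms by simp

text \<open>Distinct rays with the same start diverge at least linearly, so a bound at arbitrarily
  late times already makes them equal. The contrapositive, that distinct rays are eventually further
  apart than any constant, is used in \<open>rays_avoid_neighbourhood\<close>.\<close>

lemma rays_eqI:
  assumes \<xi>: "\<xi> \<in> sigma_rays \<sigma>" and \<zeta>: "\<zeta> \<in> sigma_rays \<sigma>" and start: "\<xi> 0 = \<zeta> 0"
    and bd: "\<And>T. \<exists>t\<ge>T. dist (\<xi> t) (\<zeta> t) \<le> C"
  shows "\<xi> = \<zeta>"
proof -
  have "\<xi> s = \<zeta> s" if s: "0 \<le> s" for s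
  proof -
    have "dist (\<xi> s) (\<zeta> s) \<le> 0 + e" if e: "0 < e" for e
    proof -
      \<comment> \<open>With \<open>t\<close> beyond \<open>s * \<bar>C\<bar> / e\<close> the factor
        \<open>s / t\<close> brings the bound below \<open>e\<close>; \<open>s + 1\<close> keeps
        \<open>t\<close> positive and later than \<open>s\<close>.\<close>
      obtain t where t: "t \<ge> max (s + 1) (s * \<bar>C\<bar> / e)" "dist (\<xi> t) (\<zeta> t) \<le> C"
        using bd by blast
      have "dist (\<xi> s) (\<zeta> s) \<le> (s / t) * dist (\<xi> t) (\<zeta> t)"
        using dist_rays_le[OF \<xi> \<zeta> start s, of t] t s by simp
      also have "\<dots> \<le> (s / t) * \<bar>C\<bar>"
        using t s by (intro mult_left_mono) auto
      also have "\<dots> \<le> e"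
      proof -
        have "s * \<bar>C\<bar> \<le> t * e" using t e by (simp add: field_simps)
        then show ?thesis using t s by (simp add: divide_le_eq mult.commute)
      qed
      finally show ?thesis by simp
    qed
    then show ?thesis using field_le_epsilon[of "dist (\<xi> s) (\<zeta> s)" 0] by fastforce
  qed
  then show ?thesis
    using extensionalityI[OF raysD(1)[OF \<xi>] raysD(1)[OF \<zeta>]] by simp
qed

text \<open>The product of the compact balls is compact by Tychonoff and, the index set being
  countable, sequentially compact. One subsequence then serves all indices, in place of a diagonal
  argument.\<close>

lemma seq_compact_product:
  fixes u :: "nat \<Rightarrow> nat \<Rightarrow> 'x"
  assumes "\<And>k n. u k n \<in> cball p (real n)"
  obtains v r where "strict_mono r" "\<And>n. (\<lambda>k. u (r k) n) \<longlonglongrightarrow> v n"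
proof -
  let ?K = "Pi\<^sub>E UNIV (\<lambda>n. cball p (real n))"
  have "compactin (product_topology (\<lambda>i::nat. euclidean) UNIV) ?K"
    unfolding compactin_PiE using proper unfolding proper_space_def by auto
  then have "compact ?K" by (simp add: euclidean_product_topology)
  then have "seq_compact ?K" by (rule compact_imp_seq_compact)
  moreover have "\<forall>k. u k \<in> ?K" using assms by (simp add: PiE_def)
  ultimately obtain v r where "strict_mono r" and lim: "(u \<circ> r) \<longlonglongrightarrow> v"
    unfolding seq_compact_def by blast
  moreover have "(\<lambda>k. u (r k) n) \<longlonglongrightarrow> v n" for n
  proof -
    have "continuous_on UNIV (\<lambda>f. f n :: 'x)" by (rule continuous_on_product_coordinates)
    from continuous_on_tendsto_compose[OF this lim] show ?thesis by (simp add: o_def)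
  qed
  ultimately show thesis using that by blast
qed

text \<open>Properness gives a subsequence converging at all integer times, and conicality contracts
  this convergence to every earlier time. The constructions in \<open>asymptotic_ray_from\<close>,
  \<open>axis_ray\<close> and \<open>side_ray\<close> all take such limits.\<close>

lemma ray_limit:
  fixes y :: "nat \<Rightarrow> 'x"
  assumes inf: "filterlim (\<lambda>k. dist p (y k)) at_top sequentially"
  obtains \<xi> r where "\<xi> \<in> sigma_rays \<sigma>" "\<xi> 0 = p" "strict_mono r"
    "\<And>t. 0 \<le> t \<Longrightarrow> (\<lambda>k. \<sigma> p (y (r k)) (t / dist p (y (r k)))) \<longlonglongrightarrow> \<xi> t"
proof -
  \<comment> \<open>\<open>min 1\<close> stops a segment at its end when it is shorter than
    \<open>t\<close>, and for \<open>y k = p\<close> it is constant. So the point at time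
    \<open>n\<close> always lies in the ball of radius \<open>n\<close>.\<close>
  define u where "u k t = \<sigma> p (y k) (min 1 (t / dist p (y k)))" for k t
  have "u k (real n) \<in> cball p (real n)" for k n
  proof (cases "dist p (y k) = 0")
    case True then show ?thesis by (simp add: u_def)
  next
    case False
    then have "dist p (u k (real n)) = min 1 (real n / dist p (y k)) * dist p (y k)"
      unfolding u_def by (intro dist_start_sigma) auto
    also have "\<dots> \<le> real n / dist p (y k) * dist p (y k)"
      by (intro mult_right_mono) auto
    finally show ?thesis using False by simp
  qed
  then obtain v r where r: "strict_mono r" and v: "\<And>n. (\<lambda>k. u (r k) (real n)) \<longlonglongrightarrow> v n"
    using seq_compact_product[of "\<lambda>k n. u k (real n)" p] by blast
  define d where "d k = dist p (y (r k))" for k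
  define w where "w k t = \<sigma> p (y (r k)) (t / d k)" for k t
  have dinf: "filterlim d at_top sequentially"
    using filterlim_compose[OF inf filterlim_subseq[OF r]] unfolding d_def by simp
  have ev: "eventually (\<lambda>k. d k > a) sequentially" for a
    using dinf by (auto simp: filterlim_at_top_dense)
  define n where "n t = nat \<lceil>t\<rceil> + 1" for t :: real
  have n: "t < real (n t)" "0 < real (n t)" for t unfolding n_def by linarith+
  define \<xi> where "\<xi> = restrict (\<lambda>t. \<sigma> p (v (n t)) (t / n t)) {0..}"
  have lim: "(\<lambda>k. w k t) \<longlonglongrightarrow> \<xi> t" if t: "0 \<le> t" for t
  proof -
    have "eventually (\<lambda>k. dist (w k t) (\<xi> t) \<le> dist (u (r k) (n t)) (v (n t))) sequentially"
      using ev[of "real (n t)"]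
    proof eventually_elim
      case (elim k)
      have nd: "0 < d k" "real (n t) / d k \<le> 1" using elim n[of t] by auto
      have tn: "0 \<le> t / real (n t)" "t / real (n t) \<le> 1"
        using n[of t] t by auto
      have "u (r k) (n t) = \<sigma> p (y (r k)) (real (n t) / d k)"
        unfolding u_def using nd by (simp add: d_def)
      then have "\<sigma> p (u (r k) (n t)) (t / n t) = w k t"
        using sigma_initial_segment[OF tn, of "real (n t) / d k" p "y (r k)"] nd n[of t]
        by (simp add: w_def)
      then have "dist (w k t) (\<xi> t) \<le> t / n t * dist (u (r k) (n t)) (v (n t))"
        unfolding \<xi>_def using dist_sigma_from_le[OF tn, of p "u (r k) (n t)" "v (n t)"] t by simp
      also have "\<dots> \<le> 1 * dist (u (r k) (n t)) (v (n t))"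
        using tn by (intro mult_right_mono) auto
      finally show ?case by simp
    qed
    then show ?thesis by (rule metric_tendsto_imp_tendsto[OF v])
  qed
  have \<xi>0: "\<xi> 0 = p" by (simp add: \<xi>_def)
  have "\<xi> \<in> sigma_rays \<sigma>"
  proof (rule raysI)
    show "\<xi> \<in> extensional {0..}" by (simp add: \<xi>_def)
  next
    fix s t :: real assume st: "0 \<le> s" "0 \<le> t"
    have "(\<lambda>k. dist (w k s) (w k t)) \<longlonglongrightarrow> dist (\<xi> s) (\<xi> t)"
      by (intro tendsto_dist lim st)
    moreover have "eventually (\<lambda>k. dist (w k s) (w k t) = \<bar>s - t\<bar>) sequentially"
      using ev[of "max s t"]
    proof eventually_elim
      case (elim k)
      then have "dist (w k s) (w k t) = \<bar>s / d k - t / d k\<bar> * d k"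
        unfolding w_def d_def using st by (intro dist_sigma_sigma) (auto simp: d_def divide_le_eq_1)
      also have "\<dots> = \<bar>s - t\<bar>"
      proof -
        have "s / d k - t / d k = (s - t) / d k" by (simp add: diff_divide_distrib)
        then show ?thesis using elim st by (simp add: abs_divide)
      qed
      finally show ?case .
    qed
    ultimately show "dist (\<xi> s) (\<xi> t) = \<bar>s - t\<bar>"
      by (metis tendsto_eventually LIMSEQ_unique)
  next
    fix t r' :: real assume t: "0 \<le> t" and r': "0 \<le> r'" "r' \<le> 1"
    have "dist (\<sigma> p (w k t) r') (\<sigma> p (\<xi> t) r') \<le> dist (w k t) (\<xi> t)" for k
      using dist_sigma_from_le[OF r', of p "w k t" "\<xi> t"] r'
        mult_right_mono[of r' 1 "dist (w k t) (\<xi> t)"] by simp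
    then have "(\<lambda>k. \<sigma> p (w k t) r') \<longlonglongrightarrow> \<sigma> p (\<xi> t) r'"
      by (intro metric_tendsto_imp_tendsto[OF lim[OF t]] always_eventually allI)
    moreover have "eventually (\<lambda>k. \<sigma> p (w k t) r' = w k (r' * t)) sequentially"
      using ev[of t]
    proof eventually_elim
      case (elim k)
      then show ?case
        unfolding w_def using sigma_initial_segment[OF r', of "t / d k" p "y (r k)"] t by simp
    qed
    ultimately have "(\<lambda>k. w k (r' * t)) \<longlonglongrightarrow> \<sigma> p (\<xi> t) r'"
      by (rule Lim_transform_eventually)
    then show "\<sigma> (\<xi> 0) (\<xi> t) r' = \<xi> (r' * t)"
      unfolding \<xi>0 using lim[of "r' * t"] t r' LIMSEQ_unique by fastforce
  qed
  then show thesis using that[of \<xi> r] \<xi>0 r lim unfolding w_def d_def by blast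
qed

section \<open>Boundary classes and their representatives\<close>

definition ray_class :: "(real \<Rightarrow> 'x) \<Rightarrow> (real \<Rightarrow> 'x) set"
  where "ray_class \<xi> = {\<zeta> \<in> sigma_rays \<sigma>. asymptotic \<xi> \<zeta>}"

lemma ray_class_eq:
  assumes "asymptotic \<xi> \<zeta>"
  shows "ray_class \<xi> = ray_class \<zeta>"
  unfolding ray_class_def using asymptotic_sym[OF assms] assms asymptotic_trans by blast

lemma sigma_boundary_eq: "sigma_boundary \<sigma> = ray_class ` sigma_rays \<sigma>"
  unfolding sigma_boundary_def quotient_def ray_class_def by auto

lemma asymptotic_same_start:
  assumes "\<xi> \<in> sigma_rays \<sigma>" "\<zeta> \<in> sigma_rays \<sigma>" "\<xi> 0 = \<zeta> 0" "asymptotic \<xi> \<zeta>"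
  shows "\<xi> = \<zeta>"
proof -
  obtain C where C: "\<And>t. t \<ge> 0 \<Longrightarrow> dist (\<xi> t) (\<zeta> t) \<le> C"
    using assms unfolding asymptotic_iff by blast
  have "\<exists>t\<ge>T. dist (\<xi> t) (\<zeta> t) \<le> C" for T
    by (rule exI[of _ "max T 0"]) (simp add: C)
  then show ?thesis by (rule rays_eqI[OF assms(1-3)])
qed

text \<open>Segments from \<open>p\<close> to \<open>\<xi> k\<close> subconverge to the wanted ray.
  With \<open>\<delta> = dist p (\<xi> 0)\<close>, moving the start costs at most
  \<open>\<delta>\<close> by conicality. The lengths \<open>dist p (\<xi> k)\<close> differ from
  \<open>k\<close> by at most \<open>\<delta>\<close>, so the change of parameter costs another
  \<open>\<delta>\<close>.\<close>

lemma asymptotic_ray_from: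
  assumes \<xi>: "\<xi> \<in> sigma_rays \<sigma>"
  obtains \<zeta> where "\<zeta> \<in> sigma_rays \<sigma>" "\<zeta> 0 = p" "asymptotic \<xi> \<zeta>"
proof -
  define \<delta> where "\<delta> = dist p (\<xi> 0)"
  define d where "d k = dist p (\<xi> (real k))" for k
  have dk: "\<bar>d k - real k\<bar> \<le> \<delta>" for k
    using dist_triangle[of p "\<xi> (real k)" "\<xi> 0"] dist_triangle[of "\<xi> 0" "\<xi> (real k)" p]
      raysD(2)[OF \<xi>, of 0 "real k"] unfolding d_def \<delta>_def by (simp add: dist_commute)
  have "filterlim (\<lambda>k. - \<delta> + real k) at_top sequentially"
    by (intro filterlim_tendsto_add_at_top[OF tendsto_const] filterlim_real_sequentially)
  then have "filterlim d at_top sequentially"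
    by (rule filterlim_at_top_mono) (use dk in \<open>auto simp: abs_le_iff algebra_simps\<close>)
  from ray_limit[OF this[unfolded d_def]]
  obtain \<zeta> r where \<zeta>: "\<zeta> \<in> sigma_rays \<sigma>" "\<zeta> 0 = p" and r: "strict_mono r"
    and lim: "\<And>t. 0 \<le> t \<Longrightarrow> (\<lambda>k. \<sigma> p (\<xi> (real (r k))) (t / d (r k))) \<longlonglongrightarrow> \<zeta> t"
    unfolding d_def by metis
  have "dist (\<xi> t) (\<zeta> t) \<le> 2 * \<delta>" if t: "0 \<le> t" for t
  proof -
    have ev: "eventually (\<lambda>k. real (r k) > t + \<delta>) sequentially"
      using filterlim_compose[OF filterlim_real_sequentially filterlim_subseq[OF r]]
      by (auto simp: filterlim_at_top_dense)
    have "eventually (\<lambda>k. dist (\<xi> t) (\<sigma> p (\<xi> (real (r k))) (t / d (r k))) \<le> 2 * \<delta>) sequentially"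
      using ev
    proof eventually_elim
      case (elim k)
      define m where "m = real (r k)"
      have \<delta>: "\<delta> \<ge> 0" by (simp add: \<delta>_def)
      have m: "m > t + \<delta>" "m > 0" "d (r k) > t" "d (r k) > 0" "\<bar>d (r k) - m\<bar> \<le> \<delta>"
        using elim dk[of "r k"] t \<delta> unfolding m_def by linarith+
      have tm: "0 \<le> t / m" "t / m \<le> 1" "0 \<le> t / d (r k)" "t / d (r k) \<le> 1"
        using m t \<delta> by (auto simp: divide_le_eq_1)
      have "\<xi> t = \<sigma> (\<xi> 0) (\<xi> m) (t / m)"
        using raysD(3)[OF \<xi>, of m "t / m"] m tm by simp
      then have 1: "dist (\<xi> t) (\<sigma> p (\<xi> m) (t / m)) \<le> (1 - t / m) * \<delta>"
        using conicalD[OF tm(1,2), of "\<xi> 0" "\<xi> m" p "\<xi> m"] by (simp add: \<delta>_def dist_commute)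
      have "(1 - t / m) * \<delta> \<le> 1 * \<delta>"
        using tm \<delta> by (intro mult_right_mono) auto
      moreover have "dist (\<sigma> p (\<xi> m) (t / m)) (\<sigma> p (\<xi> m) (t / d (r k))) \<le> \<delta>"
      proof -
        have "dist (\<sigma> p (\<xi> m) (t / m)) (\<sigma> p (\<xi> m) (t / d (r k))) = \<bar>t / m - t / d (r k)\<bar> * d (r k)"
          using dist_sigma_sigma[OF tm] by (simp add: d_def m_def)
        also have "\<dots> = \<bar>(t / m - t / d (r k)) * d (r k)\<bar>"
          using m by (simp add: abs_mult)
        also have "(t / m - t / d (r k)) * d (r k) = (t / m) * (d (r k) - m)"
          using m by (simp add: field_simps)
        also have "\<bar>\<dots>\<bar> = (t / m) * \<bar>d (r k) - m\<bar>"
          using m t by (simp add: abs_mult)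
        also have "\<dots> \<le> 1 * \<delta>"
          using tm m by (intro mult_mono) auto
        finally show ?thesis by simp
      qed
      ultimately have "dist (\<xi> t) (\<sigma> p (\<xi> m) (t / d (r k))) \<le> 2 * \<delta>"
        using 1 dist_triangle[of "\<xi> t" "\<sigma> p (\<xi> m) (t / d (r k))" "\<sigma> p (\<xi> m) (t / m)"] by linarith
      then show ?case by (simp add: m_def)
    qed
    then show ?thesis
      by (rule tendsto_upperbound[OF tendsto_dist[OF tendsto_const lim[OF t]]]) simp
  qed
  then have "asymptotic \<xi> \<zeta>" unfolding asymptotic_iff by blast
  then show thesis using that \<zeta> by blast
qed

lemma ray_from_class:
  assumes "\<xi> \<in> sigma_rays \<sigma>" "\<xi> 0 = p"
  shows "ray_from p (ray_class \<xi>) = \<xi>"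
  unfolding ray_from_def
proof (rule the_equality)
  show "\<xi> \<in> ray_class \<xi> \<and> \<xi> 0 = p"
    using assms asymptotic_refl by (simp add: ray_class_def)
next
  fix \<zeta> assume "\<zeta> \<in> ray_class \<xi> \<and> \<zeta> 0 = p"
  then show "\<zeta> = \<xi>"
    using asymptotic_same_start[of \<xi> \<zeta>] assms by (simp add: ray_class_def)
qed

lemma boundary_class_from:
  assumes "c \<in> sigma_boundary \<sigma>"
  obtains \<xi> where "\<xi> \<in> sigma_rays \<sigma>" "\<xi> 0 = p" "c = ray_class \<xi>"
proof -
  obtain \<zeta> where "\<zeta> \<in> sigma_rays \<sigma>" "c = ray_class \<zeta>"
    using assms unfolding sigma_boundary_eq by blast
  then show thesis
    using asymptotic_ray_from[of \<zeta> p] ray_class_eq that by metis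
qed

text \<open>Cut the interval into steps shorter than 1. Off \<open>B\<close> the two sides are at
  distance at least 1, so no step changes side.\<close>

lemma stays_on_side:
  fixes f :: "real \<Rightarrow> 'x" and a b :: real
  assumes lip: "\<And>s t. a \<le> s \<Longrightarrow> s \<le> t \<Longrightarrow> t \<le> b \<Longrightarrow> dist (f s) (f t) \<le> t - s"
    and avoid: "\<And>s. a \<le> s \<Longrightarrow> s \<le> b \<Longrightarrow> f s \<notin> B"
    and cover: "- B \<subseteq> A1 \<union> A2"
    and sep: "\<And>y z. y \<in> A1 - B \<Longrightarrow> z \<in> A2 - B \<Longrightarrow> dist y z \<ge> 1"
    and ab: "a \<le> b"
  shows "f a \<in> A1 \<longleftrightarrow> f b \<in> A1"
proof -
  have step: "f s \<in> A1 \<longleftrightarrow> f t \<in> A1" if "a \<le> s" "s \<le> t" "t \<le> b" "t - s < 1" for s t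
  proof -
    have "dist (f s) (f t) < 1" using lip[of s t] that by simp
    moreover have "f s \<notin> B" "f t \<notin> B" using avoid that by auto
    ultimately show ?thesis
      using sep[of "f s" "f t"] sep[of "f t" "f s"] cover by (fastforce simp: dist_commute)
  qed
  have "f a \<in> A1 \<longleftrightarrow> f (a + (b - a) * real i / real n) \<in> A1" if n: "n > b - a" "i \<le> n" for i n :: nat
    using n(2)
  proof (induction i)
    case (Suc i)
    have n0: "real n > 0" using n ab by linarith
    have "f (a + (b - a) * real i / real n) \<in> A1 \<longleftrightarrow> f (a + (b - a) * real (Suc i) / real n) \<in> A1"
    proof (rule step)
      have "(b - a) * (real (Suc i) / real n) \<le> (b - a) * 1"
        using ab Suc.prems n0 by (intro mult_left_mono) auto
      then show "a + (b - a) * real (Suc i) / real n \<le> b" by simp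
      show "a + (b - a) * real (Suc i) / real n - (a + (b - a) * real i / real n) < 1"
      proof -
        have "a + (b - a) * real (Suc i) / real n - (a + (b - a) * real i / real n) = (b - a) / real n"
          by (simp add: algebra_simps add_divide_distrib diff_divide_distrib)
        then show ?thesis using n n0 by simp
      qed
      show "a + (b - a) * real i / real n \<le> a + (b - a) * real (Suc i) / real n"
        using ab n0 by (auto simp: divide_right_mono mult_left_mono)
    qed (use ab n0 in auto)
    then show ?case using Suc by simp
  qed simp
  moreover obtain n :: nat where n: "real n > b - a" using reals_Archimedean2 by blast
  moreover have "a + (b - a) * real n / real n = b" using n ab by simp
  ultimately show ?thesis by (metis order_refl)
qed

lemma topspace_boundary: "topspace (boundary_topology \<sigma> p) = sigma_boundary \<sigma>"
proof -
  have "c \<in> \<Union> {{b \<in> sigma_boundary \<sigma>. dist (ray_from p b t) (ray_from p a t) < \<epsilon>} | a t \<epsilon>.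
      a \<in> sigma_boundary \<sigma> \<and> 0 \<le> t \<and> 0 < \<epsilon>}" if "c \<in> sigma_boundary \<sigma>" for c
  proof
    show "c \<in> {b \<in> sigma_boundary \<sigma>. dist (ray_from p b 0) (ray_from p c 0) < 1}"
      using that by simp
    show "{b \<in> sigma_boundary \<sigma>. dist (ray_from p b 0) (ray_from p c 0) < 1} \<in>
      {{b \<in> sigma_boundary \<sigma>. dist (ray_from p b t) (ray_from p a t) < \<epsilon>} | a t \<epsilon>.
      a \<in> sigma_boundary \<sigma> \<and> 0 \<le> t \<and> 0 < \<epsilon>}" using that zero_less_one order_refl by blast
  qed
  then show ?thesis
    unfolding boundary_topology_def topology_generated_by_topspace by blast
qed

text \<open>Unique representatives at \<open>p\<close> turn the generating sets of the topology into
  conditions on one point of each ray. A single generating set around each point, intersected with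
  \<open>M\<close>, then shows openness.\<close>

lemma boundary_openI:
  assumes "S \<subseteq> sigma_boundary \<sigma>"
    and "\<And>\<xi>. \<xi> \<in> sigma_rays \<sigma> \<Longrightarrow> \<xi> 0 = p \<Longrightarrow> ray_class \<xi> \<in> S \<Longrightarrow> \<exists>t\<ge>0. \<exists>\<epsilon>>0. \<forall>\<zeta>\<in>sigma_rays \<sigma>.
      \<zeta> 0 = p \<longrightarrow> ray_class \<zeta> \<in> M \<longrightarrow> dist (\<zeta> t) (\<xi> t) < \<epsilon> \<longrightarrow> ray_class \<zeta> \<in> S"
    and "S \<subseteq> M"
  shows "openin (subtopology (boundary_topology \<sigma> p) M) S"
proof (subst openin_subopen, intro ballI)
  fix c assume c: "c \<in> S"
  obtain \<xi> where \<xi>: "\<xi> \<in> sigma_rays \<sigma>" "\<xi> 0 = p" "c = ray_class \<xi>"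
    using boundary_class_from[of c p] c assms(1) by blast
  obtain t \<epsilon> where t: "t \<ge> 0" "\<epsilon> > 0" and *: "\<And>\<zeta>. \<zeta> \<in> sigma_rays \<sigma> \<Longrightarrow> \<zeta> 0 = p \<Longrightarrow> ray_class \<zeta> \<in> M \<Longrightarrow>
      dist (\<zeta> t) (\<xi> t) < \<epsilon> \<Longrightarrow> ray_class \<zeta> \<in> S"
    using assms(2)[of \<xi>] \<xi> c by blast
  let ?W = "{b \<in> sigma_boundary \<sigma>. dist (ray_from p b t) (ray_from p c t) < \<epsilon>}"
  have "openin (boundary_topology \<sigma> p) ?W"
    unfolding boundary_topology_def
    by (rule topology_generated_by_Basis) (use t c assms(1) in blast)
  then have "openin (subtopology (boundary_topology \<sigma> p) M) (?W \<inter> M)"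
    by (auto simp: openin_subtopology)
  moreover have "c \<in> ?W \<inter> M" using c assms t by auto
  moreover have "?W \<inter> M \<subseteq> S"
  proof
    fix b assume b: "b \<in> ?W \<inter> M"
    then obtain \<zeta> where \<zeta>: "\<zeta> \<in> sigma_rays \<sigma>" "\<zeta> 0 = p" "b = ray_class \<zeta>"
      using boundary_class_from[of b p] by blast
    then show "b \<in> S" using b \<xi> ray_from_class[of \<zeta> p] ray_from_class[of \<xi> p] *[of \<zeta>] by simp
  qed
  ultimately show "\<exists>T. openin (subtopology (boundary_topology \<sigma> p) M) T \<and> c \<in> T \<and> T \<subseteq> S" by blast
qed

lemma ray_class_inj:
  assumes "\<xi> \<in> sigma_rays \<sigma>" "\<zeta> \<in> sigma_rays \<sigma>" "\<xi> 0 = \<zeta> 0" "ray_class \<xi> = ray_class \<zeta>"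
  shows "\<xi> = \<zeta>"
  using ray_from_class[of \<xi> "\<xi> 0"] ray_from_class[of \<zeta> "\<xi> 0"] assms by simp

text \<open>By \<open>near\<close>, \<open>\<eta>\<close> and \<open>\<eta>'\<close> are the only
  rays along which \<open>B\<close> can run to infinity. If rays close to \<open>\<zeta>\<close> at
  late times met \<open>B\<close> afterwards, \<open>\<zeta>\<close> would at these times be within
  \<open>C + 1\<close> of \<open>\<eta>\<close> or \<open>\<eta>'\<close>, which
  \<open>rays_eqI\<close> excludes from some time on. The time \<open>T\<close> serves all rays near
  \<open>\<zeta>\<close>, and this later makes the sides open.\<close>

lemma rays_avoid_neighbourhood:
  assumes \<eta>: "\<eta> \<in> sigma_rays \<sigma>" "\<eta> 0 = p" "\<eta>' \<in> sigma_rays \<sigma>" "\<eta>' 0 = p"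
    and near: "\<And>y T. y \<in> B \<Longrightarrow> 0 \<le> T \<Longrightarrow> T \<le> dist p y \<Longrightarrow>
      dist (\<sigma> p y (T / dist p y)) (\<eta> T) \<le> C \<or> dist (\<sigma> p y (T / dist p y)) (\<eta>' T) \<le> C"
    and \<zeta>: "\<zeta> \<in> sigma_rays \<sigma>" "\<zeta> 0 = p" "\<zeta> \<noteq> \<eta>" "\<zeta> \<noteq> \<eta>'"
  shows "\<exists>T\<ge>0. T \<ge> T0 \<and> (\<forall>\<zeta>' t. \<zeta>' \<in> sigma_rays \<sigma> \<longrightarrow> \<zeta>' 0 = p \<longrightarrow>
    dist (\<zeta>' T) (\<zeta> T) < 1 \<longrightarrow> T \<le> t \<longrightarrow> \<zeta>' t \<notin> B)"
proof (rule ccontr)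
  assume contr: "\<not> ?thesis"
  have alt: "dist (\<zeta> T) (\<eta> T) \<le> C + 1 \<or> dist (\<zeta> T) (\<eta>' T) \<le> C + 1" if T: "T \<ge> T0" "T \<ge> 1" for T
  proof -
    have "T \<ge> 0" using T by simp
    with T(1) contr obtain \<zeta>' t where z: "\<zeta>' \<in> sigma_rays \<sigma>" "\<zeta>' 0 = p" "dist (\<zeta>' T) (\<zeta> T) < 1"
      "T \<le> t" "\<zeta>' t \<in> B"
      by blast
    have "dist p (\<zeta>' t) = t" using raysD(2)[OF z(1), of 0 t] z T by simp
    moreover have "\<sigma> p (\<zeta>' t) (T / t) = \<zeta>' T"
      using raysD(3)[OF z(1), of t "T / t"] z T by simp
    ultimately have "dist (\<zeta>' T) (\<eta> T) \<le> C \<or> dist (\<zeta>' T) (\<eta>' T) \<le> C"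
      using near[OF z(5), of T] z T by simp
    then show ?thesis
      using z(3) dist_triangle[of "\<zeta> T" "\<eta> T" "\<zeta>' T"] dist_triangle[of "\<zeta> T" "\<eta>' T" "\<zeta>' T"]
      by (auto simp: dist_commute)
  qed
  have "\<exists>S. \<forall>T\<ge>S. \<not> dist (\<zeta> T) (\<eta> T) \<le> C + 1"
    using rays_eqI[OF \<zeta>(1) \<eta>(1), of "C + 1"] \<zeta> \<eta> by auto
  moreover have "\<exists>S. \<forall>T\<ge>S. \<not> dist (\<zeta> T) (\<eta>' T) \<le> C + 1"
    using rays_eqI[OF \<zeta>(1) \<eta>(3), of "C + 1"] \<zeta> \<eta> by auto
  ultimately obtain S S' where "\<forall>T\<ge>S. \<not> dist (\<zeta> T) (\<eta> T) \<le> C + 1"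
    "\<forall>T\<ge>S'. \<not> dist (\<zeta> T) (\<eta>' T) \<le> C + 1"
    by blast
  then show False
    using alt[of "max (max S S') (max T0 1)"] by (auto simp: le_max_iff_disj)
qed

text \<open>\<open>B\<close> is a wall whose only possible ends are \<open>\<eta>\<close> and
  \<open>\<eta>'\<close>. Any other ray eventually avoids \<open>B\<close> and stays on one side by
  \<open>stays_on_side\<close>, and nearby rays stay on the same side. So the sides split the rest
  of the boundary into two open sets, nonempty because of \<open>\<xi>1\<close> and
  \<open>\<xi>2\<close>.\<close>

lemma boundary_pair_separates:
  assumes \<eta>: "\<eta> \<in> sigma_rays \<sigma>" "\<eta> 0 = p" "\<eta>' \<in> sigma_rays \<sigma>" "\<eta>' 0 = p" "\<eta> \<noteq> \<eta>'"
    and near: "\<And>y T. y \<in> B \<Longrightarrow> 0 \<le> T \<Longrightarrow> T \<le> dist p y \<Longrightarrow>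
      dist (\<sigma> p y (T / dist p y)) (\<eta> T) \<le> C \<or> dist (\<sigma> p y (T / dist p y)) (\<eta>' T) \<le> C"
    and cover: "- B \<subseteq> A1 \<union> A2"
    and sep: "\<And>y z. y \<in> A1 - B \<Longrightarrow> z \<in> A2 - B \<Longrightarrow> dist y z \<ge> 1"
    and \<xi>1: "\<xi>1 \<in> sigma_rays \<sigma>" "\<xi>1 0 = p" "\<xi>1 \<noteq> \<eta>" "\<xi>1 \<noteq> \<eta>'" "\<And>t. t \<ge> T1 \<Longrightarrow> \<xi>1 t \<in> A1 - B"
    and \<xi>2: "\<xi>2 \<in> sigma_rays \<sigma>" "\<xi>2 0 = p" "\<xi>2 \<noteq> \<eta>" "\<xi>2 \<noteq> \<eta>'" "\<And>t. t \<ge> T2 \<Longrightarrow> \<xi>2 t \<in> A2 - B"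
  shows "\<exists>a \<in> sigma_boundary \<sigma>. \<exists>b \<in> sigma_boundary \<sigma>. a \<noteq> b \<and>
    \<not> connected_space (subtopology (boundary_topology \<sigma> p) (sigma_boundary \<sigma> - {a, b}))"
proof -
  let ?a = "ray_class \<eta>" and ?b = "ray_class \<eta>'"
  define M where "M = sigma_boundary \<sigma> - {?a, ?b}"
  define R where "R = {\<zeta> \<in> sigma_rays \<sigma>. \<zeta> 0 = p \<and> \<zeta> \<noteq> \<eta> \<and> \<zeta> \<noteq> \<eta>'}"
  define S where "S A = ray_class ` {\<zeta> \<in> R. \<exists>T. \<forall>t\<ge>T. \<zeta> t \<in> A - B}" for A
  have MR: "M = ray_class ` R"
  proof
    show "M \<subseteq> ray_class ` R"
    proof
      fix c assume c: "c \<in> M"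
      then obtain \<xi> where "\<xi> \<in> sigma_rays \<sigma>" "\<xi> 0 = p" "c = ray_class \<xi>"
        using boundary_class_from[of c p] by (auto simp: M_def)
      then show "c \<in> ray_class ` R" using c by (auto simp: M_def R_def)
    qed
    show "ray_class ` R \<subseteq> M"
      using ray_class_inj \<eta> by (fastforce simp: M_def R_def sigma_boundary_eq)
  qed
  have inM: "\<zeta> \<in> R" if "ray_class \<zeta> \<in> M" "\<zeta> \<in> sigma_rays \<sigma>" "\<zeta> 0 = p" for \<zeta>
    using that by (auto simp: M_def R_def)
  have avoid: "\<exists>T\<ge>0. T \<ge> T0 \<and> (\<forall>\<zeta>' t. \<zeta>' \<in> sigma_rays \<sigma> \<longrightarrow> \<zeta>' 0 = p \<longrightarrow> dist (\<zeta>' T) (\<zeta> T) < 1 \<longrightarrow> T \<le> t \<longrightarrow> \<zeta>' t \<notin> B)"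
    if "\<zeta> \<in> R" for \<zeta> T0
  proof -
    have z: "\<zeta> \<in> sigma_rays \<sigma>" "\<zeta> 0 = p" "\<zeta> \<noteq> \<eta>" "\<zeta> \<noteq> \<eta>'" using that by (auto simp: R_def)
    show ?thesis
      by (rule rays_avoid_neighbourhood[OF \<eta>(1-4) near z])
  qed
  have stay: "\<zeta> t \<in> A - B"
    if "\<zeta> \<in> sigma_rays \<sigma>" "T \<ge> 0" "\<And>t. T \<le> t \<Longrightarrow> \<zeta> t \<notin> B" "\<zeta> T \<in> A" "T \<le> t"
      "- B \<subseteq> A \<union> A'" "\<And>y z. y \<in> A - B \<Longrightarrow> z \<in> A' - B \<Longrightarrow> dist y z \<ge> 1" for A A' \<zeta> T t
  proof -
    have "\<zeta> T \<in> A \<longleftrightarrow> \<zeta> t \<in> A"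
    proof (rule stays_on_side[of T t \<zeta> B A A'])
      fix s s' assume "T \<le> s" "s \<le> s'" "s' \<le> t"
      then show "dist (\<zeta> s) (\<zeta> s') \<le> s' - s" using raysD(2)[OF that(1), of s s'] that(2) by simp
    qed (use that in auto)
    then show ?thesis using that(3,4,5) by blast
  qed
  have opn: "openin (subtopology (boundary_topology \<sigma> p) M) (S A)"
    if cov: "- B \<subseteq> A \<union> A'" and sp: "\<And>y z. y \<in> A - B \<Longrightarrow> z \<in> A' - B \<Longrightarrow> dist y z \<ge> 1" for A A'
  proof (rule boundary_openI)
    show "S A \<subseteq> M" "S A \<subseteq> sigma_boundary \<sigma>" unfolding MR S_def R_def sigma_boundary_eq by auto
    fix \<xi> assume \<xi>: "\<xi> \<in> sigma_rays \<sigma>" "\<xi> 0 = p" "ray_class \<xi> \<in> S A"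
    then obtain \<zeta> T0 where z: "\<zeta> \<in> R" "\<And>t. t \<ge> T0 \<Longrightarrow> \<zeta> t \<in> A - B" "ray_class \<xi> = ray_class \<zeta>"
      unfolding S_def by blast
    have "\<xi> = \<zeta>" using z \<xi> ray_class_inj[of \<xi> \<zeta>] by (auto simp: R_def)
    with z have z: "\<xi> \<in> R" "\<And>t. t \<ge> T0 \<Longrightarrow> \<xi> t \<in> A - B" by auto
    obtain T where T: "T \<ge> T0" "T \<ge> 0" "\<And>\<zeta>' t. \<zeta>' \<in> sigma_rays \<sigma> \<Longrightarrow> \<zeta>' 0 = p \<Longrightarrow>
        dist (\<zeta>' T) (\<xi> T) < 1 \<Longrightarrow> T \<le> t \<Longrightarrow> \<zeta>' t \<notin> B"
      using avoid[OF z(1), of T0] by blast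
    have "ray_class \<zeta> \<in> S A" if \<zeta>: "\<zeta> \<in> sigma_rays \<sigma>" "\<zeta> 0 = p" "ray_class \<zeta> \<in> M" "dist (\<zeta> T) (\<xi> T) < 1" for \<zeta>
    proof -
      have nB: "\<zeta> t \<notin> B" if "T \<le> t" for t using T(3)[OF \<zeta>(1,2,4) that] .
      \<comment> \<open>At time \<open>T\<close> the nearby ray is within 1 of a point of
        \<open>A - B\<close>, too close to be on the other side.\<close>
      have "\<zeta> T \<in> A"
      proof (rule ccontr)
        assume "\<zeta> T \<notin> A"
        then have "\<zeta> T \<in> A' - B" using nB[of T] cov by auto
        then show False using sp[of "\<xi> T" "\<zeta> T"] z(2)[OF T(1)] \<zeta>(4) by (simp add: dist_commute)
      qed
      then have "\<zeta> t \<in> A - B" if "T \<le> t" for t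
        using stay[OF \<zeta>(1) T(2) nB _ that cov sp] by blast
      then show ?thesis unfolding S_def using inM[OF \<zeta>(3,1,2)] by blast
    qed
    then show "\<exists>t\<ge>0. \<exists>\<epsilon>>0. \<forall>\<zeta>\<in>sigma_rays \<sigma>. \<zeta> 0 = p \<longrightarrow> ray_class \<zeta> \<in> M \<longrightarrow>
        dist (\<zeta> t) (\<xi> t) < \<epsilon> \<longrightarrow> ray_class \<zeta> \<in> S A"
      using T(2) zero_less_one by blast
  qed
  have sep': "\<And>y z. y \<in> A2 - B \<Longrightarrow> z \<in> A1 - B \<Longrightarrow> dist y z \<ge> 1"
    by (subst dist_commute) (rule sep)
  have cover': "- B \<subseteq> A2 \<union> A1" using cover by blast
  have disj: "S A1 \<inter> S A2 = {}"
  proof (rule ccontr)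
    assume "S A1 \<inter> S A2 \<noteq> {}"
    then obtain \<zeta> \<zeta>' T T' where z: "\<zeta> \<in> R" "\<zeta>' \<in> R" "ray_class \<zeta> = ray_class \<zeta>'"
      "\<forall>t\<ge>T. \<zeta> t \<in> A1 - B" "\<forall>t\<ge>T'. \<zeta>' t \<in> A2 - B"
      unfolding S_def by blast
    then have "\<zeta> = \<zeta>'" using ray_class_inj by (auto simp: R_def)
    then show False using z sep[of "\<zeta> (max T T')" "\<zeta> (max T T')"] by auto
  qed
  have "M \<subseteq> S A1 \<union> S A2"
  proof
    fix c assume "c \<in> M"
    then obtain \<zeta> where \<zeta>: "\<zeta> \<in> R" "c = ray_class \<zeta>" unfolding MR by blast
    then have ray: "\<zeta> \<in> sigma_rays \<sigma>" "\<zeta> 0 = p" by (auto simp: R_def)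
    obtain T where T: "T \<ge> 0" "\<And>t. T \<le> t \<Longrightarrow> \<zeta> t \<notin> B"
      using avoid[OF \<zeta>(1), of 0] ray by (metis dist_self zero_less_one)
    then consider "\<zeta> T \<in> A1" | "\<zeta> T \<in> A2" using cover by blast
    then show "c \<in> S A1 \<union> S A2"
    proof cases
      case 1
      then have "\<zeta> t \<in> A1 - B" if "T \<le> t" for t
        using stay[OF ray(1) T 1 that cover sep] by blast
      then show ?thesis using \<zeta> unfolding S_def by blast
    next
      case 2
      then have "\<zeta> t \<in> A2 - B" if "T \<le> t" for t
        using stay[OF ray(1) T 2 that cover' sep'] by blast
      then show ?thesis using \<zeta> unfolding S_def by blast
    qed
  qed
  moreover have "ray_class \<xi>1 \<in> S A1" "ray_class \<xi>2 \<in> S A2"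
    using \<xi>1 \<xi>2 unfolding S_def R_def by blast+
  moreover have "topspace (subtopology (boundary_topology \<sigma> p) M) = M"
    by (auto simp: topspace_boundary M_def)
  ultimately have "\<not> connected_space (subtopology (boundary_topology \<sigma> p) M)"
    unfolding connected_space_def
    using opn[OF cover sep] opn[OF cover' sep'] disj by (metis empty_iff)
  moreover have "?a \<noteq> ?b" using ray_class_inj[of \<eta> \<eta>'] \<eta> by auto
  ultimately show ?thesis using \<eta> unfolding M_def sigma_boundary_eq by blast
qed

end

section \<open>Axes of isometries\<close>

text \<open>Jensen's inequality for the square root. It replaces mean distances by root mean
  squares, so that the variances of successive random steps add up in
  \<open>orbit_near_sigma_pos\<close>.\<close>

lemma sqrt_concave:
  fixes A B t :: real
  assumes "0 \<le> A" "0 \<le> B" "0 \<le> t" "t \<le> 1"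
  shows "(1 - t) * sqrt A + t * sqrt B \<le> sqrt ((1 - t) * A + t * B)"
proof (rule real_le_rsqrt)
  define a b where "a = sqrt A" and "b = sqrt B"
  have "(1 - t) * a\<^sup>2 + t * b\<^sup>2 - ((1 - t) * a + t * b)\<^sup>2 = t * (1 - t) * (a - b)\<^sup>2"
    by (simp add: power2_eq_square algebra_simps)
  moreover have "t * (1 - t) * (a - b)\<^sup>2 \<ge> 0" using assms by simp
  ultimately have "((1 - t) * a + t * b)\<^sup>2 \<le> (1 - t) * a\<^sup>2 + t * b\<^sup>2" by linarith
  then show "((1 - t) * sqrt A + t * sqrt B)\<^sup>2 \<le> (1 - t) * A + t * B"
    using assms by (simp add: a_def b_def)
qed

section \<open>Geometric actions and minimal displacement\<close>

locale geometric_bicombed_space = bicombed_space \<sigma> + group G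
  for \<sigma> :: "'x::metric_space \<Rightarrow> 'x \<Rightarrow> real \<Rightarrow> 'x" and G :: "'g monoid" (structure) +
  fixes \<phi> :: "'g \<Rightarrow> 'x \<Rightarrow> 'x"
  assumes geometric: "geometric_action G \<phi>"
    and reversible: "reversible \<sigma>"
    and equivariant: "equivariant G \<phi> \<sigma>"
begin

lemma mult_inv_cancel:
  assumes "k \<in> carrier G" "z \<in> carrier G"
  shows "k \<otimes> (inv k \<otimes> z) = z" "inv k \<otimes> (k \<otimes> z) = z"
  using assms by (simp_all add: m_assoc[symmetric])

lemma group_action: "group_action G UNIV \<phi>"
  using geometric unfolding geometric_action_def by blast

lemma act_one [simp]: "\<phi> \<one> x = x"
  using group_action.id_eq_one[OF group_action] by (metis iso_tuple_UNIV_I restrict_apply)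

lemma act_mult: "g \<in> carrier G \<Longrightarrow> h \<in> carrier G \<Longrightarrow> \<phi> (g \<otimes> h) x = \<phi> g (\<phi> h x)"
  using group_action.composition_rule[OF group_action] by blast

lemma act_inv [simp]:
  assumes "g \<in> carrier G"
  shows "\<phi> (inv g) (\<phi> g x) = x" "\<phi> g (\<phi> (inv g) x) = x"
  using act_mult[of "inv g" g x] act_mult[of g "inv g" x] assms by simp_all

lemma act_dist [simp]: "g \<in> carrier G \<Longrightarrow> dist (\<phi> g x) (\<phi> g y) = dist x y"
  using geometric unfolding geometric_action_def by blast

lemma dist_act_inv: "g \<in> carrier G \<Longrightarrow> dist (\<phi> g x) y = dist x (\<phi> (inv g) y)"
  by (metis act_dist act_inv(2))

lemma act_sigma:
  "g \<in> carrier G \<Longrightarrow> 0 \<le> t \<Longrightarrow> t \<le> 1 \<Longrightarrow> \<phi> g (\<sigma> x y t) = \<sigma> (\<phi> g x) (\<phi> g y) t"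
  using equivariant unfolding equivariant_def by auto

lemma finite_displacement: "finite {g \<in> carrier G. dist x (\<phi> g x) \<le> r}"
proof -
  have "compact (cball x r)" using proper unfolding proper_space_def by blast
  then have fin: "finite {g \<in> carrier G. \<phi> g ` cball x r \<inter> cball x r \<noteq> {}}"
    using geometric unfolding geometric_action_def by blast
  have "g \<in> {g \<in> carrier G. \<phi> g ` cball x r \<inter> cball x r \<noteq> {}}"
    if g: "g \<in> {g \<in> carrier G. dist x (\<phi> g x) \<le> r}" for g
  proof -
    have "x \<in> cball x r" using g zero_le_dist[of x "\<phi> g x"] by (simp del: zero_le_dist)
    then have "\<phi> g x \<in> \<phi> g ` cball x r \<inter> cball x r" using g by auto
    then show ?thesis using g by blast
  qed
  then show ?thesis by (intro finite_subset[OF _ fin]) blast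
qed

text \<open>The orbits coming within \<open>n\<close> of \<open>x\<close> form an open set of the
  orbit space. These sets increase and cover it, so by compactness one radius serves all
  orbits.\<close>

lemma cobounded:
  obtains R where "R \<ge> 0" "\<And>y. \<exists>g\<in>carrier G. dist y (\<phi> g x) \<le> R"
proof -
  define U where "U n = {O' \<in> orbits G UNIV \<phi>. \<exists>y\<in>O'. dist y x < real n}" for n
  have opn: "openin (orbit_space G \<phi>) A \<longleftrightarrow> A \<subseteq> orbits G UNIV \<phi> \<and> open {x. orbit G \<phi> x \<in> A}" for A
    unfolding orbit_space_def by (simp add: topology_inverse'[OF istopology_orbit_space])
  have "openin (orbit_space G \<phi>) (U n)" for n
  proof -
    have "{z. orbit G \<phi> z \<in> U n} = (\<Union>g\<in>carrier G. ball (\<phi> (inv g) x) (real n))"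
    proof -
      have "orbit G \<phi> z \<in> U n \<longleftrightarrow> (\<exists>g\<in>carrier G. dist (\<phi> g z) x < real n)" for z
        unfolding U_def orbits_def orbit_def by auto
      moreover have "dist (\<phi> g z) x < real n \<longleftrightarrow> z \<in> ball (\<phi> (inv g) x) (real n)" if "g \<in> carrier G" for g z
        using dist_act_inv[OF that, of z x] by (simp add: dist_commute)
      ultimately show ?thesis by auto
    qed
    then show ?thesis unfolding opn by (auto simp: U_def)
  qed
  moreover have top: "topspace (orbit_space G \<phi>) = orbits G UNIV \<phi>"
  proof
    show "topspace (orbit_space G \<phi>) \<subseteq> orbits G UNIV \<phi>"
      using opn openin_topspace by blast
    have "{x. orbit G \<phi> x \<in> orbits G UNIV \<phi>} = UNIV" unfolding orbits_def by auto
    then have "openin (orbit_space G \<phi>) (orbits G UNIV \<phi>)" unfolding opn by simp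
    then show "orbits G UNIV \<phi> \<subseteq> topspace (orbit_space G \<phi>)" by (rule openin_subset)
  qed
  moreover have in_orbit: "\<phi> g z \<in> orbit G \<phi> z" if "g \<in> carrier G" for g z
    using that unfolding orbit_def by blast
  have "O' \<in> \<Union> (range U)" if O': "O' \<in> orbits G UNIV \<phi>" for O'
  proof -
    obtain z where z: "O' = orbit G \<phi> z" using O' unfolding orbits_def by blast
    obtain n where "dist z x < real n" using reals_Archimedean2 by blast
    then have "O' \<in> U n" using O' in_orbit[of \<one> z] z unfolding U_def by auto
    then show ?thesis by blast
  qed
  moreover have "compactin (orbit_space G \<phi>) (topspace (orbit_space G \<phi>))"
    using geometric unfolding geometric_action_def compact_space_def by blast
  moreover have "\<And>V. V \<in> range U \<Longrightarrow> openin (orbit_space G \<phi>) V"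
    using calculation by blast
  ultimately obtain \<F> where F: "finite \<F>" "\<F> \<subseteq> range U" "orbits G UNIV \<phi> \<subseteq> \<Union>\<F>"
    using compactinD[of "orbit_space G \<phi>" "orbits G UNIV \<phi>" "range U"]
    by (metis (no_types, lifting) subsetI)
  then obtain I where I: "finite I" "\<F> = U ` I" by (meson finite_subset_image)
  obtain N where N: "\<And>i. i \<in> I \<Longrightarrow> i \<le> N" using I(1) by (meson finite_nat_set_iff_bounded_le)
  have "\<exists>g\<in>carrier G. dist y (\<phi> g x) \<le> real N" for y
  proof -
    have "orbit G \<phi> y \<in> orbits G UNIV \<phi>" unfolding orbits_def by blast
    then obtain i where i: "i \<in> I" "orbit G \<phi> y \<in> U i" using F(3) I by blast
    then obtain g where g: "g \<in> carrier G" "dist (\<phi> g y) x < real i"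
      unfolding U_def orbit_def by auto
    then have "dist y (\<phi> (inv g) x) \<le> real N"
      using N[OF i(1)] dist_act_inv[OF g(1), of y x] by simp
    then show ?thesis using g(1) by blast
  qed
  then show thesis using that[of "real N"] by simp
qed

text \<open>The midpoint \<open>m\<close> of \<open>y\<close> and \<open>\<phi> a y\<close> is moved
  to the midpoint of the next segment. Reversing that segment lets both end at
  \<open>\<phi> a y\<close>, so conicality bounds \<open>dist m (\<phi> a m)\<close> by half the
  distance from \<open>y\<close> to its image under \<open>a \<otimes> a\<close>. Later
  \<open>Y\<close> is \<open>UNIV\<close> in \<open>axis\<close> and \<open>Tube\<close> in
  \<open>equivariant_map_displacement\<close>.\<close>

lemma displacement_double:
  assumes a: "a \<in> carrier G" and inv: "\<And>y. y \<in> Y \<Longrightarrow> \<phi> a y \<in> Y"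
    and mid: "\<And>y z. y \<in> Y \<Longrightarrow> z \<in> Y \<Longrightarrow> \<sigma> y z (1/2) \<in> Y"
    and L: "\<And>y. y \<in> Y \<Longrightarrow> L \<le> dist y (\<phi> a y)" and y: "y \<in> Y"
  shows "2 * L \<le> dist y (\<phi> (a \<otimes> a) y)"
proof -
  define m where "m = \<sigma> y (\<phi> a y) (1/2)"
  have "\<phi> a m = \<sigma> (\<phi> a y) (\<phi> a (\<phi> a y)) (1/2)"
    unfolding m_def by (rule act_sigma) (use a in auto)
  also have "\<dots> = \<sigma> (\<phi> a (\<phi> a y)) (\<phi> a y) (1/2)"
    using reversible[unfolded reversible_def, rule_format, of "1/2"] by simp
  finally have "dist m (\<phi> a m) \<le> 1/2 * dist y (\<phi> a (\<phi> a y))"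
    using conicalD[of "1/2" y "\<phi> a y" "\<phi> a (\<phi> a y)" "\<phi> a y"] by (simp add: m_def)
  moreover have "m \<in> Y" unfolding m_def using mid inv y by blast
  ultimately show ?thesis using L[of m] a by (simp add: act_mult)
qed

lemma displacement_power:
  assumes a: "a \<in> carrier G" and inv: "\<And>y. y \<in> Y \<Longrightarrow> \<phi> a y \<in> Y"
    and mid: "\<And>y z. y \<in> Y \<Longrightarrow> z \<in> Y \<Longrightarrow> \<sigma> y z (1/2) \<in> Y"
    and L: "\<And>y. y \<in> Y \<Longrightarrow> L \<le> dist y (\<phi> a y)" and y: "y \<in> Y"
  shows "2 ^ k * L \<le> dist y (\<phi> (a [^] (2 ^ k :: nat)) y)"
proof -
  have inv': "\<phi> (a [^] (n::nat)) y \<in> Y" if "y \<in> Y" for n y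
    using that by (induction n arbitrary: y) (use a inv in \<open>auto simp: act_mult\<close>)
  \<comment> \<open>Doubling takes its lower bound at a midpoint and not at \<open>y\<close>, so the
    induction ranges over all of \<open>Y\<close>.\<close>
  have "\<forall>y\<in>Y. 2 ^ k * L \<le> dist y (\<phi> (a [^] (2 ^ k :: nat)) y)"
  proof (induction k)
    case 0 then show ?case using L a by simp
  next
    case (Suc k)
    have "a [^] (2 ^ Suc k :: nat) = a [^] (2 ^ k :: nat) \<otimes> a [^] (2 ^ k :: nat)"
      using a by (simp add: nat_pow_mult mult_2)
    moreover have "2 * (2 ^ k * L) \<le> dist y (\<phi> (a [^] (2 ^ k :: nat) \<otimes> a [^] (2 ^ k :: nat)) y)"
      if "y \<in> Y" for y
      by (rule displacement_double[of _ Y]) (use a inv' mid Suc that in auto)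
    ultimately show ?case by (simp add: mult.assoc)
  qed
  then show ?thesis using y by blast
qed

text \<open>The displacement of \<open>g\<close> at \<open>\<phi> k z\<close> is that of the
  conjugate \<open>inv k \<otimes> g \<otimes> k\<close> at \<open>z\<close>. Cocompactness thus
  moves the search into a compact ball, where only finitely many conjugates compete and each attains
  its minimum.\<close>

lemma minimal_displacement:
  assumes g: "g \<in> carrier G"
  obtains x where "\<And>y. dist x (\<phi> g x) \<le> dist y (\<phi> g y)"
proof -
  obtain y0 :: 'x where True by blast
  obtain R where R: "R \<ge> 0" "\<And>y. \<exists>g\<in>carrier G. dist y (\<phi> g y0) \<le> R" using cobounded by blast
  define D where "D = dist y0 (\<phi> g y0)"
  \<comment> \<open>A point displaced by at most \<open>D\<close>, translated into the ball, yields
    a conjugate that moves \<open>y0\<close> by at most \<open>R + D + R\<close>.\<close>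
  define Q where "Q = {k \<in> carrier G. dist y0 (\<phi> (inv k \<otimes> g \<otimes> k) y0) \<le> D + 2 * R}"
  let ?c = "\<lambda>k. inv k \<otimes> g \<otimes> k"
  have "?c ` Q \<subseteq> {u \<in> carrier G. dist y0 (\<phi> u y0) \<le> D + 2 * R}" unfolding Q_def using g by auto
  then have fin: "finite (?c ` Q)" using finite_displacement finite_subset by blast
  define f where "f u z = dist z (\<phi> u z)" for u z
  have conj: "f (?c k) z = f g (\<phi> k z)" if "k \<in> carrier G" for k z
    unfolding f_def using that g by (simp add: act_mult dist_act_inv m_assoc)
  have "\<exists>z\<in>cball y0 R. \<forall>z'\<in>cball y0 R. f u z \<le> f u z'" if "u \<in> carrier G" for u
  proof (rule continuous_attains_inf)
    show "compact (cball y0 R)" using proper unfolding proper_space_def by blast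
    show "cball y0 R \<noteq> {}" using R(1) by auto
    have "continuous_on (cball y0 R) (\<phi> u)"
      by (rule continuous_onI) (use that in \<open>auto intro!: exI\<close>)
    then show "continuous_on (cball y0 R) (f u)" unfolding f_def by (intro continuous_intros)
  qed
  then obtain z where z: "\<And>u. u \<in> carrier G \<Longrightarrow> z u \<in> cball y0 R"
    "\<And>u z'. u \<in> carrier G \<Longrightarrow> z' \<in> cball y0 R \<Longrightarrow> f u (z u) \<le> f u z'" by metis
  have one: "\<one> \<in> Q" using g R(1) by (simp add: Q_def D_def)
  then obtain k where k: "k \<in> Q" "\<And>k'. k' \<in> Q \<Longrightarrow> f (?c k) (z (?c k)) \<le> f (?c k') (z (?c k'))"
  proof -
    have "finite ((\<lambda>u. f u (z u)) ` ?c ` Q)" using fin by blast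
    moreover have "(\<lambda>u. f u (z u)) ` ?c ` Q \<noteq> {}" using one by blast
    ultimately have "Min ((\<lambda>u. f u (z u)) ` ?c ` Q) \<in> (\<lambda>u. f u (z u)) ` ?c ` Q"
      "\<And>v. v \<in> (\<lambda>u. f u (z u)) ` ?c ` Q \<Longrightarrow> Min ((\<lambda>u. f u (z u)) ` ?c ` Q) \<le> v"
      by (auto intro: Min_in)
    then show thesis using that by force
  qed
  have kG: "k \<in> carrier G" using k by (simp add: Q_def)
  let ?x = "\<phi> k (z (?c k))"
  have x: "f g ?x = f (?c k) (z (?c k))" using conj[OF kG] by simp
  have small: "f g ?x \<le> f g y" if y: "f g y \<le> D" for y
  proof -
    obtain h where h: "h \<in> carrier G" "dist y (\<phi> h y0) \<le> R" using R by blast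
    let ?z = "\<phi> (inv h) y"
    have zR: "?z \<in> cball y0 R" using h dist_act_inv[OF h(1), of y0 y] by (simp add: dist_commute)
    have fz: "f (?c h) ?z = f g y" using conj[OF h(1), of ?z] h by simp
    have cG: "?c h \<in> carrier G" using h g by simp
    have "dist y0 (\<phi> (?c h) y0) \<le> dist y0 ?z + dist ?z (\<phi> (?c h) ?z) + dist (\<phi> (?c h) ?z) (\<phi> (?c h) y0)"
      using dist_triangle[of y0 "\<phi> (?c h) y0" "?z"] dist_triangle[of ?z "\<phi> (?c h) y0" "\<phi> (?c h) ?z"] by linarith
    also have "\<dots> \<le> R + D + R"
      using zR fz y act_dist[OF cG] unfolding f_def by (simp add: dist_commute)
    finally have "h \<in> Q" using h(1) by (simp add: Q_def)
    then have "f g ?x \<le> f (?c h) (z (?c h))" using x k(2) by simp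
    also have "\<dots> \<le> f (?c h) ?z" using z(2)[OF cG zR] .
    finally show ?thesis using fz by simp
  qed
  have "f g ?x \<le> f g y" for y
    using small[of y] small[of y0] by (cases "f g y \<le> D") (auto simp: f_def D_def)
  then show thesis using that unfolding f_def by blast
qed

text \<open>At a point of minimal displacement \<open>l\<close>, the triangle inequality bounds the
  displacement of \<open>g [^] n\<close> by \<open>n * l\<close> from above, while doubling bounds
  it from below along powers of 2. Any shortfall at \<open>n\<close> would persist at
  \<open>2 ^ n\<close>, so equality holds throughout.\<close>

lemma axis:
  assumes g: "g \<in> carrier G" and inf: "infinite (range (\<lambda>n::int. g [^] n))"
  shows "\<exists>x l. l > 0 \<and> (\<forall>i j. dist (\<phi> (g [^] (i::int)) x) (\<phi> (g [^] (j::int)) x) = real_of_int \<bar>i - j\<bar> * l)"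
proof -
  obtain x where x: "\<And>y. dist x (\<phi> g x) \<le> dist y (\<phi> g y)" using minimal_displacement[OF g] by blast
  define l where "l = dist x (\<phi> g x)"
  have up: "dist x (\<phi> (g [^] n) x) \<le> real n * l" for n :: nat
  proof (induction n)
    case (Suc n)
    have "dist (\<phi> (g [^] n) x) (\<phi> (g [^] Suc n) x) = l"
      using g by (simp add: act_mult l_def)
    then show ?case using Suc dist_triangle[of x "\<phi> (g [^] Suc n) x" "\<phi> (g [^] n) x"]
      by (simp add: algebra_simps)
  qed simp
  have nat: "dist x (\<phi> (g [^] n) x) = real n * l" for n :: nat
  proof -
    \<comment> \<open>The remaining \<open>m\<close> steps contribute at most \<open>m * l\<close>,
      which leaves at least \<open>n * l\<close> for the first \<open>n\<close>.\<close>
    have "n \<le> 2 ^ n" by simp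
    then obtain m where m: "2 ^ n = n + m" using le_Suc_ex by blast
    have "2 ^ n * l \<le> dist x (\<phi> (g [^] (2 ^ n :: nat)) x)"
      by (rule displacement_power[of _ UNIV]) (use g x in \<open>auto simp: l_def\<close>)
    also have "\<dots> \<le> dist x (\<phi> (g [^] n) x) + dist (\<phi> (g [^] n) x) (\<phi> (g [^] (2 ^ n :: nat)) x)"
      by (rule dist_triangle)
    also have "dist (\<phi> (g [^] n) x) (\<phi> (g [^] (2 ^ n :: nat)) x) = dist x (\<phi> (g [^] m) x)"
      unfolding m using g by (simp add: nat_pow_mult[symmetric] act_mult)
    also have "\<dots> \<le> real m * l" by (rule up)
    finally have "2 ^ n * l - real m * l \<le> dist x (\<phi> (g [^] n) x)" by simp
    moreover have "(2 ^ n :: real) = real n + real m" using m by (metis of_nat_add of_nat_numeral of_nat_power)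
    ultimately show ?thesis using up[of n] by (simp add: algebra_simps)
  qed
  have le: "dist (\<phi> (g [^] i) x) (\<phi> (g [^] j) x) = \<bar>i - j\<bar> * l" if "i \<le> j" for i j :: int
  proof -
    define n where "n = nat (j - i)"
    have n: "j = i + int n" using that by (simp add: n_def)
    have "g [^] j = g [^] i \<otimes> g [^] n"
      using int_pow_mult[OF g, of i "int n"] n by (simp add: int_pow_int)
    then have "dist (\<phi> (g [^] i) x) (\<phi> (g [^] j) x) = dist x (\<phi> (g [^] n) x)"
      using g by (simp add: act_mult)
    then show ?thesis using nat n by simp
  qed
  have all: "dist (\<phi> (g [^] i) x) (\<phi> (g [^] j) x) = \<bar>i - j\<bar> * l" for i j :: int
    using le[of i j] le[of j i] by (cases "i \<le> j") (auto simp: dist_commute abs_minus_commute)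
  have "l \<noteq> 0"
  proof
    assume "l = 0"
    then have "range (\<lambda>n::int. g [^] n) \<subseteq> {g \<in> carrier G. dist x (\<phi> g x) \<le> 0}"
      using all[of 0] g by auto
    then show False using inf finite_displacement finite_subset by blast
  qed
  then have "l > 0" unfolding l_def by simp
  then show ?thesis by (intro exI[of _ x] exI[of _ l] conjI allI all)
qed

end

section \<open>The centralizer of \<open>g\<close> and the minimal set of \<open>g\<close>\<close>

locale axis_space = geometric_bicombed_space \<sigma> G \<phi>
  for \<sigma> :: "'x::metric_space \<Rightarrow> 'x \<Rightarrow> real \<Rightarrow> 'x" and G :: "'g monoid" (structure) and \<phi> +
  fixes g :: 'g and x :: 'x and l :: real
  assumes g: "g \<in> carrier G" and l_pos: "l > 0"
    and axis_dist: "\<And>i j. dist (\<phi> (g [^] (i::int)) x) (\<phi> (g [^] (j::int)) x) = real_of_int \<bar>i - j\<bar> * l"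
begin

definition Cent where "Cent = {h \<in> carrier G. h \<otimes> g = g \<otimes> h}"

text \<open>The orbit of \<open>x\<close> moves at speed \<open>l\<close>, so no point is displaced
  by less than \<open>l\<close>: this is the set of points of minimal displacement. The inequality
  makes convexity under \<open>\<sigma>\<close> a direct consequence of conicality.\<close>

definition Tube where "Tube = {y. dist y (\<phi> g y) \<le> l}"

lemma Cent_carrier [simp]: "h \<in> Cent \<Longrightarrow> h \<in> carrier G"
  by (simp add: Cent_def)

lemma Cent_one [simp]: "\<one> \<in> Cent"
  using g by (simp add: Cent_def del: Cent_carrier)

lemma Cent_mult [simp]:
  assumes "h \<in> Cent" "k \<in> Cent"
  shows "h \<otimes> k \<in> Cent"
proof -
  have "h \<otimes> k \<otimes> g = h \<otimes> (g \<otimes> k)" using assms g by (simp add: Cent_def m_assoc del: Cent_carrier)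
  also have "\<dots> = g \<otimes> h \<otimes> k" using assms g by (simp add: Cent_def m_assoc[symmetric] del: Cent_carrier)
  finally show ?thesis using assms g by (simp add: Cent_def m_assoc del: Cent_carrier)
qed

lemma Cent_inv [simp]:
  assumes "h \<in> Cent"
  shows "inv h \<in> Cent"
proof -
  have h: "h \<in> carrier G" "h \<otimes> g = g \<otimes> h" using assms by (auto simp: Cent_def simp del: Cent_carrier)
  have "inv h \<otimes> g = inv h \<otimes> g \<otimes> (h \<otimes> inv h)" using h g by simp
  also have "\<dots> = inv h \<otimes> (g \<otimes> h) \<otimes> inv h" using h(1) g by (simp add: m_assoc)
  also have "\<dots> = inv h \<otimes> (h \<otimes> g) \<otimes> inv h" using h(2) by simp
  also have "\<dots> = g \<otimes> inv h" using h(1) g by (simp add: m_assoc[symmetric])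
  finally show ?thesis using h by (simp add: Cent_def del: Cent_carrier)
qed

lemma g_Cent: "g \<in> Cent"
  using g by (simp add: Cent_def del: Cent_carrier)

lemma Cent_nat_pow [simp]: "h \<in> Cent \<Longrightarrow> h [^] (n::nat) \<in> Cent"
  by (induction n) auto

lemma act_Cent_g:
  assumes "h \<in> Cent"
  shows "\<phi> h (\<phi> g y) = \<phi> g (\<phi> h y)"
  using assms g by (simp add: Cent_def act_mult[symmetric] del: Cent_carrier)

lemma act_Tube [simp]:
  assumes "h \<in> Cent" "y \<in> Tube"
  shows "\<phi> h y \<in> Tube"
  using assms act_Cent_g[OF assms(1), of y, symmetric] by (simp add: Tube_def)

lemma axis_dist_nat: "dist x (\<phi> (g [^] (n::nat)) x) = real n * l"
  using axis_dist[of 0 "int n"] by (simp add: int_pow_int)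

lemma x_Tube [simp]: "x \<in> Tube"
  using axis_dist_nat[of 1] g by (simp add: Tube_def)

lemma sigma_Tube [simp]:
  assumes "y \<in> Tube" "z \<in> Tube" "0 \<le> t" "t \<le> 1"
  shows "\<sigma> y z t \<in> Tube"
proof -
  have "dist (\<sigma> y z t) (\<phi> g (\<sigma> y z t)) \<le> (1 - t) * dist y (\<phi> g y) + t * dist z (\<phi> g z)"
    using conicalD[OF assms(3,4)] by (simp add: act_sigma[OF g assms(3,4)])
  also have "\<dots> \<le> (1 - t) * l + t * l"
    using assms by (intro add_mono mult_left_mono) (auto simp: Tube_def)
  finally show ?thesis by (simp add: Tube_def algebra_simps)
qed

text \<open>For \<open>y\<close> in \<open>Tube\<close> near \<open>\<phi> k x\<close>, the
  conjugate of \<open>g\<close> by \<open>k\<close> moves \<open>x\<close> boundedly and so is one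
  of finitely many. Elements with the same conjugate differ by an element of \<open>Cent\<close>,
  and replacing \<open>k\<close> by \<open>k \<otimes> inv q\<close>, with \<open>q\<close> a chosen
  representative, costs only the displacement of \<open>inv q\<close>.\<close>

lemma Tube_cobounded:
  obtains R where "R \<ge> 0" "\<And>y. y \<in> Tube \<Longrightarrow> \<exists>h\<in>Cent. dist y (\<phi> h x) \<le> R"
proof -
  obtain R where R: "R \<ge> 0" "\<And>y. \<exists>k\<in>carrier G. dist y (\<phi> k x) \<le> R" using cobounded by blast
  let ?c = "\<lambda>k. inv k \<otimes> g \<otimes> k"
  define A where "A = {k \<in> carrier G. dist x (\<phi> (?c k) x) \<le> l + 2 * R}"
  have "?c ` A \<subseteq> {u \<in> carrier G. dist x (\<phi> u x) \<le> l + 2 * R}" unfolding A_def using g by auto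
  then have "finite (?c ` A)" using finite_displacement finite_subset by blast
  then obtain Q where Q: "Q \<subseteq> A" "finite Q" "?c ` A = ?c ` Q" using finite_subset_image[of "?c ` A" ?c A] by blast
  have "finite ((\<lambda>q. dist x (\<phi> (inv q) x)) ` Q)" using Q by blast
  then obtain M where M: "\<And>q. q \<in> Q \<Longrightarrow> dist x (\<phi> (inv q) x) \<le> M"
    using bdd_above_finite[of "(\<lambda>q. dist x (\<phi> (inv q) x)) ` Q"] unfolding bdd_above_def by auto
  have "\<exists>h\<in>Cent. dist y (\<phi> h x) \<le> R + \<bar>M\<bar>" if y: "y \<in> Tube" for y
  proof -
    obtain k where k: "k \<in> carrier G" "dist y (\<phi> k x) \<le> R" using R by blast
    have "dist x (\<phi> (?c k) x) = dist (\<phi> k x) (\<phi> g (\<phi> k x))"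
      using k g by (simp add: act_mult dist_act_inv m_assoc)
    also have "\<dots> \<le> dist (\<phi> k x) y + dist y (\<phi> g y) + dist (\<phi> g y) (\<phi> g (\<phi> k x))"
      using dist_triangle[of "\<phi> k x" "\<phi> g (\<phi> k x)" y] dist_triangle[of y "\<phi> g (\<phi> k x)" "\<phi> g y"] by linarith
    also have "\<dots> \<le> R + l + R"
      using k(2) y act_dist[OF g, of y "\<phi> k x"] by (simp add: Tube_def dist_commute)
    finally have "k \<in> A" using k by (simp add: A_def)
    then obtain q where q: "q \<in> Q" "?c k = ?c q" using Q(3) by blast
    have qG: "q \<in> carrier G" using q Q(1) A_def by blast
    have "k \<otimes> inv q \<in> Cent"
    proof -
      have "g \<otimes> (k \<otimes> inv q) = k \<otimes> ?c k \<otimes> inv q" using k g qG by (simp add: m_assoc mult_inv_cancel)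
      also have "\<dots> = k \<otimes> ?c q \<otimes> inv q" using q by simp
      also have "\<dots> = k \<otimes> inv q \<otimes> g" using k g qG by (simp add: m_assoc)
      finally show ?thesis using k qG by (simp add: Cent_def del: Cent_carrier)
    qed
    moreover have "dist y (\<phi> (k \<otimes> inv q) x) \<le> R + \<bar>M\<bar>"
      using dist_triangle[of y "\<phi> (k \<otimes> inv q) x" "\<phi> k x"] k M[OF q(1)] qG by (simp add: act_mult)
    ultimately show ?thesis by blast
  qed
  then show thesis using that[of "R + \<bar>M\<bar>"] R(1) by simp
qed

text \<open>The segment from \<open>x\<close> to \<open>\<phi> h x\<close> stays in
  \<open>Tube\<close>. Its points, spaced by at most 1, are followed by elements of
  \<open>Cent\<close>, and successive ones differ by a factor moving \<open>x\<close> at most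
  \<open>2 * R + 1\<close>. So such factors generate \<open>Cent\<close>, which is phrased here in
  terms of commutation.\<close>

lemma Cent_generated:
  assumes R: "R \<ge> 0" "\<And>y. y \<in> Tube \<Longrightarrow> \<exists>h\<in>Cent. dist y (\<phi> h x) \<le> R"
    and a: "a \<in> carrier G" "\<And>s. s \<in> Cent \<Longrightarrow> dist x (\<phi> s x) \<le> 2 * R + 1 \<Longrightarrow> a \<otimes> s = s \<otimes> a"
    and h: "h \<in> Cent"
  shows "a \<otimes> h = h \<otimes> a"
proof -
  obtain n :: nat where n: "real n > dist x (\<phi> h x)" using reals_Archimedean2 by blast
  then have n0: "n > 0" by (cases n) auto
  have yT: "\<sigma> x (\<phi> h x) (real i / real n) \<in> Tube" if "i \<le> n" for i
    using that h n0 by (intro sigma_Tube) auto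
  \<comment> \<open>The claim covers every \<open>k\<close> near the point, so that at the last
    point it applies to \<open>h\<close> itself.\<close>
  have "\<forall>k\<in>Cent. dist (\<sigma> x (\<phi> h x) (real i / real n)) (\<phi> k x) \<le> R \<longrightarrow> a \<otimes> k = k \<otimes> a" if "i \<le> n" for i
    using that
  proof (induction i)
    case 0
    then show ?case using a R(1) by (auto intro!: a(2))
  next
    case (Suc i)
    show ?case
    proof (intro ballI impI)
      fix k assume k: "k \<in> Cent" "dist (\<sigma> x (\<phi> h x) (real (Suc i) / real n)) (\<phi> k x) \<le> R"
      obtain k' where k': "k' \<in> Cent" "dist (\<sigma> x (\<phi> h x) (real i / real n)) (\<phi> k' x) \<le> R"
        using R(2)[OF yT] Suc.prems by (metis Suc_leD)
      have com: "a \<otimes> k' = k' \<otimes> a" using Suc k' by auto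
      have "dist (\<sigma> x (\<phi> h x) (real i / real n)) (\<sigma> x (\<phi> h x) (real (Suc i) / real n)) =
          \<bar>real i / real n - real (Suc i) / real n\<bar> * dist x (\<phi> h x)"
        using Suc.prems n0 by (intro dist_sigma_sigma) auto
      also have "\<bar>real i / real n - real (Suc i) / real n\<bar> = 1 / real n"
        by (simp add: diff_divide_distrib[symmetric])
      also have "1 / real n * dist x (\<phi> h x) \<le> 1" using n n0 by simp
      finally have "dist (\<phi> k' x) (\<phi> k x) \<le> 2 * R + 1"
        using k(2) k'(2) dist_triangle[of "\<phi> k' x" "\<phi> k x" "\<sigma> x (\<phi> h x) (real i / real n)"]
          dist_triangle[of "\<sigma> x (\<phi> h x) (real i / real n)" "\<phi> k x" "\<sigma> x (\<phi> h x) (real (Suc i) / real n)"]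
        by (simp add: dist_commute)
      then have "dist x (\<phi> (inv k' \<otimes> k) x) \<le> 2 * R + 1"
        using k k' by (simp add: act_mult dist_act_inv)
      then have "a \<otimes> (inv k' \<otimes> k) = inv k' \<otimes> k \<otimes> a" using a(2) k k' by simp
      then have "k' \<otimes> (a \<otimes> (inv k' \<otimes> k)) = k' \<otimes> (inv k' \<otimes> k \<otimes> a)" by simp
      moreover have "k' \<otimes> (a \<otimes> (inv k' \<otimes> k)) = k' \<otimes> a \<otimes> (inv k' \<otimes> k)"
        using a(1) k k' by (simp add: m_assoc)
      moreover have "\<dots> = a \<otimes> k' \<otimes> (inv k' \<otimes> k)" using com by simp
      moreover have "\<dots> = a \<otimes> k" "k' \<otimes> (inv k' \<otimes> k \<otimes> a) = k \<otimes> a"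
        using a(1) k k' by (simp_all add: m_assoc mult_inv_cancel)
      ultimately show "a \<otimes> k = k \<otimes> a" by simp
    qed
  qed
  from this[of n] show ?thesis using h n0 R(1) by simp
qed

text \<open>Up to bounded error, \<open>F\<close> agrees with an element \<open>a\<close> of the centre of the centralizer, and
  the displacement of \<open>a\<close> is almost constant on \<^term>\<open>Tube\<close>, hence close to its translation
  length.\<close>

lemma equivariant_map_displacement:
  obtains C where "\<And>F D. (\<And>y. y \<in> Tube \<Longrightarrow> F y \<in> Tube) \<Longrightarrow>
      (\<And>h y. h \<in> Cent \<Longrightarrow> y \<in> Tube \<Longrightarrow> F (\<phi> h y) = \<phi> h (F y)) \<Longrightarrow>
      (\<And>y z. y \<in> Tube \<Longrightarrow> z \<in> Tube \<Longrightarrow> dist (F y) (F z) \<le> dist y z) \<Longrightarrow>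
      (\<And>k::nat. dist x ((F ^^ k) x) \<le> D * sqrt (real k)) \<Longrightarrow> dist x (F x) \<le> C"
proof -
  obtain R where R: "R \<ge> 0" "\<And>y. y \<in> Tube \<Longrightarrow> \<exists>h\<in>Cent. dist y (\<phi> h x) \<le> R"
    using Tube_cobounded by blast
  \<comment> \<open>\<open>S\<close> generates \<open>Cent\<close> by \<open>Cent_generated\<close>.
    Its elements move \<open>F x\<close> by at most \<open>2 * R + 1\<close>, hence a point within
    \<open>R\<close> of \<open>F x\<close> by at most \<open>4 * R + 1\<close>, the bound in
    \<open>S'\<close>.\<close>
  define S where "S = {s \<in> Cent. dist x (\<phi> s x) \<le> 2 * R + 1}"
  define S' where "S' = {s \<in> Cent. dist x (\<phi> s x) \<le> 4 * R + 1}"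
  \<comment> \<open>Only the conjugates of generators are recorded; with \<open>restrict\<close> the
    maps lie in a finite function set, and the pigeonhole principle applies.\<close>
  define c where "c h = restrict (\<lambda>s. inv h \<otimes> s \<otimes> h) S" for h
  define A where "A = {h \<in> Cent. c h \<in> S \<rightarrow>\<^sub>E S'}"
  have finS: "finite S" "finite S'"
    unfolding S_def S'_def
    by (rule finite_subset[OF _ finite_displacement[of x "2 * R + 1"]], auto)
      (rule finite_subset[OF _ finite_displacement[of x "4 * R + 1"]], auto)
  have "finite (c ` A)"
    by (rule finite_subset[of _ "S \<rightarrow>\<^sub>E S'"]) (use finS in \<open>auto simp: A_def intro: finite_PiE\<close>)
  then obtain Q where Q: "Q \<subseteq> A" "finite Q" "c ` A = c ` Q" using finite_subset_image[of "c ` A" c A] by blast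
  have "finite ((\<lambda>q. dist x (\<phi> q x)) ` Q)" using Q by blast
  then obtain M where M: "\<And>q. q \<in> Q \<Longrightarrow> dist x (\<phi> q x) \<le> M"
    using bdd_above_finite[of "(\<lambda>q. dist x (\<phi> q x)) ` Q"] unfolding bdd_above_def by auto
  define R2 where "R2 = R + \<bar>M\<bar>"
  have "dist x (F x) \<le> 2 * R + 2 * R2 + 1"
    if FT: "\<And>y. y \<in> Tube \<Longrightarrow> F y \<in> Tube"
      and eq: "\<And>h y. h \<in> Cent \<Longrightarrow> y \<in> Tube \<Longrightarrow> F (\<phi> h y) = \<phi> h (F y)"
      and lip: "\<And>y z. y \<in> Tube \<Longrightarrow> z \<in> Tube \<Longrightarrow> dist (F y) (F z) \<le> dist y z"
      and small: "\<And>k::nat. dist x ((F ^^ k) x) \<le> D * sqrt (real k)" for F D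
  proof -
    obtain h where h: "h \<in> Cent" "dist (F x) (\<phi> h x) \<le> R" using R(2)[OF FT[OF x_Tube]] by blast
    have "inv h \<otimes> s \<otimes> h \<in> S'" if s: "s \<in> S" for s
    proof -
      have sC: "s \<in> Cent" using s by (simp add: S_def)
      have "dist x (\<phi> (inv h \<otimes> s \<otimes> h) x) = dist (\<phi> h x) (\<phi> s (\<phi> h x))"
        using h sC by (simp add: act_mult dist_act_inv m_assoc)
      also have "\<dots> \<le> dist (\<phi> h x) (F x) + dist (F x) (\<phi> s (F x)) + dist (\<phi> s (F x)) (\<phi> s (\<phi> h x))"
        using dist_triangle[of "\<phi> h x" "\<phi> s (\<phi> h x)" "F x"] dist_triangle[of "F x" "\<phi> s (\<phi> h x)" "\<phi> s (F x)"]
        by linarith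
      also have "dist (F x) (\<phi> s (F x)) = dist (F x) (F (\<phi> s x))" using eq[OF sC x_Tube] by simp
      also have "\<dots> \<le> dist x (\<phi> s x)" using lip sC by simp
      also have "\<dots> \<le> 2 * R + 1" using s by (simp add: S_def)
      finally show ?thesis using h sC by (simp add: S'_def dist_commute)
    qed
    then have "h \<in> A" using h by (auto simp: A_def c_def)
    then obtain q where q: "q \<in> Q" "c h = c q" using Q(3) by blast
    have qC: "q \<in> Cent" using q Q(1) A_def by blast
    \<comment> \<open>\<open>h\<close> and \<open>q\<close> conjugate the generators alike, so
      \<open>a\<close> commutes with \<open>S\<close> and hence with \<open>Cent\<close>. As
      \<open>q\<close> is one of finitely many elements, \<open>a\<close> still approximates
      \<open>F\<close> at \<open>x\<close>.\<close>
    define a where "a = h \<otimes> inv q"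
    have aC: "a \<in> Cent" using h qC by (simp add: a_def)
    have com: "a \<otimes> k = k \<otimes> a" if "k \<in> Cent" for k
    proof (rule Cent_generated[OF R _ _ that])
      show "a \<in> carrier G" using aC by simp
      fix s assume s: "s \<in> Cent" "dist x (\<phi> s x) \<le> 2 * R + 1"
      have "inv h \<otimes> s \<otimes> h = inv q \<otimes> s \<otimes> q"
      proof -
        have "s \<in> S" using s by (simp add: S_def)
        then show ?thesis using fun_cong[OF q(2), of s] by (simp add: c_def)
      qed
      then have e: "h \<otimes> (inv h \<otimes> s \<otimes> h) \<otimes> inv q = h \<otimes> (inv q \<otimes> s \<otimes> q) \<otimes> inv q" by simp
      have "h \<otimes> (inv h \<otimes> s \<otimes> h) \<otimes> inv q = s \<otimes> a"
        using h qC s by (simp add: a_def m_assoc mult_inv_cancel)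
      moreover have "h \<otimes> (inv q \<otimes> s \<otimes> q) \<otimes> inv q = a \<otimes> s"
        using h qC s by (simp add: a_def m_assoc)
      ultimately show "a \<otimes> s = s \<otimes> a" using e by simp
    qed
    have Fa: "dist (F x) (\<phi> a x) \<le> R2"
    proof -
      have "dist (\<phi> h x) (\<phi> a x) = dist x (\<phi> q x)"
        using h qC dist_act_inv[of q x x] by (simp add: a_def act_mult dist_commute)
      then show ?thesis using h(2) M[OF q(1)] dist_triangle[of "F x" "\<phi> a x" "\<phi> h x"] by (simp add: R2_def)
    qed
    \<comment> \<open>\<open>F\<close> is 1-Lipschitz and commutes with \<open>a [^] k\<close>, so
      each iteration adds an error of at most \<open>R2\<close>.\<close>
    have it: "(F ^^ k) x \<in> Tube \<and> dist ((F ^^ k) x) (\<phi> (a [^] k) x) \<le> real k * R2" for k :: nat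
    proof (induction k)
      case (Suc k)
      have "dist (F ((F ^^ k) x)) (F (\<phi> (a [^] k) x)) \<le> real k * R2"
        using lip[of "(F ^^ k) x" "\<phi> (a [^] k) x"] Suc aC by simp
      moreover have "dist (F (\<phi> (a [^] k) x)) (\<phi> (a [^] Suc k) x) \<le> R2"
        using eq[of "a [^] k" x] aC Fa by (simp add: act_mult)
      ultimately show ?case
        using dist_triangle[of "F ((F ^^ k) x)" "\<phi> (a [^] Suc k) x" "F (\<phi> (a [^] k) x)"] Suc FT
        by (simp add: algebra_simps)
    qed simp
    \<comment> \<open>Since \<open>a\<close> commutes with \<open>Cent\<close>, its displacement is
      constant along the \<open>Cent\<close> orbit of \<open>x\<close>; on the rest of
      \<open>Tube\<close> it can drop by at most \<open>2 * R\<close>.\<close>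
    define L where "L = dist x (\<phi> a x) - 2 * R"
    have L: "L \<le> dist y (\<phi> a y)" if y: "y \<in> Tube" for y
    proof -
      obtain k where k: "k \<in> Cent" "dist y (\<phi> k x) \<le> R" using R(2)[OF y] by blast
      have "dist x (\<phi> a x) = dist (\<phi> k x) (\<phi> a (\<phi> k x))"
        using com[OF k(1)] k aC act_dist[of k x "\<phi> a x"] by (simp add: act_mult[symmetric])
      also have "\<dots> \<le> dist (\<phi> k x) y + dist y (\<phi> a y) + dist (\<phi> a y) (\<phi> a (\<phi> k x))"
        using dist_triangle[of "\<phi> k x" "\<phi> a (\<phi> k x)" y] dist_triangle[of y "\<phi> a (\<phi> k x)" "\<phi> a y"] by linarith
      also have "dist (\<phi> a y) (\<phi> a (\<phi> k x)) = dist y (\<phi> k x)" using aC by simp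
      finally show ?thesis using k(2) by (simp add: L_def dist_commute)
    qed
    \<comment> \<open>For \<open>2 ^ j\<close> above \<open>D\<^sup>2\<close> the term
      \<open>D * sqrt (2 ^ j)\<close> is at most \<open>2 ^ j\<close>. After division by
      \<open>2 ^ j\<close> the bound on \<open>L\<close> no longer involves
      \<open>D\<close>.\<close>
    obtain j :: nat where j: "D\<^sup>2 < 2 ^ j" using real_arch_pow[of 2 "D\<^sup>2"] by auto
    have "2 ^ j * L \<le> dist x (\<phi> (a [^] (2 ^ j :: nat)) x)"
      by (rule displacement_power[of _ Tube]) (use aC L in auto)
    also have "\<dots> \<le> D * sqrt (2 ^ j) + 2 ^ j * R2"
      using dist_triangle[of x "\<phi> (a [^] (2 ^ j :: nat)) x" "(F ^^ (2 ^ j)) x"] small[of "2 ^ j"] it[of "2 ^ j"]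
      by simp
    also have "D * sqrt (2 ^ j) \<le> sqrt (2 ^ j) * sqrt (2 ^ j)"
      using j by (intro mult_right_mono real_le_rsqrt) auto
    finally have "2 ^ j * L \<le> 2 ^ j * (1 + R2)" by (simp add: algebra_simps)
    then have "L \<le> 1 + R2" by simp
    then show ?thesis using Fa dist_triangle[of x "F x" "\<phi> a x"] by (simp add: L_def dist_commute)
  qed
  then show thesis using that by blast
qed

lemma Cent_commutes_pow:
  assumes "h \<in> Cent"
  shows "\<phi> h (\<phi> (g [^] (n::nat)) y) = \<phi> (g [^] n) (\<phi> h y)"
    and "\<phi> h (\<phi> (inv (g [^] n)) y) = \<phi> (inv (g [^] n)) (\<phi> h y)"
proof -
  show *: "\<phi> h (\<phi> (g [^] n) y) = \<phi> (g [^] n) (\<phi> h y)" for y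
    by (induction n arbitrary: y) (use assms g in \<open>auto simp: act_mult act_Cent_g\<close>)
  have "\<phi> (g [^] n) (\<phi> h (\<phi> (inv (g [^] n)) y)) = \<phi> h y"
    using *[of "\<phi> (inv (g [^] n)) y"] g by simp
  then show "\<phi> h (\<phi> (inv (g [^] n)) y) = \<phi> (inv (g [^] n)) (\<phi> h y)"
    using g by (metis act_inv(1) nat_pow_closed)
qed

text \<open>The map \<open>F\<close> below averages one step of a centred random walk on the axis, so its
  iterates move \<open>x\<close> only by the order of the square root of the number of steps.\<close>

lemma orbit_near_sigma_pos:
  obtains C where "\<And>n m::nat. n \<le> m \<Longrightarrow> 0 < m \<Longrightarrow>
    dist (\<sigma> x (\<phi> (g [^] m) x) (real n / real m)) (\<phi> (g [^] n) x) \<le> C"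
proof -
  obtain C where C: "\<And>F D. (\<And>y. y \<in> Tube \<Longrightarrow> F y \<in> Tube) \<Longrightarrow>
      (\<And>h y. h \<in> Cent \<Longrightarrow> y \<in> Tube \<Longrightarrow> F (\<phi> h y) = \<phi> h (F y)) \<Longrightarrow>
      (\<And>y z. y \<in> Tube \<Longrightarrow> z \<in> Tube \<Longrightarrow> dist (F y) (F z) \<le> dist y z) \<Longrightarrow>
      (\<And>k::nat. dist x ((F ^^ k) x) \<le> D * sqrt (real k)) \<Longrightarrow> dist x (F x) \<le> C"
    using equivariant_map_displacement by blast
  have "dist (\<sigma> x (\<phi> (g [^] m) x) (real n / real m)) (\<phi> (g [^] n) x) \<le> C"
    if nm: "n \<le> m" "0 < m" for n m :: nat
  proof -
    define t where "t = real n / real m"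
    have t: "0 \<le> t" "t \<le> 1" "t * real m = real n" using nm by (auto simp: t_def)
    \<comment> \<open>Read the point at \<open>t\<close> as a mean of the end points:
      \<open>F\<close> steps by \<open>- n\<close> with weight \<open>1 - t\<close> and by
      \<open>m - n\<close> with weight \<open>t = n / m\<close>. The mean step is zero and its
      variance is \<open>v\<close>.\<close>
    define F where "F y = \<phi> (inv (g [^] n)) (\<sigma> y (\<phi> (g [^] m) y) t)" for y
    define v where "v = real n * (real m - real n)"
    have v: "v \<ge> 0" using nm by (simp add: v_def)
    have gC: "g [^] k \<in> Cent" for k :: nat using g_Cent by simp
    have "dist x (F x) \<le> C"
    \<comment> \<open>The coefficient depends on \<open>n\<close> and \<open>m\<close>, but
      \<open>C\<close> was fixed before them, so the final bound is uniform.\<close>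
    proof (rule C[of F "l * sqrt v"])
      show "F y \<in> Tube" if "y \<in> Tube" for y
        unfolding F_def using that gC t by simp
      show "F (\<phi> h y) = \<phi> h (F y)" if "h \<in> Cent" "y \<in> Tube" for h y
        unfolding F_def using that t Cent_commutes_pow[OF that(1)] by (simp add: act_sigma)
      show "dist (F y) (F z) \<le> dist y z" for y z
        unfolding F_def using conicalD[OF t(1,2), of y "\<phi> (g [^] m) y" z "\<phi> (g [^] m) z"] g
        by (simp add: algebra_simps)
    next
      \<comment> \<open>Measuring from every orbit point, and not only from \<open>x\<close>, lets
        the induction hypothesis apply at the two exponents \<open>i\<close> and
        \<open>i - m\<close> that one step involves.\<close>
      have "dist (\<phi> (g [^] (j::int)) x) ((F ^^ k) x) \<le> l * sqrt ((real_of_int j)\<^sup>2 + real k * v)" for j and k :: nat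
      proof (induction k arbitrary: j)
        case 0
        then show ?case using axis_dist[of j 0] l_pos by simp
      next
        case (Suc k)
        define w where "w = (F ^^ k) x"
        define i where "i = int n + j"
        have gi: "\<phi> (g [^] n) (\<phi> (g [^] j) x) = \<phi> (g [^] i) x"
          using g by (simp add: i_def int_pow_mult int_pow_int act_mult)
        have gi': "\<phi> (g [^] i) x = \<phi> (g [^] m) (\<phi> (g [^] (i - int m)) x)"
        proof -
          have "g [^] i = g [^] (int m + (i - int m))" by simp
          also have "\<dots> = g [^] int m \<otimes> g [^] (i - int m)" by (rule int_pow_mult[OF g])
          finally show ?thesis using g by (simp add: int_pow_int act_mult)
        qed
        have "dist (\<phi> (g [^] j) x) (F w) = dist (\<phi> (g [^] i) x) (\<sigma> w (\<phi> (g [^] m) w) t)"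
          unfolding F_def gi[symmetric] using g by (simp add: dist_act_inv)
        also have "\<dots> \<le> (1 - t) * dist (\<phi> (g [^] i) x) w + t * dist (\<phi> (g [^] i) x) (\<phi> (g [^] m) w)"
          by (rule dist_sigma_le[OF t(1,2)])
        also have "dist (\<phi> (g [^] i) x) (\<phi> (g [^] m) w) = dist (\<phi> (g [^] (i - int m)) x) w"
          unfolding gi' using g by simp
        also have "(1 - t) * dist (\<phi> (g [^] i) x) w + t * dist (\<phi> (g [^] (i - int m)) x) w \<le>
            (1 - t) * (l * sqrt ((real_of_int i)\<^sup>2 + real k * v)) +
            t * (l * sqrt ((real_of_int (i - int m))\<^sup>2 + real k * v))"
          unfolding w_def by (intro add_mono mult_left_mono Suc.IH) (use t in auto)
        also have "\<dots> = l * ((1 - t) * sqrt ((real_of_int i)\<^sup>2 + real k * v) +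
            t * sqrt ((real_of_int (i - int m))\<^sup>2 + real k * v))"
          by (simp add: algebra_simps)
        also have "\<dots> \<le> l * sqrt ((1 - t) * ((real_of_int i)\<^sup>2 + real k * v) +
            t * ((real_of_int (i - int m))\<^sup>2 + real k * v))"
          using l_pos t v by (intro mult_left_mono sqrt_concave) auto
        also have "(1 - t) * ((real_of_int i)\<^sup>2 + real k * v) + t * ((real_of_int (i - int m))\<^sup>2 + real k * v)
            = (real_of_int i)\<^sup>2 - 2 * (t * real m) * real_of_int i + (t * real m) * real m + real k * v"
          by (simp add: power2_eq_square algebra_simps)
        \<comment> \<open>Completing the square with \<open>i = n + j\<close> and
          \<open>t * m = n\<close>: the mean of the squares is \<open>j\<^sup>2\<close> plus the
          variance \<open>v\<close> of one more step.\<close>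
        also have "\<dots> = (real_of_int j)\<^sup>2 + real (Suc k) * v"
          unfolding t(3) by (simp add: i_def v_def power2_eq_square algebra_simps)
        finally show ?case by (simp add: w_def)
      qed
      from this[of 0] show "dist x ((F ^^ k) x) \<le> l * sqrt v * sqrt (real k)" for k :: nat
        by (simp add: real_sqrt_mult mult.commute mult.left_commute)
    qed
    also have "dist x (F x) = dist (\<sigma> x (\<phi> (g [^] m) x) t) (\<phi> (g [^] n) x)"
      unfolding F_def using g by (simp add: dist_act_inv[symmetric] dist_commute)
    finally show ?thesis by (simp add: t_def)
  qed
  then show thesis using that by blast
qed

text \<open>For negative exponents, translate by \<open>g [^] m\<close>. The segment then runs from
  \<open>\<phi> (g [^] m) x\<close> to \<open>x\<close>, and reversed it is the one already treated,
  with \<open>n\<close> replaced by \<open>m - n\<close>.\<close>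

lemma orbit_near_sigma:
  obtains C where "\<And>(n::nat) (m::nat) (s::int). n \<le> m \<Longrightarrow> 0 < m \<Longrightarrow> s \<in> {1, -1} \<Longrightarrow>
    dist (\<sigma> x (\<phi> (g [^] (s * int m)) x) (real n / real m)) (\<phi> (g [^] (s * int n)) x) \<le> C"
proof -
  obtain C where C: "\<And>n m::nat. n \<le> m \<Longrightarrow> 0 < m \<Longrightarrow>
    dist (\<sigma> x (\<phi> (g [^] m) x) (real n / real m)) (\<phi> (g [^] n) x) \<le> C"
    using orbit_near_sigma_pos by blast
  have "dist (\<sigma> x (\<phi> (g [^] (s * int m)) x) (real n / real m)) (\<phi> (g [^] (s * int n)) x) \<le> C"
    if nm: "n \<le> m" "0 < m" and s: "s \<in> {1, -1}" for n m :: nat and s :: int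
  proof (cases "s = 1")
    case True
    then show ?thesis using C[OF nm] by (simp add: int_pow_int)
  next
    case False
    then have s: "s = -1" using s by simp
    let ?t = "real n / real m"
    have t: "0 \<le> ?t" "?t \<le> 1" using nm by auto
    have gm: "g [^] (s * int m) = inv (g [^] m)" unfolding s using g by (simp add: int_pow_neg_int)
    have "g [^] m \<otimes> g [^] (s * int n) = g [^] (m - n)"
      using int_pow_mult[OF g, of "int m" "- int n"] nm s by (simp add: int_pow_int[symmetric] of_nat_diff)
    then have e: "\<phi> (g [^] m) (\<phi> (g [^] (s * int n)) x) = \<phi> (g [^] (m - n)) x"
      using g by (simp add: act_mult[symmetric])
    have "dist (\<sigma> x (\<phi> (g [^] (s * int m)) x) ?t) (\<phi> (g [^] (s * int n)) x) =
        dist (\<phi> (g [^] m) (\<sigma> x (\<phi> (g [^] (s * int m)) x) ?t)) (\<phi> (g [^] m) (\<phi> (g [^] (s * int n)) x))"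
      using g by simp
    also have "\<phi> (g [^] m) (\<sigma> x (\<phi> (g [^] (s * int m)) x) ?t) = \<sigma> (\<phi> (g [^] m) x) x ?t"
      using g t gm by (simp add: act_sigma)
    also have "\<dots> = \<sigma> x (\<phi> (g [^] m) x) (1 - ?t)"
      by (rule reversible[unfolded reversible_def, rule_format]) (use t in auto)
    also have "1 - ?t = real (m - n) / real m" using nm by (simp add: of_nat_diff diff_divide_distrib)
    finally show ?thesis using C[of "m - n" m] nm e by simp
  qed
  then show thesis using that by blast
qed

end

section \<open>Normal forms in amalgamated products\<close>

locale amalgam_factor = H: group H + Z: group Z
  for H :: "'h monoid" (structure) and Z :: "'c monoid" +
  fixes i :: "'c \<Rightarrow> 'h" and tag :: "'h \<Rightarrow> 'u"
  assumes i_mon: "i \<in> mon Z H" and tag_inj: "inj tag"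
begin

abbreviation K where "K \<equiv> i ` carrier Z"

text \<open>Chosen from the coset as a set, so equal cosets get the same representative.\<close>

definition rep where "rep y = (SOME r. r \<in> K #> y)"

definition T where "T = {t \<in> carrier H. t \<notin> K \<and> rep t = t}"

definition zpart where "zpart y = inv_into (carrier Z) i (y \<otimes> inv (rep y))"

text \<open>A pair \<open>(z, ts)\<close> stands for the product of \<open>i z\<close> and the
  letters of \<open>ts\<close>. \<open>comb\<close> normalizes the product of \<open>y\<close> and
  \<open>ts\<close>, and \<open>head\<close> and \<open>rest\<close> undo it, so that acting on a
  pair becomes left multiplication of \<open>head\<close> (van der Waerden's method).\<close>

definition comb where
  "comb y ts = (if y \<in> K then (inv_into (carrier Z) i y, ts) else (zpart y, tag (rep y) # ts))"

definition starts where "starts ts \<longleftrightarrow> (\<exists>t us. ts = tag t # us)"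

definition head where
  "head \<omega> = (if starts (snd \<omega>) then i (fst \<omega>) \<otimes> the_inv tag (hd (snd \<omega>)) else i (fst \<omega>))"

definition rest where "rest ts = (if starts ts then tl ts else ts)"

definition act where "act h \<omega> = comb (h \<otimes> head \<omega>) (rest (snd \<omega>))"

definition valid where
  "valid \<omega> \<longleftrightarrow> fst \<omega> \<in> carrier Z \<and> (\<forall>t us. snd \<omega> = tag t # us \<longrightarrow> t \<in> T \<and> \<not> starts us)"

lemma i_closed [simp]: "z \<in> carrier Z \<Longrightarrow> i z \<in> carrier H"
  and i_mult: "z \<in> carrier Z \<Longrightarrow> z' \<in> carrier Z \<Longrightarrow> i (z \<otimes>\<^bsub>Z\<^esub> z') = i z \<otimes> i z'"
  and i_inj: "inj_on i (carrier Z)"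
  using i_mon unfolding mon_def hom_def by auto

lemma i_one [simp]: "i \<one>\<^bsub>Z\<^esub> = \<one>"
  using i_mon hom_one[of i Z H] H.group_axioms Z.group_axioms unfolding mon_def by blast

lemma K_subgroup: "subgroup K H"
proof -
  interpret group_hom Z H i
    using i_mon by unfold_locales (simp add: mon_def)
  show ?thesis by (rule img_is_subgroup)
qed

lemma inv_i [simp]: "z \<in> carrier Z \<Longrightarrow> inv_into (carrier Z) i (i z) = z"
  using i_inj by simp

lemma rep_in: "y \<in> carrier H \<Longrightarrow> rep y \<in> K #> y"
  unfolding rep_def by (rule someI) (rule H.rcos_self[OF _ K_subgroup])

lemma rep_closed [simp]: "y \<in> carrier H \<Longrightarrow> rep y \<in> carrier H"
  using rep_in H.r_coset_subset_G[OF subgroup.subset[OF K_subgroup]] by blast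

lemma zpart:
  assumes y: "y \<in> carrier H"
  shows "zpart y \<in> carrier Z" "i (zpart y) \<otimes> rep y = y"
proof -
  obtain z where z: "z \<in> carrier Z" "rep y = i z \<otimes> y"
    using rep_in[OF y] unfolding r_coset_def by auto
  have "y \<otimes> inv (rep y) = inv (i z)"
    unfolding z(2) using z(1) y by (simp add: H.inv_mult_group H.m_assoc[symmetric])
  also have "\<dots> \<in> K" using z(1) K_subgroup by (simp add: subgroup.m_inv_closed)
  finally have k: "y \<otimes> inv (rep y) \<in> K" .
  then show "zpart y \<in> carrier Z" unfolding zpart_def by (rule inv_into_into)
  have "i (zpart y) = y \<otimes> inv (rep y)" unfolding zpart_def using k by (rule f_inv_into_f)
  then show "i (zpart y) \<otimes> rep y = y" using y by (simp add: H.m_assoc)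
qed

lemma rep_mult:
  assumes "z \<in> carrier Z" "y \<in> carrier H"
  shows "rep (i z \<otimes> y) = rep y"
proof -
  have "K #> (i z \<otimes> y) = K #> y"
    using H.coset_mult_assoc[of K "i z" y] H.coset_join2[OF _ K_subgroup, of "i z"] assms
      subgroup.subset[OF K_subgroup] by auto
  then show ?thesis by (simp add: rep_def)
qed

lemma rep_rep [simp]: "y \<in> carrier H \<Longrightarrow> rep (rep y) = rep y"
  using rep_mult[of "zpart y" "rep y"] zpart[of y] by simp

lemma mult_K_iff:
  assumes "z \<in> carrier Z" "y \<in> carrier H"
  shows "i z \<otimes> y \<in> K \<longleftrightarrow> y \<in> K"
proof
  assume "i z \<otimes> y \<in> K"
  then have "inv (i z) \<otimes> (i z \<otimes> y) \<in> K"
    by (rule subgroup.m_closed[OF K_subgroup subgroup.m_inv_closed[OF K_subgroup imageI[OF assms(1)]]])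
  then show "y \<in> K" using assms by (simp add: H.m_assoc[symmetric])
qed (use K_subgroup assms in \<open>auto intro: subgroup.m_closed\<close>)

lemma rep_T: "y \<in> carrier H \<Longrightarrow> y \<notin> K \<Longrightarrow> rep y \<in> T"
  using mult_K_iff[of "zpart y" "rep y"] zpart[of y] by (simp add: T_def)

lemma T_decomp:
  assumes "z \<in> carrier Z" "t \<in> T"
  shows "i z \<otimes> t \<in> carrier H" "i z \<otimes> t \<notin> K" "rep (i z \<otimes> t) = t" "zpart (i z \<otimes> t) = z"
proof -
  have t: "t \<in> carrier H" "t \<notin> K" "rep t = t" using assms by (auto simp: T_def)
  show c: "i z \<otimes> t \<in> carrier H" using assms t by simp
  show "i z \<otimes> t \<notin> K" using mult_K_iff assms t by blast
  show r: "rep (i z \<otimes> t) = t" using rep_mult assms t by simp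
  have "i (zpart (i z \<otimes> t)) \<otimes> t = i z \<otimes> t" using zpart(2)[OF c] r by simp
  then have "i (zpart (i z \<otimes> t)) = i z" using zpart(1)[OF c] t assms H.right_cancel by simp
  then show "zpart (i z \<otimes> t) = z" using zpart(1)[OF c] i_inj assms by (meson inj_onD)
qed

lemma starts_Nil [simp]: "\<not> starts []"
  and starts_tag [simp]: "starts (tag t # us)"
  by (auto simp: starts_def)

lemma the_inv_tag [simp]: "the_inv tag (tag t) = t"
  by (rule the_inv_f_f[OF tag_inj])

text \<open>Together with \<open>valid_cases\<close> this makes \<open>comb\<close> a bijection onto
  the valid pairs, with inverse given by \<open>head\<close> and \<open>rest\<close>. The laws
  \<open>act_one\<close> and \<open>act_act\<close> then are those of left multiplication in the
  factor.\<close>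

lemma comb_valid:
  assumes "y \<in> carrier H" "\<not> starts us"
  shows "valid (comb y us)" "head (comb y us) = y" "rest (snd (comb y us)) = us"
proof -
  have tagD: "tag t = tag t' \<longleftrightarrow> t = t'" for t t' using tag_inj by (auto dest: injD)
  show "valid (comb y us)"
    using assms zpart(1) rep_T unfolding valid_def comb_def
    by (auto simp: tagD starts_def intro: inv_into_into)
  show "head (comb y us) = y" "rest (snd (comb y us)) = us"
    using assms zpart(2) unfolding head_def rest_def comb_def
    by (auto simp: f_inv_into_f)
qed

lemma valid_cases:
  assumes "valid \<omega>"
  shows "head \<omega> \<in> carrier H" "\<not> starts (rest (snd \<omega>))" "comb (head \<omega>) (rest (snd \<omega>)) = \<omega>"
proof -
  obtain z ts where w: "\<omega> = (z, ts)" by (cases \<omega>)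
  have z: "z \<in> carrier Z" using assms by (simp add: valid_def w)
  have "head \<omega> \<in> carrier H \<and> \<not> starts (rest (snd \<omega>)) \<and> comb (head \<omega>) (rest (snd \<omega>)) = \<omega>"
  proof (cases "starts ts")
    case True
    then obtain t us where ts: "ts = tag t # us" by (auto simp: starts_def)
    then have t: "t \<in> T" "\<not> starts us" using assms by (auto simp: valid_def w)
    then show ?thesis using T_decomp[OF z t(1)] by (simp add: w ts head_def rest_def comb_def)
  next
    case False
    then show ?thesis using z by (simp add: w head_def rest_def comb_def)
  qed
  then show "head \<omega> \<in> carrier H" "\<not> starts (rest (snd \<omega>))" "comb (head \<omega>) (rest (snd \<omega>)) = \<omega>" by auto
qed

lemma act_valid: "h \<in> carrier H \<Longrightarrow> valid \<omega> \<Longrightarrow> valid (act h \<omega>)"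
  unfolding act_def using comb_valid valid_cases by simp

lemma act_one: "valid \<omega> \<Longrightarrow> act \<one> \<omega> = \<omega>"
  unfolding act_def using valid_cases by simp

lemma act_act:
  assumes "h \<in> carrier H" "k \<in> carrier H" "valid \<omega>"
  shows "act h (act k \<omega>) = act (h \<otimes> k) \<omega>"
  unfolding act_def using comb_valid[of "k \<otimes> head \<omega>" "rest (snd \<omega>)"] valid_cases[OF assms(3)] assms
  by (simp add: H.m_assoc)

text \<open>\<open>Z\<close> touches only the first coordinate, by a formula that does not mention
  the factor. This is why both factors act alike on the amalgamated subgroup in
  \<open>cong_act\<close>.\<close>

lemma act_i:
  assumes "z' \<in> carrier Z" "valid (z, ts)"
  shows "act (i z') (z, ts) = (z' \<otimes>\<^bsub>Z\<^esub> z, ts)"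
proof -
  have z: "z \<in> carrier Z" using assms by (simp add: valid_def)
  have v: "valid (z' \<otimes>\<^bsub>Z\<^esub> z, ts)" using assms by (simp add: valid_def)
  have "i z' \<otimes> head (z, ts) = head (z' \<otimes>\<^bsub>Z\<^esub> z, ts)"
  proof (cases "starts ts")
    case True
    then obtain t us where ts: "ts = tag t # us" by (auto simp: starts_def)
    then have "t \<in> carrier H" using assms by (auto simp: valid_def T_def)
    then show ?thesis using assms(1) z by (simp add: head_def ts i_mult H.m_assoc)
  next
    case False
    then show ?thesis using assms(1) z by (simp add: head_def i_mult)
  qed
  then show ?thesis using valid_cases(3)[OF v] by (simp add: act_def)
qed

lemma act_new:
  assumes "h \<in> carrier H" "h \<notin> K" "valid (z, ts)" "\<not> starts ts"
  shows "starts (snd (act h (z, ts)))"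
proof -
  have z: "z \<in> carrier Z" using assms by (simp add: valid_def)
  have "h \<otimes> i z \<notin> K"
  proof
    assume "h \<otimes> i z \<in> K"
    then have "h \<otimes> i z \<otimes> inv (i z) \<in> K"
      by (rule subgroup.m_closed[OF K_subgroup _ subgroup.m_inv_closed[OF K_subgroup imageI[OF z]]])
    then show False using assms z by (simp add: H.m_assoc)
  qed
  then show ?thesis using assms by (simp add: act_def head_def comb_def)
qed

lemma act_T:
  assumes "t \<in> T" "\<not> starts ts"
  shows "act t (\<one>\<^bsub>Z\<^esub>, ts) = (\<one>\<^bsub>Z\<^esub>, tag t # ts)"
  using T_decomp[of "\<one>\<^bsub>Z\<^esub>" t] assms
  by (auto simp: act_def head_def rest_def comb_def T_def)

lemma act_shape:
  assumes "h \<in> carrier H" "valid \<omega>"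
  obtains "snd (act h \<omega>) = rest (snd \<omega>)"
  | t where "t \<in> T" "snd (act h \<omega>) = tag t # rest (snd \<omega>)"
proof (cases "h \<otimes> head \<omega> \<in> K")
  case True
  then show thesis using that(1) by (simp add: act_def comb_def)
next
  case False
  then have "rep (h \<otimes> head \<omega>) \<in> T" using valid_cases[OF assms(2)] assms rep_T by simp
  then show thesis using that(2) False by (simp add: act_def comb_def)
qed

lemma fst_act: "h \<in> carrier H \<Longrightarrow> valid \<omega> \<Longrightarrow> fst (act h \<omega>) \<in> carrier Z"
  using act_valid[of h \<omega>] by (simp add: valid_def)

lemma act_base:
  assumes "h \<in> carrier H"
  shows "snd (act h (\<one>\<^bsub>Z\<^esub>, [])) = [] \<or> starts (snd (act h (\<one>\<^bsub>Z\<^esub>, [])))"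
  using assms by (auto simp: act_def head_def rest_def comb_def)

text \<open>Acting is a rewriting of words: multiply up to one letter \<open>y\<close>, then split
  it into its \<open>Z\<close> part and its representative. \<open>C\<close> is left abstract
  because the congruence of the amalgam involves both factors and this locale knows one.\<close>

lemma act_cong:
  assumes C_trans: "\<And>u v w. C u v \<Longrightarrow> C v w \<Longrightarrow> C u w" and C_sym: "\<And>u v. C u v \<Longrightarrow> C v u"
    and C_mult: "\<And>a b w. a \<in> carrier H \<Longrightarrow> b \<in> carrier H \<Longrightarrow> w \<in> W \<Longrightarrow> C (tag a # tag b # w) (tag (a \<otimes> b) # w)"
    and W: "ts \<in> W" "rest ts \<in> W"
    and h: "h \<in> carrier H" and v: "valid (z, ts)"
  shows "C (tag h # tag (i z) # ts) (tag (i (fst (act h (z, ts)))) # snd (act h (z, ts)))"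
proof -
  have z: "z \<in> carrier Z" using v by (simp add: valid_def)
  define y where "y = h \<otimes> head (z, ts)"
  have y: "y \<in> carrier H" using h valid_cases[OF v] by (simp add: y_def)
  have 1: "C (tag h # tag (i z) # ts) (tag y # rest ts)"
  proof (cases "starts ts")
    case True
    then obtain t us where ts: "ts = tag t # us" by (auto simp: starts_def)
    then have t: "t \<in> carrier H" using v by (auto simp: valid_def T_def)
    have "C (tag h # tag (i z) # ts) (tag (h \<otimes> i z) # ts)" using C_mult h z W by simp
    moreover have "C (tag (h \<otimes> i z) # ts) (tag (h \<otimes> i z \<otimes> t) # us)"
      using C_mult[of "h \<otimes> i z" t us] h z t W by (simp add: ts rest_def)
    ultimately have "C (tag h # tag (i z) # ts) (tag (h \<otimes> i z \<otimes> t) # us)" by (rule C_trans)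
    then show ?thesis
      using h z t by (simp add: y_def ts head_def rest_def H.m_assoc)
  next
    case False
    then show ?thesis using C_mult h z W by (simp add: y_def head_def rest_def)
  qed
  show ?thesis
  proof (cases "y \<in> K")
    case True
    then show ?thesis using 1 by (simp add: act_def y_def[symmetric] comb_def f_inv_into_f)
  next
    case False
    have "C (tag (i (zpart y)) # tag (rep y) # rest ts) (tag y # rest ts)"
      using C_mult[of "i (zpart y)" "rep y" "rest ts"] zpart[OF y] y W by simp
    from C_trans[OF 1 C_sym[OF this]] show ?thesis
      using False by (simp add: act_def y_def[symmetric] comb_def)
  qed
qed

end

section \<open>Normal forms for both factors together\<close>

locale amalgam = G1: group G1 + G2: group G2 + Z: group Z
  for G1 :: "'a monoid" and G2 :: "'b monoid" and Z :: "'c monoid" +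
  fixes i1 :: "'c \<Rightarrow> 'a" and i2 :: "'c \<Rightarrow> 'b"
  assumes i1: "i1 \<in> mon Z G1" and i2: "i2 \<in> mon Z G2"
begin

sublocale F1: amalgam_factor G1 Z i1 "Inl :: 'a \<Rightarrow> 'a + 'b"
  by unfold_locales (use i1 in auto)

sublocale F2: amalgam_factor G2 Z i2 "Inr :: 'b \<Rightarrow> 'a + 'b"
  by unfold_locales (use i2 in auto)

abbreviation Wd where "Wd \<equiv> amalgam_words G1 G2"

abbreviation eqv (infix "\<doteq>" 50) where "v \<doteq> w \<equiv> amalgam_cong G1 G2 Z i1 i2 v w"

text \<open>The alternating words in nontrivial coset representatives, that is, normal forms without
  their \<open>Z\<close> part.\<close>

fun good :: "('a + 'b) list \<Rightarrow> bool" where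
  "good [] = True"
| "good (Inl t # ts) = (t \<in> F1.T \<and> \<not> F1.starts ts \<and> good ts)"
| "good (Inr t # ts) = (t \<in> F2.T \<and> \<not> F2.starts ts \<and> good ts)"

definition \<Omega> where "\<Omega> = {\<omega>. fst \<omega> \<in> carrier Z \<and> good (snd \<omega>)}"

fun letter_act :: "'a + 'b \<Rightarrow> 'c \<times> ('a + 'b) list \<Rightarrow> 'c \<times> ('a + 'b) list" where
  "letter_act (Inl a) = F1.act a"
| "letter_act (Inr b) = F2.act b"

definition word_act where "word_act w \<omega> = foldr letter_act w \<omega>"

text \<open>The orbit map of the trivial normal form. By \<open>nf_cong\<close> and
  \<open>cong_nf\<close> it separates exactly the congruence classes.\<close>

definition nf where "nf w = word_act w (\<one>\<^bsub>Z\<^esub>, [])"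

lemma word_act_simps [simp]: "word_act [] \<omega> = \<omega>"
  "word_act (u # w) \<omega> = letter_act u (word_act w \<omega>)"
  "word_act (v @ w) \<omega> = word_act v (word_act w \<omega>)"
  by (simp_all add: word_act_def)

lemma words_simps [simp]: "[] \<in> Wd"
  "Inl a # w \<in> Wd \<longleftrightarrow> a \<in> carrier G1 \<and> w \<in> Wd"
  "Inr b # w \<in> Wd \<longleftrightarrow> b \<in> carrier G2 \<and> w \<in> Wd"
  "v @ w \<in> Wd \<longleftrightarrow> v \<in> Wd \<and> w \<in> Wd"
  by (auto simp: amalgam_words_def)

lemma starts_iff [simp]: "\<not> F1.starts (Inr b # w)" "\<not> F2.starts (Inl a # w)"
  by (auto simp: F1.starts_def F2.starts_def)

lemma \<Omega>_valid: "\<omega> \<in> \<Omega> \<Longrightarrow> F1.valid \<omega>" "\<omega> \<in> \<Omega> \<Longrightarrow> F2.valid \<omega>"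
  by (auto simp: \<Omega>_def F1.valid_def F2.valid_def)

lemma good_rest: "good ts \<Longrightarrow> good (F1.rest ts)" "good ts \<Longrightarrow> good (F2.rest ts)"
  by (cases ts rule: good.cases; simp add: F1.rest_def F2.rest_def)+

lemma good_words: "good ts \<Longrightarrow> ts \<in> Wd"
  by (induction ts rule: good.induct) (auto simp: F1.T_def F2.T_def)

lemma act1_\<Omega>:
  assumes "a \<in> carrier G1" "\<omega> \<in> \<Omega>"
  shows "F1.act a \<omega> \<in> \<Omega>"
proof -
  have v: "F1.valid \<omega>" using \<Omega>_valid assms by blast
  have g: "good (F1.rest (snd \<omega>))" using good_rest assms by (simp add: \<Omega>_def)
  have "good (snd (F1.act a \<omega>))"
    by (rule F1.act_shape[OF assms(1) v]) (use g F1.valid_cases(2)[OF v] in auto)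
  then show ?thesis using F1.fst_act[OF assms(1) v] by (simp add: \<Omega>_def)
qed

lemma act2_\<Omega>:
  assumes "b \<in> carrier G2" "\<omega> \<in> \<Omega>"
  shows "F2.act b \<omega> \<in> \<Omega>"
proof -
  have v: "F2.valid \<omega>" using \<Omega>_valid assms by blast
  have g: "good (F2.rest (snd \<omega>))" using good_rest assms by (simp add: \<Omega>_def)
  have "good (snd (F2.act b \<omega>))"
    by (rule F2.act_shape[OF assms(1) v]) (use g F2.valid_cases(2)[OF v] in auto)
  then show ?thesis using F2.fst_act[OF assms(1) v] by (simp add: \<Omega>_def)
qed

lemma word_act_\<Omega>: "w \<in> Wd \<Longrightarrow> \<omega> \<in> \<Omega> \<Longrightarrow> word_act w \<omega> \<in> \<Omega>"
proof (induction w)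
  case (Cons u w)
  then show ?case by (cases u) (auto intro: act1_\<Omega> act2_\<Omega>)
qed simp

text \<open>Each defining relation holds for the actions on \<open>\<Omega>\<close>: units and
  products by the action laws, \<open>amalg\<close> by \<open>act_i\<close> in both factors. This is
  the uniqueness half of the normal form theorem.\<close>

lemma cong_act:
  assumes "v \<doteq> w"
  shows "v \<in> Wd \<and> w \<in> Wd \<and> (\<forall>\<omega>\<in>\<Omega>. word_act v \<omega> = word_act w \<omega>)"
  using assms
proof (induction rule: amalgam_cong.induct)
  case (append u v u' v')
  then show ?case using word_act_\<Omega> by auto
next
  case (amalg z)
  have "F1.act (i1 z) \<omega> = F2.act (i2 z) \<omega>" if "\<omega> \<in> \<Omega>" for \<omega>
    using F1.act_i[OF amalg, of "fst \<omega>" "snd \<omega>"] F2.act_i[OF amalg, of "fst \<omega>" "snd \<omega>"] \<Omega>_valid[OF that] by simp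
  then show ?case using amalg by simp
qed (auto simp: F1.act_one F2.act_one F1.act_act F2.act_act \<Omega>_valid)

lemma base_\<Omega> [simp]: "(\<one>\<^bsub>Z\<^esub>, []) \<in> \<Omega>"
  by (simp add: \<Omega>_def)

lemma nf_\<Omega>: "w \<in> Wd \<Longrightarrow> nf w \<in> \<Omega>"
  unfolding nf_def by (rule word_act_\<Omega>) simp_all

lemma nf_cong: "v \<doteq> w \<Longrightarrow> nf v = nf w"
  using cong_act unfolding nf_def by simp

lemma cong_append_right: "v \<doteq> w \<Longrightarrow> u \<in> Wd \<Longrightarrow> v @ u \<doteq> w @ u"
  by (rule amalgam_cong.append) (auto intro: amalgam_cong.refl)

lemma cong_append_left: "v \<doteq> w \<Longrightarrow> u \<in> Wd \<Longrightarrow> u @ v \<doteq> u @ w"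
  by (rule amalgam_cong.append) (auto intro: amalgam_cong.refl)

text \<open>For a letter of \<open>G1\<close> this is \<open>act_cong\<close>. For a letter of
  \<open>G2\<close> the \<open>Z\<close> part is first moved to that factor with
  \<open>amalg\<close> and afterwards moved back. Iteration gives \<open>cong_nf\<close>, the
  existence half of the normal form theorem.\<close>

lemma letter_cong:
  assumes w: "\<omega> \<in> \<Omega>" and u: "[u] \<in> Wd"
  shows "u # Inl (i1 (fst \<omega>)) # snd \<omega> \<doteq> Inl (i1 (fst (letter_act u \<omega>))) # snd (letter_act u \<omega>)"
proof -
  obtain z ts where zt: "\<omega> = (z, ts)" by (cases \<omega>)
  have z: "z \<in> carrier Z" and ts: "good ts" using w by (auto simp: zt \<Omega>_def)
  have W: "ts \<in> Wd" "F1.rest ts \<in> Wd" "F2.rest ts \<in> Wd" using ts good_rest good_words by auto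
  show ?thesis
  proof (cases u)
    case (Inl a)
    have "Inl a # Inl (i1 z) # ts \<doteq> Inl (i1 (fst (F1.act a (z, ts)))) # snd (F1.act a (z, ts))"
    proof (rule F1.act_cong[where W = Wd])
      show "Inl a # Inl b # w \<doteq> Inl (a \<otimes>\<^bsub>G1\<^esub> b) # w" if "a \<in> carrier G1" "b \<in> carrier G1" "w \<in> Wd" for a b w
        using cong_append_right[OF amalgam_cong.mult1[OF that(1,2)] that(3)] by simp
    qed (use W u w zt \<Omega>_valid Inl in \<open>auto intro: amalgam_cong.trans amalgam_cong.sym\<close>)
    then show ?thesis using Inl zt by simp
  next
    case (Inr b)
    have b: "b \<in> carrier G2" using u Inr by simp
    have "Inr b # Inr (i2 z) # ts \<doteq> Inr (i2 (fst (F2.act b (z, ts)))) # snd (F2.act b (z, ts))"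
    proof (rule F2.act_cong[where W = Wd])
      show "Inr a # Inr b # w \<doteq> Inr (a \<otimes>\<^bsub>G2\<^esub> b) # w" if "a \<in> carrier G2" "b \<in> carrier G2" "w \<in> Wd" for a b w
        using cong_append_right[OF amalgam_cong.mult2[OF that(1,2)] that(3)] by simp
    qed (use W u w zt \<Omega>_valid Inr in \<open>auto intro: amalgam_cong.trans amalgam_cong.sym\<close>)
    moreover have "Inr b # Inl (i1 z) # ts \<doteq> Inr b # Inr (i2 z) # ts"
      using cong_append_left[OF cong_append_right[OF amalgam_cong.amalg[OF z] W(1)], of "[Inr b]"] b by simp
    moreover have "Inr (i2 (fst (F2.act b (z, ts)))) # snd (F2.act b (z, ts)) \<doteq>
        Inl (i1 (fst (F2.act b (z, ts)))) # snd (F2.act b (z, ts))"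
    proof -
      have o: "F2.act b (z, ts) \<in> \<Omega>" using act2_\<Omega>[OF b] w zt by simp
      then have "fst (F2.act b (z, ts)) \<in> carrier Z" "snd (F2.act b (z, ts)) \<in> Wd"
        using good_words by (auto simp: \<Omega>_def)
      from cong_append_right[OF amalgam_cong.sym[OF amalgam_cong.amalg[OF this(1)]] this(2)]
      show ?thesis by simp
    qed
    ultimately show ?thesis using Inr zt by (auto intro: amalgam_cong.trans)
  qed
qed

lemma cong_nf: "w \<in> Wd \<Longrightarrow> w \<doteq> Inl (i1 (fst (nf w))) # snd (nf w)"
proof (induction w)
  case Nil
  then show ?case
    using amalgam_cong.sym[OF amalgam_cong.one1, of G1 G2 Z i1 i2] by (simp add: nf_def)
next
  case (Cons u w)
  have u: "[u] \<in> Wd" "w \<in> Wd" using Cons.prems by (cases u; simp)+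
  have "[u] @ w \<doteq> [u] @ Inl (i1 (fst (nf w))) # snd (nf w)"
    by (rule cong_append_left[OF Cons.IH[OF u(2)] u(1)])
  moreover have "u # Inl (i1 (fst (nf w))) # snd (nf w) \<doteq> Inl (i1 (fst (nf (u # w)))) # snd (nf (u # w))"
    using letter_cong[OF nf_\<Omega>[OF u(2)] u(1)] by (simp add: nf_def)
  ultimately show ?case by (auto intro: amalgam_cong.trans)
qed

lemma nf_i1: "z \<in> carrier Z \<Longrightarrow> w \<in> Wd \<Longrightarrow> nf (Inl (i1 z) # w) = (z \<otimes>\<^bsub>Z\<^esub> fst (nf w), snd (nf w))"
  using F1.act_i[of z "fst (nf w)" "snd (nf w)"] \<Omega>_valid(1)[OF nf_\<Omega>, of w] by (simp add: nf_def)

lemma nf_good: "good ts \<Longrightarrow> nf ts = (\<one>\<^bsub>Z\<^esub>, ts)"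
  unfolding nf_def by (induction ts rule: good.induct) (auto simp: F1.act_T F2.act_T)

definition same_side where
  "same_side ts us \<longleftrightarrow> us = [] \<or> (F1.starts ts \<and> F1.starts us) \<or> (F2.starts ts \<and> F2.starts us)"

text \<open>Right multiplication by a letter works at the far end of the word. By induction the
  changed tail is empty or still starts in the other factor, so the leading letter has nothing to
  merge with. Only a word of a single letter can disappear.\<close>

lemma same_side_append_letter:
  assumes "good ts" "ts \<noteq> []" "[u] \<in> Wd"
  shows "same_side ts (snd (word_act ts (letter_act u (\<one>\<^bsub>Z\<^esub>, []))))"
  using assms(1,2)
proof (induction ts rule: good.induct)
  case 1
  then show ?case by simp
next
  case (2 t ts)
  have t: "t \<in> F1.T" "t \<in> carrier G1" "t \<notin> F1.K" "\<not> F1.starts ts" "good ts" using 2 by (auto simp: F1.T_def)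
  let ?\<omega> = "word_act ts (letter_act u (\<one>\<^bsub>Z\<^esub>, []))"
  have uW: "letter_act u (\<one>\<^bsub>Z\<^esub>, []) \<in> \<Omega>" using word_act_\<Omega>[OF assms(3) base_\<Omega>] by simp
  have o: "?\<omega> \<in> \<Omega>" by (rule word_act_\<Omega>[OF good_words[OF t(5)] uW])
  have new: "same_side (Inl t # ts) (snd (F1.act t ?\<omega>))" if "\<not> F1.starts (snd ?\<omega>)"
    using F1.act_new[OF t(2,3), of "fst ?\<omega>" "snd ?\<omega>"] \<Omega>_valid[OF o] that by (simp add: same_side_def)
  show ?case
  proof (cases ts)
    case Nil
    show ?thesis
    proof (cases u)
      case (Inl a)
      then have "F1.act t (F1.act a (\<one>\<^bsub>Z\<^esub>, [])) = F1.act (t \<otimes>\<^bsub>G1\<^esub> a) (\<one>\<^bsub>Z\<^esub>, [])"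
        using t assms \<Omega>_valid by (intro F1.act_act) auto
      then show ?thesis using F1.act_base[of "t \<otimes>\<^bsub>G1\<^esub> a"] t assms Inl Nil by (auto simp: same_side_def)
    next
      case (Inr b)
      have "\<not> F1.starts (snd (F2.act b (\<one>\<^bsub>Z\<^esub>, [])))"
        using F2.act_base[of b] assms Inr by (auto simp: F2.starts_def)
      then show ?thesis using new Inr Nil by simp
    qed
  next
    case (Cons t' ts')
    then have "F2.starts ts" using t(4) by (cases t') auto
    moreover have "same_side ts (snd ?\<omega>)" using 2 Cons by simp
    ultimately have "\<not> F1.starts (snd ?\<omega>)" by (auto simp: same_side_def F1.starts_def F2.starts_def)
    then show ?thesis using new by simp
  qed
next
  case (3 t ts)
  have t: "t \<in> F2.T" "t \<in> carrier G2" "t \<notin> F2.K" "\<not> F2.starts ts" "good ts" using 3 by (auto simp: F2.T_def)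
  let ?\<omega> = "word_act ts (letter_act u (\<one>\<^bsub>Z\<^esub>, []))"
  have uW: "letter_act u (\<one>\<^bsub>Z\<^esub>, []) \<in> \<Omega>" using word_act_\<Omega>[OF assms(3) base_\<Omega>] by simp
  have o: "?\<omega> \<in> \<Omega>" by (rule word_act_\<Omega>[OF good_words[OF t(5)] uW])
  have new: "same_side (Inr t # ts) (snd (F2.act t ?\<omega>))" if "\<not> F2.starts (snd ?\<omega>)"
    using F2.act_new[OF t(2,3), of "fst ?\<omega>" "snd ?\<omega>"] \<Omega>_valid[OF o] that by (simp add: same_side_def)
  show ?case
  proof (cases ts)
    case Nil
    show ?thesis
    proof (cases u)
      case (Inr b)
      then have "F2.act t (F2.act b (\<one>\<^bsub>Z\<^esub>, [])) = F2.act (t \<otimes>\<^bsub>G2\<^esub> b) (\<one>\<^bsub>Z\<^esub>, [])"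
        using t assms \<Omega>_valid by (intro F2.act_act) auto
      then show ?thesis using F2.act_base[of "t \<otimes>\<^bsub>G2\<^esub> b"] t assms Inr Nil by (auto simp: same_side_def)
    next
      case (Inl a)
      have "\<not> F2.starts (snd (F1.act a (\<one>\<^bsub>Z\<^esub>, [])))"
        using F1.act_base[of a] assms Inl by (auto simp: F1.starts_def)
      then show ?thesis using new Inl Nil by simp
    qed
  next
    case (Cons t' ts')
    then have "F1.starts ts" using t(4) by (cases t') auto
    moreover have "same_side ts (snd ?\<omega>)" using 3 Cons by simp
    ultimately have "\<not> F2.starts (snd ?\<omega>)" by (auto simp: same_side_def F1.starts_def F2.starts_def)
    then show ?thesis using new by simp
  qed
qed

lemma nf_append_letter:
  assumes "w \<in> Wd" "[u] \<in> Wd" "snd (nf w) \<noteq> []"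
  shows "same_side (snd (nf w)) (snd (nf (w @ [u])))"
proof -
  define z ts where "z = fst (nf w)" and "ts = snd (nf w)"
  have z: "z \<in> carrier Z" and ts: "good ts" "ts \<in> Wd"
    using nf_\<Omega>[OF assms(1)] good_words by (auto simp: z_def ts_def \<Omega>_def)
  have "w @ [u] \<doteq> (Inl (i1 z) # ts) @ [u]"
    unfolding z_def ts_def by (rule cong_append_right[OF cong_nf[OF assms(1)] assms(2)])
  then have "nf (w @ [u]) = nf (Inl (i1 z) # (ts @ [u]))" using nf_cong by simp
  then have "snd (nf (w @ [u])) = snd (nf (ts @ [u]))" using nf_i1[of z "ts @ [u]"] z ts assms by simp
  also have "nf (ts @ [u]) = word_act ts (letter_act u (\<one>\<^bsub>Z\<^esub>, []))" by (simp add: nf_def)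
  finally show ?thesis using same_side_append_letter[OF ts(1) _ assms(2)] assms(3) by (simp add: ts_def)
qed

text \<open>A factor larger than \<open>Z\<close> has a nontrivial coset representative. Both claims
  are proved together because a letter of one factor is prefixed to a word starting in the
  other.\<close>

lemma long_good:
  assumes "F1.K \<noteq> carrier G1" "F2.K \<noteq> carrier G2"
  shows "(\<exists>ts. good ts \<and> F1.starts ts \<and> length ts > n) \<and> (\<exists>ts. good ts \<and> F2.starts ts \<and> length ts > n)"
proof -
  obtain a b where a: "a \<in> carrier G1" "a \<notin> F1.K" and b: "b \<in> carrier G2" "b \<notin> F2.K"
    using assms by (metis F1.K_subgroup F2.K_subgroup subgroup.subset subsetI subset_antisym)
  define s t where "s = F1.rep a" and "t = F2.rep b"
  have st: "s \<in> F1.T" "t \<in> F2.T" using F1.rep_T F2.rep_T a b by (auto simp: s_def t_def)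
  show ?thesis
  proof (induction n)
    case 0
    show ?case
      using st by (intro conjI exI[of _ "[Inl s]"] exI[of _ "[Inr t]"]) auto
  next
    case (Suc n)
    then obtain us vs where u: "good us" "F1.starts us" "length us > n" and v: "good vs" "F2.starts vs" "length vs > n"
      by blast
    have "\<not> F1.starts vs" "\<not> F2.starts us" using u v by (auto simp: F1.starts_def F2.starts_def)
    then show ?case
      using st u v by (intro conjI exI[of _ "Inl s # vs"] exI[of _ "Inr t # us"]) auto
  qed
qed

section \<open>From words to elements of the group\<close>

definition cls where "cls w = {v. w \<doteq> v}"

lemma rel_Image: "amalgam_rel G1 G2 Z i1 i2 `` {w} = cls w"
  by (auto simp: amalgam_rel_def cls_def)

lemma cls_eq: "v \<doteq> w \<Longrightarrow> cls v = cls w"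
  unfolding cls_def using amalgam_cong.trans amalgam_cong.sym by blast

lemma cls_eqD: "cls v = cls w \<Longrightarrow> w \<in> Wd \<Longrightarrow> v \<doteq> w"
  unfolding cls_def using amalgam_cong.refl by blast

lemma carrier_product: "carrier (amalgamated_product G1 G2 Z i1 i2) = cls ` Wd"
  unfolding amalgamated_product_def quotient_def rel_Image by auto

lemma mult_product:
  assumes "v \<in> Wd" "w \<in> Wd"
  shows "cls v \<otimes>\<^bsub>amalgamated_product G1 G2 Z i1 i2\<^esub> cls w = cls (v @ w)"
proof -
  have "cls (v' @ w') = cls (v @ w)" if "v' \<in> cls v" "w' \<in> cls w" for v' w'
    using that amalgam_cong.append[of G1 G2 Z i1 i2 v v' w w'] cls_eq unfolding cls_def by blast
  moreover have "v \<in> cls v" "w \<in> cls w" using assms by (auto simp: cls_def intro: amalgam_cong.refl)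
  ultimately have "(\<Union>v'\<in>cls v. \<Union>w'\<in>cls w. cls (v' @ w')) = cls (v @ w)" by blast
  then show ?thesis unfolding amalgamated_product_def rel_Image by simp
qed

text \<open>\<open>E1\<close> and \<open>E2\<close> consist of the elements whose normal form starts
  in \<open>G1\<close> or in \<open>G2\<close>. Multiplying by the letters of \<open>s\<close> one
  by one changes the side only through \<open>Z\<close>, which leaves finitely many cosets of
  \<open>Z\<close> for a crossing. Long normal forms avoid any finitely many cosets because
  \<open>Z\<close> on the left preserves the length.\<close>

lemma splitting:
  fixes G :: "'g monoid"
  assumes G: "group G" and iso: "G \<cong> amalgamated_product G1 G2 Z i1 i2"
    and proper: "F1.K \<noteq> carrier G1" "F2.K \<noteq> carrier G2"
  obtains j E1 E2 where "j \<in> mon Z G" "carrier G = j ` carrier Z \<union> E1 \<union> E2"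
    "\<And>z g. z \<in> carrier Z \<Longrightarrow> g \<in> E1 \<Longrightarrow> j z \<otimes>\<^bsub>G\<^esub> g \<in> E1"
    "\<And>z g. z \<in> carrier Z \<Longrightarrow> g \<in> E2 \<Longrightarrow> j z \<otimes>\<^bsub>G\<^esub> g \<in> E2"
    "\<And>s. s \<in> carrier G \<Longrightarrow> \<exists>F. finite F \<and> F \<subseteq> carrier G \<and>
      (\<forall>g\<in>E1. g \<otimes>\<^bsub>G\<^esub> s \<in> E2 \<longrightarrow> (\<exists>z\<in>carrier Z. \<exists>f\<in>F. g = j z \<otimes>\<^bsub>G\<^esub> f))"
    "\<And>F. finite F \<Longrightarrow> F \<subseteq> carrier G \<Longrightarrow> \<exists>g\<in>E1. \<forall>z\<in>carrier Z. \<forall>f\<in>F. g \<noteq> j z \<otimes>\<^bsub>G\<^esub> f"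
    "\<And>F. finite F \<Longrightarrow> F \<subseteq> carrier G \<Longrightarrow> \<exists>g\<in>E2. \<forall>z\<in>carrier Z. \<forall>f\<in>F. g \<noteq> j z \<otimes>\<^bsub>G\<^esub> f"
proof -
  interpret G: group G by (rule G)
  let ?P = "amalgamated_product G1 G2 Z i1 i2"
  obtain \<psi> where \<psi>: "\<psi> \<in> hom G ?P" "bij_betw \<psi> (carrier G) (carrier ?P)"
    using iso unfolding is_iso_def iso_def by blast
  define elt where "elt w = inv_into (carrier G) \<psi> (cls w)" for w
  have elt: "elt w \<in> carrier G" "\<psi> (elt w) = cls w" if "w \<in> Wd" for w
  proof -
    have "cls w \<in> \<psi> ` carrier G" using \<psi>(2) that carrier_product by (auto simp: bij_betw_def)
    then show "elt w \<in> carrier G" "\<psi> (elt w) = cls w"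
      unfolding elt_def by (rule inv_into_into, rule f_inv_into_f)
  qed
  have elt_cong: "elt v = elt w" if "v \<doteq> w" for v w
    using cls_eq[OF that] by (simp add: elt_def)
  have elt_eqD: "v \<doteq> w" if "elt v = elt w" "v \<in> Wd" "w \<in> Wd" for v w
    using that elt(2)[of v] elt(2)[of w] cls_eqD by auto
  have elt_mult: "elt (v @ w) = elt v \<otimes>\<^bsub>G\<^esub> elt w" if "v \<in> Wd" "w \<in> Wd" for v w
  proof -
    have vw: "elt v \<in> carrier G" "elt w \<in> carrier G" "\<psi> (elt v) = cls v" "\<psi> (elt w) = cls w"
      using elt that by blast+
    have "\<psi> (elt v \<otimes>\<^bsub>G\<^esub> elt w) = cls (v @ w)"
      using hom_mult[OF \<psi>(1) vw(1,2)] vw(3,4) mult_product[OF that] by simp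
    moreover have "inv_into (carrier G) \<psi> (\<psi> (elt v \<otimes>\<^bsub>G\<^esub> elt w)) = elt v \<otimes>\<^bsub>G\<^esub> elt w"
      by (rule inv_into_f_f[OF bij_betw_imp_inj_on[OF \<psi>(2)]]) (use vw in simp)
    ultimately show ?thesis by (simp add: elt_def[of "v @ w"])
  qed
  have elt_surj: "\<exists>w\<in>Wd. g = elt w" if "g \<in> carrier G" for g
  proof -
    have "\<psi> g \<in> cls ` Wd" using bij_betwE[OF \<psi>(2)] that by (simp add: carrier_product)
    then obtain w where w: "w \<in> Wd" "\<psi> g = cls w" by blast
    then have "elt w = g"
      unfolding elt_def using inv_into_f_f[OF bij_betw_imp_inj_on[OF \<psi>(2)] that] by simp
    then show ?thesis using w by blast
  qed
  \<comment> \<open>The choice of a word is harmless, as congruent words have the same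
    \<open>nf\<close>.\<close>
  define N where "N g = snd (nf (SOME w. w \<in> Wd \<and> g = elt w))" for g
  have N: "N (elt w) = snd (nf w)" if "w \<in> Wd" for w
  proof -
    have "(SOME v. v \<in> Wd \<and> elt w = elt v) \<in> Wd \<and> elt w = elt (SOME v. v \<in> Wd \<and> elt w = elt v)"
      by (rule someI[of _ w]) (use that in simp)
    then have "(SOME v. v \<in> Wd \<and> elt w = elt v) \<doteq> w"
      using elt_eqD[OF _ _ that] by simp
    then show ?thesis unfolding N_def by (simp add: nf_cong)
  qed
  define j where "j z = elt [Inl (i1 z)]" for z
  have zW: "[Inl (i1 z)] \<in> Wd" if "z \<in> carrier Z" for z using that by simp
  have jG: "j z \<in> carrier G" if "z \<in> carrier Z" for z unfolding j_def using elt zW that by blast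
  have j_mon: "j \<in> mon Z G"
  proof -
    have "j (z \<otimes>\<^bsub>Z\<^esub> z') = j z \<otimes>\<^bsub>G\<^esub> j z'" if "z \<in> carrier Z" "z' \<in> carrier Z" for z z'
    proof -
      have "elt [Inl (i1 z), Inl (i1 z')] = elt [Inl (i1 (z \<otimes>\<^bsub>Z\<^esub> z'))]"
        using elt_cong[OF amalgam_cong.mult1] that F1.i_mult by simp
      then show ?thesis using elt_mult[OF zW zW] that by (simp add: j_def)
    qed
    moreover have "inj_on j (carrier Z)"
    proof (rule inj_onI)
      fix z z' assume z: "z \<in> carrier Z" "z' \<in> carrier Z" "j z = j z'"
      then have "nf [Inl (i1 z)] = nf [Inl (i1 z')]" unfolding j_def using elt_eqD zW nf_cong by blast
      then show "z = z'" using nf_i1[of z "[]"] nf_i1[of z' "[]"] z by (simp add: nf_def)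
    qed
    ultimately show ?thesis using jG by (simp add: mon_def hom_def)
  qed
  have Nj: "N (j z \<otimes>\<^bsub>G\<^esub> g) = N g" if zg: "z \<in> carrier Z" "g \<in> carrier G" for z g
  proof -
    obtain w where w: "w \<in> Wd" "g = elt w" using elt_surj[OF zg(2)] by blast
    have "j z \<otimes>\<^bsub>G\<^esub> g = elt (Inl (i1 z) # w)" using elt_mult[OF zW[OF that(1)] w(1)] w by (simp add: j_def)
    then show ?thesis using N[of w] N[of "Inl (i1 z) # w"] nf_i1[OF that(1) w(1)] w that by simp
  qed
  have N_Nil: "\<exists>z\<in>carrier Z. g = j z" if gN: "g \<in> carrier G" "N g = []" for g
  proof -
    obtain w where w: "w \<in> Wd" "g = elt w" using elt_surj[OF gN(1)] by blast
    then have "w \<doteq> [Inl (i1 (fst (nf w)))]" using cong_nf[OF w(1)] N[OF w(1)] that by simp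
    then have "g = j (fst (nf w))" unfolding j_def using elt_cong[of w] w by simp
    then show ?thesis using nf_\<Omega>[OF w(1)] by (auto simp: \<Omega>_def)
  qed
  define E1 where "E1 = {g \<in> carrier G. F1.starts (N g)}"
  define E2 where "E2 = {g \<in> carrier G. F2.starts (N g)}"
  have starts_cases: "ts = [] \<or> F1.starts ts \<or> F2.starts ts" for ts
    by (cases ts rule: good.cases) auto
  have deep: "\<exists>g\<in>{g \<in> carrier G. S (N g)}. \<forall>z\<in>carrier Z. \<forall>f\<in>F. g \<noteq> j z \<otimes>\<^bsub>G\<^esub> f"
    if F: "finite F" "F \<subseteq> carrier G" and S: "\<And>n. \<exists>ts. good ts \<and> S ts \<and> length ts > n" for F S
  proof -
    obtain n where n: "\<And>f. f \<in> F \<Longrightarrow> length (N f) \<le> n"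
      using F(1) finite_nat_set_iff_bounded_le[of "(\<lambda>f. length (N f)) ` F"] by auto
    obtain ts where ts: "good ts" "S ts" "length ts > n" using S by blast
    have tsW: "ts \<in> Wd" by (rule good_words[OF ts(1)])
    have Nts: "N (elt ts) = ts" using N[OF tsW] nf_good[OF ts(1)] by simp
    have "elt ts \<noteq> j z \<otimes>\<^bsub>G\<^esub> f" if "z \<in> carrier Z" "f \<in> F" for z f
      using Nj[OF that(1), of f] that F(2) n[OF that(2)] Nts ts(3) by auto
    then show ?thesis using elt(1)[OF tsW] Nts ts(2) by (intro bexI[of _ "elt ts"]) simp_all
  qed
  show thesis
  proof (rule that[of j E1 E2])
    show "j \<in> mon Z G" by (rule j_mon)
    show "carrier G = j ` carrier Z \<union> E1 \<union> E2"
      using jG N_Nil starts_cases unfolding E1_def E2_def by blast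
    show "j z \<otimes>\<^bsub>G\<^esub> g \<in> E1" if "z \<in> carrier Z" "g \<in> E1" for z g
      using that Nj jG by (simp add: E1_def)
    show "j z \<otimes>\<^bsub>G\<^esub> g \<in> E2" if "z \<in> carrier Z" "g \<in> E2" for z g
      using that Nj jG by (simp add: E2_def)
    show "\<exists>g\<in>E1. \<forall>z\<in>carrier Z. \<forall>f\<in>F. g \<noteq> j z \<otimes>\<^bsub>G\<^esub> f" if "finite F" "F \<subseteq> carrier G" for F
      unfolding E1_def by (rule deep[OF that]) (use long_good[OF proper] in blast)
    show "\<exists>g\<in>E2. \<forall>z\<in>carrier Z. \<forall>f\<in>F. g \<noteq> j z \<otimes>\<^bsub>G\<^esub> f" if "finite F" "F \<subseteq> carrier G" for F
      unfolding E2_def by (rule deep[OF that]) (use long_good[OF proper] in blast)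
  next
    fix s assume "s \<in> carrier G"
    then obtain u where u: "u \<in> Wd" "s = elt u" using elt_surj[of s] by blast
    have takeW: "take k u \<in> Wd" for k
      using u(1) by (auto simp: amalgam_words_def dest: in_set_takeD)
    \<comment> \<open>If \<open>g\<close> times a prefix of \<open>u\<close> falls into
      \<open>Z\<close>, then \<open>g\<close> lies in the coset of \<open>Z\<close> given by the
      inverse of that prefix.\<close>
    define F where "F = (\<lambda>k. inv\<^bsub>G\<^esub> (elt (take k u))) ` {..length u}"
    have "\<exists>z\<in>carrier Z. \<exists>f\<in>F. g = j z \<otimes>\<^bsub>G\<^esub> f" if g: "g \<in> E1" "g \<otimes>\<^bsub>G\<^esub> s \<in> E2" for g
    proof -
      have "g \<in> carrier G" using g(1) by (simp add: E1_def)
      then obtain w where w: "w \<in> Wd" "g = elt w" using elt_surj[of g] by blast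
      have st: "F1.starts (snd (nf w))" "F2.starts (snd (nf (w @ u)))"
        using g N[of w] N[of "w @ u"] w u elt_mult[OF w(1) u(1)] by (simp_all add: E1_def E2_def)
      \<comment> \<open>Otherwise \<open>nf_append_letter\<close> would keep the starting factor
        \<open>G1\<close> through all prefixes up to \<open>w @ u\<close>, which starts in
        \<open>G2\<close>.\<close>
      have "\<exists>k\<le>length u. snd (nf (w @ take k u)) = []"
      proof (rule ccontr)
        assume nn: "\<not> ?thesis"
        have "F1.starts (snd (nf (w @ take k u)))" if "k \<le> length u" for k
          using that
        proof (induction k)
          case (Suc k)
          have "take (Suc k) u = take k u @ [u ! k]" using Suc.prems by (simp add: take_Suc_conv_app_nth)
          moreover have "[u ! k] \<in> Wd"
            using u(1) Suc.prems by (auto simp: amalgam_words_def in_lists_conv_set)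
          moreover have "snd (nf (w @ take k u)) \<noteq> []" using nn Suc.prems by auto
          ultimately have "same_side (snd (nf (w @ take k u))) (snd (nf (w @ take (Suc k) u)))"
            using nf_append_letter[of "w @ take k u" "u ! k"] w takeW by simp
          moreover have "snd (nf (w @ take (Suc k) u)) \<noteq> []" using nn Suc.prems by blast
          ultimately show ?case
            using Suc by (auto simp: same_side_def F1.starts_def F2.starts_def)
        qed (use st in simp)
        from this[of "length u"] show False
          using st by (auto simp: F1.starts_def F2.starts_def)
      qed
      then obtain k where k: "k \<le> length u" "snd (nf (w @ take k u)) = []" by blast
      have "g \<otimes>\<^bsub>G\<^esub> elt (take k u) = elt (w @ take k u)" using elt_mult[OF w(1) takeW] w by simp
      then obtain z where z: "z \<in> carrier Z" "g \<otimes>\<^bsub>G\<^esub> elt (take k u) = j z"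
        using N_Nil[of "elt (w @ take k u)"] N[of "w @ take k u"] k(2) w(1) takeW[of k]
        elt(1)[of "w @ take k u"] by auto
      then have "g = j z \<otimes>\<^bsub>G\<^esub> inv\<^bsub>G\<^esub> (elt (take k u))"
        using G.inv_solve_right[of g "j z" "elt (take k u)"] w elt(1)[OF w(1)] elt(1)[OF takeW] jG[OF z(1)] by simp
      then show ?thesis using z(1) k(1) unfolding F_def by blast
    qed
    moreover have "finite F" "F \<subseteq> carrier G" using elt takeW by (auto simp: F_def)
    ultimately show "\<exists>F. finite F \<and> F \<subseteq> carrier G \<and>
      (\<forall>g\<in>E1. g \<otimes>\<^bsub>G\<^esub> s \<in> E2 \<longrightarrow> (\<exists>z\<in>carrier Z. \<exists>f\<in>F. g = j z \<otimes>\<^bsub>G\<^esub> f))" by blast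
  qed
qed

end

section \<open>Separation of the boundary\<close>

context axis_space
begin

text \<open>\<open>orbit_near_sigma\<close> keeps segments from \<open>x\<close> along the axis
  within \<open>C\<close> of the orbit points they pass, and a limit inherits this. Starting at
  \<open>p\<close> costs \<open>\<delta>\<close> for the shifted start and \<open>\<delta>\<close>
  for the changed length.\<close>

lemma axis_ray:
  assumes s: "s \<in> {1, -1::int}"
  obtains \<eta> C where "\<eta> \<in> sigma_rays \<sigma>" "\<eta> 0 = p"
    "\<And>n::nat. dist (\<eta> (real n * l)) (\<phi> (g [^] (s * int n)) x) \<le> C"
proof -
  obtain C where C: "\<And>(n::nat) (m::nat) (s::int). n \<le> m \<Longrightarrow> 0 < m \<Longrightarrow> s \<in> {1, -1} \<Longrightarrow>
    dist (\<sigma> x (\<phi> (g [^] (s * int m)) x) (real n / real m)) (\<phi> (g [^] (s * int n)) x) \<le> C"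
    using orbit_near_sigma by blast
  define y where "y n = \<phi> (g [^] (s * int n)) x" for n :: nat
  define \<delta> where "\<delta> = dist p x"
  have xy: "dist x (y n) = real n * l" for n
    using axis_dist[of 0 "s * int n"] s by (auto simp: y_def abs_mult)
  have dy: "\<bar>dist p (y n) - real n * l\<bar> \<le> \<delta>" for n
    using dist_triangle[of p "y n" x] dist_triangle[of x "y n" p] xy[of n]
    by (simp add: \<delta>_def dist_commute)
  have "filterlim (\<lambda>n. - \<delta> + real n * l) at_top sequentially"
    by (intro filterlim_tendsto_add_at_top[OF tendsto_const]
      filterlim_at_top_mult_tendsto_pos[OF tendsto_const l_pos] filterlim_real_sequentially)
  then have "filterlim (\<lambda>n. dist p (y n)) at_top sequentially"
    by (rule filterlim_at_top_mono) (use dy in \<open>auto simp: abs_le_iff algebra_simps\<close>)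
  then obtain \<eta> r where \<eta>: "\<eta> \<in> sigma_rays \<sigma>" "\<eta> 0 = p" and r: "strict_mono r"
    and lim: "\<And>t. 0 \<le> t \<Longrightarrow> (\<lambda>k. \<sigma> p (y (r k)) (t / dist p (y (r k)))) \<longlonglongrightarrow> \<eta> t"
    using ray_limit by blast
  have "dist (\<eta> (real n * l)) (y n) \<le> C + 2 * \<delta>" for n
  proof -
    have "filterlim (\<lambda>k. real (r k) * l) at_top sequentially"
      by (intro filterlim_at_top_mult_tendsto_pos[OF tendsto_const l_pos]
        filterlim_compose[OF filterlim_real_sequentially filterlim_subseq[OF r]])
    then have ev: "eventually (\<lambda>k. real (r k) * l > real n * l + \<delta>) sequentially"
      by (auto simp: filterlim_at_top_dense)
    have "eventually (\<lambda>k. dist (\<sigma> p (y (r k)) (real n * l / dist p (y (r k)))) (y n) \<le> C + 2 * \<delta>) sequentially"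
      using ev
    proof eventually_elim
      case (elim k)
      define m where "m = r k"
      define d where "d = dist p (y m)"
      have \<delta>: "\<delta> \<ge> 0" by (simp add: \<delta>_def)
      have nl: "real n * l \<ge> 0" using l_pos by simp
      have ml: "real m * l > real n * l + \<delta>" using elim by (simp add: m_def)
      then have "real m * l > real n * l" using \<delta> by linarith
      then have m: "n < m" using l_pos by simp
      have d: "d > real n * l" "\<bar>d - real m * l\<bar> \<le> \<delta>" "d > 0"
        using dy[of m] ml nl unfolding d_def by linarith+
      have t: "0 \<le> real n * l / d" "real n * l / d \<le> 1" "0 \<le> real n / real m" "real n / real m \<le> 1"
        using d nl m by (auto simp: divide_le_eq_1)
      have 1: "dist (\<sigma> p (y m) (real n * l / d)) (\<sigma> p (y m) (real n / real m)) \<le> \<delta>"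
      proof -
        have "dist (\<sigma> p (y m) (real n * l / d)) (\<sigma> p (y m) (real n / real m)) =
            \<bar>real n * l / d - real n / real m\<bar> * d"
          using dist_sigma_sigma[OF t] by (simp add: d_def)
        also have "\<dots> = \<bar>(real n * l / d - real n / real m) * d\<bar>"
          using d by (simp add: abs_mult)
        also have "(real n * l / d - real n / real m) * d = (real n / real m) * (real m * l - d)"
          using d m by (simp add: field_simps)
        also have "\<bar>\<dots>\<bar> = (real n / real m) * \<bar>d - real m * l\<bar>"
          by (simp add: abs_mult abs_minus_commute)
        also have "\<dots> \<le> 1 * \<delta>" using t d by (intro mult_mono) auto
        finally show ?thesis by simp
      qed
      have "dist (\<sigma> p (y m) (real n / real m)) (\<sigma> x (y m) (real n / real m)) \<le> (1 - real n / real m) * \<delta>"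
        using conicalD[OF t(3,4), of p "y m" x "y m"] by (simp add: \<delta>_def)
      also have "\<dots> \<le> 1 * \<delta>" using t \<delta> by (intro mult_right_mono) auto
      finally have 2: "dist (\<sigma> p (y m) (real n / real m)) (\<sigma> x (y m) (real n / real m)) \<le> \<delta>" by simp
      have 3: "dist (\<sigma> x (y m) (real n / real m)) (y n) \<le> C"
        using C[of n m s] m s by (simp add: y_def)
      show ?case
        using 1 2 3 dist_triangle[of "\<sigma> p (y m) (real n * l / d)" "y n" "\<sigma> p (y m) (real n / real m)"]
          dist_triangle[of "\<sigma> p (y m) (real n / real m)" "y n" "\<sigma> x (y m) (real n / real m)"]
        unfolding d_def m_def by linarith
    qed
    moreover have "(\<lambda>k. dist (\<sigma> p (y (r k)) (real n * l / dist p (y (r k)))) (y n)) \<longlonglongrightarrow> dist (\<eta> (real n * l)) (y n)"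
      using l_pos by (intro tendsto_dist lim tendsto_const) simp
    ultimately show ?thesis by (intro tendsto_upperbound) auto
  qed
  then show thesis using that[OF \<eta>] unfolding y_def by blast
qed

text \<open>\<open>deep\<close> and \<open>finite_displacement\<close> yield points of the
  \<open>E\<close> orbit arbitrarily far from the \<open>ZG\<close> orbit, and a translation by
  \<open>ZG\<close> makes \<open>x\<close> almost nearest to them. Segments to such points move away
  from the \<open>ZG\<close> orbit at unit speed up to a constant, so they end up off
  \<open>B\<close>, on the side of their end points. A limit ray does the same.\<close>

lemma side_ray:
  assumes ZG: "subgroup ZG G" and E: "E \<subseteq> carrier G"
    and ZE: "\<And>z h. z \<in> ZG \<Longrightarrow> h \<in> E \<Longrightarrow> z \<otimes> h \<in> E"
    and deep: "\<And>F. finite F \<Longrightarrow> F \<subseteq> carrier G \<Longrightarrow> \<exists>h\<in>E. \<forall>z\<in>ZG. \<forall>f\<in>F. h \<noteq> z \<otimes> f"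
    and A: "\<And>h. h \<in> E \<Longrightarrow> \<phi> h x \<in> A"
    and B: "B = {y. \<exists>z\<in>ZG. dist y (\<phi> z x) \<le> R}"
    and cover: "- B \<subseteq> A \<union> A'"
    and sep: "\<And>y z. y \<in> A - B \<Longrightarrow> z \<in> A' - B \<Longrightarrow> dist y z \<ge> 1"
  obtains \<xi> T where "\<xi> \<in> sigma_rays \<sigma>" "\<xi> 0 = p" "\<And>t. t \<ge> T \<Longrightarrow> \<xi> t \<in> A - B"
    "\<And>t z. t \<ge> 0 \<Longrightarrow> z \<in> ZG \<Longrightarrow> dist (\<xi> t) (\<phi> z x) \<ge> t - 1 - dist p x"
proof -
  have ZGc: "z \<in> carrier G" if "z \<in> ZG" for z using subgroup.subset[OF ZG] that by blast
  have ex: "\<exists>e\<in>E. dist (\<phi> e x) x > real n \<and> (\<forall>z\<in>ZG. dist (\<phi> e x) (\<phi> z x) \<ge> dist (\<phi> e x) x - 1)" for n :: nat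
  proof -
    obtain h where h: "h \<in> E" "\<And>z f. z \<in> ZG \<Longrightarrow> f \<in> {f \<in> carrier G. dist x (\<phi> f x) \<le> real n} \<Longrightarrow> h \<noteq> z \<otimes> f"
      using deep[OF finite_displacement[of x "real n"]] by blast
    have hc: "h \<in> carrier G" using h(1) E by blast
    have far: "dist (\<phi> h x) (\<phi> z x) > real n" if z: "z \<in> ZG" for z
    proof (rule ccontr)
      assume "\<not> ?thesis"
      then have "dist x (\<phi> (inv z \<otimes> h) x) \<le> real n"
        using dist_act_inv[OF ZGc[OF z], of x "\<phi> h x"] ZGc[OF z] hc by (simp add: act_mult dist_commute)
      then have "h \<noteq> z \<otimes> (inv z \<otimes> h)" using h(2)[OF z, of "inv z \<otimes> h"] ZGc[OF z] hc by simp
      then show False using mult_inv_cancel(1)[OF ZGc[OF z] hc] by simp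
    qed
    define I where "I = (INF z\<in>ZG. dist (\<phi> h x) (\<phi> z x))"
    have ne: "ZG \<noteq> {}" using subgroup.one_closed[OF ZG] by blast
    have bdd: "bdd_below ((\<lambda>z. dist (\<phi> h x) (\<phi> z x)) ` ZG)" by (rule bdd_belowI2[of _ 0]) simp
    have "I < I + 1" by simp
    \<comment> \<open>The infimum is only approached up to 1; this is the 1 lost in the later
      distance estimates.\<close>
    then obtain z0 where z0: "z0 \<in> ZG" "dist (\<phi> h x) (\<phi> z0 x) < I + 1"
      unfolding I_def using cINF_less_iff[OF ne bdd] by blast
    have z0c: "z0 \<in> carrier G" by (rule ZGc[OF z0(1)])
    define e where "e = inv z0 \<otimes> h"
    have e: "e \<in> E" unfolding e_def by (rule ZE[OF subgroup.m_inv_closed[OF ZG z0(1)] h(1)])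
    have ed: "dist (\<phi> e x) (\<phi> z x) = dist (\<phi> h x) (\<phi> (z0 \<otimes> z) x)" if "z \<in> ZG" for z
      using dist_act_inv[OF z0c, of "\<phi> z x" "\<phi> h x"] z0c hc ZGc[OF that] by (simp add: e_def act_mult dist_commute)
    have ed0: "dist (\<phi> e x) x = dist (\<phi> h x) (\<phi> z0 x)"
      using ed[OF subgroup.one_closed[OF ZG]] z0c by simp
    have "dist (\<phi> e x) (\<phi> z x) \<ge> dist (\<phi> e x) x - 1" if z: "z \<in> ZG" for z
    proof -
      have "I \<le> dist (\<phi> h x) (\<phi> (z0 \<otimes> z) x)"
        unfolding I_def by (rule cINF_lower[OF bdd subgroup.m_closed[OF ZG z0(1) z]])
      then show ?thesis using ed[OF z] ed0 z0(2) by simp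
    qed
    moreover have "dist (\<phi> e x) x > real n" using ed0 far[OF z0(1)] by simp
    ultimately show ?thesis using e by blast
  qed
  obtain e where e: "\<And>n. e n \<in> E" "\<And>n. dist (\<phi> (e n) x) x > real n"
    "\<And>n z. z \<in> ZG \<Longrightarrow> dist (\<phi> (e n) x) (\<phi> z x) \<ge> dist (\<phi> (e n) x) x - 1"
    using ex by metis
  define y where "y n = \<phi> (e n) x" for n
  define \<delta> where "\<delta> = dist p x"
  have yp: "dist p (y n) \<le> dist (y n) x + \<delta>" "dist p (y n) \<ge> dist (y n) x - \<delta>" for n
    using dist_triangle[of p "y n" x] dist_triangle[of "y n" x p] by (auto simp: \<delta>_def dist_commute)
  have "filterlim (\<lambda>n. - \<delta> + real n) at_top sequentially"
    by (intro filterlim_tendsto_add_at_top[OF tendsto_const] filterlim_real_sequentially)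
  then have "filterlim (\<lambda>n. dist p (y n)) at_top sequentially"
  proof (rule filterlim_at_top_mono)
    have "- \<delta> + real n \<le> dist p (y n)" for n using yp(2)[of n] e(2)[of n] by (simp add: y_def)
    then show "eventually (\<lambda>n. - \<delta> + real n \<le> dist p (y n)) sequentially" by simp
  qed
  note inf = this
  then obtain \<xi> r where \<xi>: "\<xi> \<in> sigma_rays \<sigma>" "\<xi> 0 = p" and r: "strict_mono r"
    and lim: "\<And>t. 0 \<le> t \<Longrightarrow> (\<lambda>k. \<sigma> p (y (r k)) (t / dist p (y (r k)))) \<longlonglongrightarrow> \<xi> t"
    using ray_limit by blast
  have ev: "eventually (\<lambda>k. dist p (y (r k)) > t) sequentially" for t
    using filterlim_compose[OF inf filterlim_subseq[OF r]] by (auto simp: filterlim_at_top_dense)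
  \<comment> \<open>Triangle inequality from the far end: at time \<open>t\<close> the segment is
    \<open>dist p (y n) - t\<close> away from \<open>y n\<close>, while the \<open>ZG\<close> orbit
    is at least \<open>dist p (y n) - \<delta> - 1\<close> away from it.\<close>
  have far: "dist (\<sigma> p (y n) (t / dist p (y n))) (\<phi> z x) \<ge> t - 1 - \<delta>"
    if z: "z \<in> ZG" and t: "0 \<le> t" "t \<le> dist p (y n)" "0 < dist p (y n)" for t z n
  proof -
    have "dist (\<sigma> p (y n) (t / dist p (y n))) (y n) = (1 - t / dist p (y n)) * dist p (y n)"
      by (rule dist_sigma_end) (use t in auto)
    also have "\<dots> = dist p (y n) - t" using t by (simp add: left_diff_distrib)
    finally have "dist (\<sigma> p (y n) (t / dist p (y n))) (y n) = dist p (y n) - t" .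
    then show ?thesis
      using e(3)[OF z, of n] yp(1)[of n]
        dist_triangle[of "y n" "\<phi> z x" "\<sigma> p (y n) (t / dist p (y n))"]
      by (simp add: y_def[symmetric] dist_commute)
  qed
  have \<xi>far: "dist (\<xi> t) (\<phi> z x) \<ge> t - 1 - \<delta>" if z: "z \<in> ZG" and t: "0 \<le> t" for t z
  proof -
    have "(\<lambda>k. dist (\<sigma> p (y (r k)) (t / dist p (y (r k)))) (\<phi> z x)) \<longlonglongrightarrow> dist (\<xi> t) (\<phi> z x)"
      by (intro tendsto_dist lim[OF t] tendsto_const)
    moreover have "eventually (\<lambda>k. t - 1 - \<delta> \<le> dist (\<sigma> p (y (r k)) (t / dist p (y (r k)))) (\<phi> z x)) sequentially"
      using ev[of t]
    proof eventually_elim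
      case (elim k)
      show ?case by (rule far[OF z t]) (use elim t in linarith)+
    qed
    ultimately show ?thesis by (intro tendsto_lowerbound) auto
  qed
  define T where "T = max 0 (R + 2 + \<delta>)"
  have "\<xi> t \<in> A - B" if t: "t \<ge> T" for t
  proof -
    have t0: "0 \<le> t" "t > R + 1 + \<delta>" using t by (auto simp: T_def)
    have nB: "\<xi> t \<notin> B" using \<xi>far[OF _ t0(1)] t0(2) unfolding B by force
    \<comment> \<open>A segment point \<open>f t\<close> within 1 of \<open>\<xi> t\<close> decides
      the side: the segment avoids \<open>B\<close> from time \<open>t\<close> to its end in
      \<open>A\<close>, and \<open>sep\<close> passes the side from \<open>f t\<close> on to
      \<open>\<xi> t\<close>.\<close>
    have "eventually (\<lambda>k. dist (\<sigma> p (y (r k)) (t / dist p (y (r k)))) (\<xi> t) < 1) sequentially"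
      using lim[OF t0(1)] by (simp add: tendsto_iff)
    then have "eventually (\<lambda>k. dist (\<sigma> p (y (r k)) (t / dist p (y (r k)))) (\<xi> t) < 1 \<and> dist p (y (r k)) > t) sequentially"
      using ev[of t] by eventually_elim simp
    then obtain k where k: "dist (\<sigma> p (y (r k)) (t / dist p (y (r k)))) (\<xi> t) < 1" "dist p (y (r k)) > t"
      using eventually_happens'[OF sequentially_bot] by blast
    define d where "d = dist p (y (r k))"
    define f where "f s = \<sigma> p (y (r k)) (s / d)" for s
    have d: "d > t" "d > 0" using k(2) t0 by (auto simp: d_def)
    have fB: "f s \<notin> B" if "t \<le> s" "s \<le> d" for s
      using far[of _ s "r k"] that t0 d unfolding B f_def d_def[symmetric] by fastforce
    have "f t \<in> A \<longleftrightarrow> f d \<in> A"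
    proof (rule stays_on_side[of t d f B A A'])
      fix s s' assume ss: "t \<le> s" "s \<le> s'" "s' \<le> d"
      have "dist (f s) (f s') = \<bar>s / d - s' / d\<bar> * d"
        unfolding f_def d_def by (rule dist_sigma_sigma) (use ss t0 d in \<open>auto simp: d_def divide_le_eq_1\<close>)
      also have "\<dots> = \<bar>(s / d - s' / d) * d\<bar>" using d by (simp add: abs_mult)
      also have "(s / d - s' / d) * d = s - s'" using d by (simp add: field_simps)
      finally show "dist (f s) (f s') \<le> s' - s" using ss by simp
    qed (use fB cover sep d in auto)
    moreover have "f d = y (r k)" using d by (simp add: f_def)
    ultimately have "f t \<in> A - B" using A[OF e(1)] fB[of t] d by (simp add: y_def)
    then have "\<xi> t \<notin> A' - B" using sep[of "f t" "\<xi> t"] k(1) by (auto simp: f_def d_def)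
    then show ?thesis using nB cover by blast
  qed
  then show thesis using that[OF \<xi>, of T] \<xi>far unfolding \<delta>_def by blast
qed

text \<open>Neighbourhoods of the orbits of \<open>E1\<close> and \<open>E2\<close> serve as sides,
  and one of the \<open>ZG\<close> orbit as wall, in \<open>boundary_pair_separates\<close>. Since
  the powers of \<open>g\<close> have finite index in \<open>ZG\<close>, the wall stays near the
  axis, and its only ends are the two from \<open>axis_ray\<close>.\<close>

lemma coarse_splitting_separates:
  assumes ZG: "subgroup ZG G" and gZG: "g \<in> ZG"
    and F0: "finite F0" "F0 \<subseteq> carrier G" "\<And>z. z \<in> ZG \<Longrightarrow> \<exists>k::int. \<exists>f\<in>F0. z = g [^] k \<otimes> f"
    and parts: "carrier G = ZG \<union> E1 \<union> E2"
    and ZE1: "\<And>z h. z \<in> ZG \<Longrightarrow> h \<in> E1 \<Longrightarrow> z \<otimes> h \<in> E1"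
    and ZE2: "\<And>z h. z \<in> ZG \<Longrightarrow> h \<in> E2 \<Longrightarrow> z \<otimes> h \<in> E2"
    and cross: "\<And>s. s \<in> carrier G \<Longrightarrow> \<exists>F. finite F \<and> F \<subseteq> carrier G \<and>
      (\<forall>h\<in>E1. h \<otimes> s \<in> E2 \<longrightarrow> (\<exists>z\<in>ZG. \<exists>f\<in>F. h = z \<otimes> f))"
    and deep1: "\<And>F. finite F \<Longrightarrow> F \<subseteq> carrier G \<Longrightarrow> \<exists>h\<in>E1. \<forall>z\<in>ZG. \<forall>f\<in>F. h \<noteq> z \<otimes> f"
    and deep2: "\<And>F. finite F \<Longrightarrow> F \<subseteq> carrier G \<Longrightarrow> \<exists>h\<in>E2. \<forall>z\<in>ZG. \<forall>f\<in>F. h \<noteq> z \<otimes> f"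
  shows "\<exists>a \<in> sigma_boundary \<sigma>. \<exists>b \<in> sigma_boundary \<sigma>. a \<noteq> b \<and>
    \<not> connected_space (subtopology (boundary_topology \<sigma> p) (sigma_boundary \<sigma> - {a, b}))"
proof -
  have ZGc: "z \<in> carrier G" if "z \<in> ZG" for z using subgroup.subset[OF ZG] that by blast
  have E: "E1 \<subseteq> carrier G" "E2 \<subseteq> carrier G" using parts by auto
  have powZ: "g [^] k \<in> ZG" for k :: int by (rule subgroup_int_pow_closed[OF ZG gZG])
  have bound: "\<exists>M\<ge>0. \<forall>f\<in>F. dist x (\<phi> f x) \<le> M" if F: "finite F" for F
  proof -
    have "bdd_above ((\<lambda>f. dist x (\<phi> f x)) ` F)" using F by simp
    then obtain M where "\<forall>f\<in>F. dist x (\<phi> f x) \<le> M" unfolding bdd_above_def by auto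
    then show ?thesis by (intro exI[of _ "\<bar>M\<bar>"]) force
  qed
  obtain R where R: "R \<ge> 0" "\<And>y. \<exists>h\<in>carrier G. dist y (\<phi> h x) \<le> R" using cobounded by blast
  \<comment> \<open>If two points at distance below 1 are within \<open>R\<close> of
    \<open>\<phi> h x\<close> and \<open>\<phi> h' x\<close>, then \<open>inv h \<otimes> h'\<close>
    is in this finite set. So finitely many instances of \<open>cross\<close> suffice.\<close>
  define S where "S = {s \<in> carrier G. dist x (\<phi> s x) \<le> 2 * R + 1}"
  obtain F where F: "\<And>s. s \<in> carrier G \<Longrightarrow> finite (F s) \<and>
      (\<forall>h\<in>E1. h \<otimes> s \<in> E2 \<longrightarrow> (\<exists>z\<in>ZG. \<exists>f\<in>F s. f \<in> carrier G \<and> h = z \<otimes> f))"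
    using cross by (metis subsetD)
  have "finite (\<Union>s\<in>S. F s)"
    using finite_displacement[of x "2 * R + 1"] F by (auto simp: S_def)
  then obtain M where M: "M \<ge> 0" "\<And>s f. s \<in> S \<Longrightarrow> f \<in> F s \<Longrightarrow> dist x (\<phi> f x) \<le> M"
    using bound[of "\<Union>s\<in>S. F s"] by blast
  \<comment> \<open>\<open>M\<close> bounds how far from the \<open>ZG\<close> orbit the orbit can
    change sides, and \<open>R\<close> accounts for points off the orbit.\<close>
  define R' where "R' = R + M"
  define B where "B = {y. \<exists>z\<in>ZG. dist y (\<phi> z x) \<le> R'}"
  define A where "A E = {y. \<exists>h\<in>E. dist y (\<phi> h x) \<le> R}" for E
  have cover: "- B \<subseteq> A E1 \<union> A E2"
  proof
    fix y assume y: "y \<in> - B"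
    obtain h where h: "h \<in> carrier G" "dist y (\<phi> h x) \<le> R" using R by blast
    have "h \<notin> ZG" using y h(2) M(1) by (force simp: B_def R'_def)
    then show "y \<in> A E1 \<union> A E2" using h parts by (auto simp: A_def)
  qed
  have sep: "dist y z \<ge> 1" if y: "y \<in> A E1 - B" and z: "z \<in> A E2 - B" for y z
  proof (rule ccontr)
    assume "\<not> 1 \<le> dist y z"
    obtain h where h: "h \<in> E1" "dist y (\<phi> h x) \<le> R" using y by (auto simp: A_def)
    obtain h' where h': "h' \<in> E2" "dist z (\<phi> h' x) \<le> R" using z by (auto simp: A_def)
    have c: "h \<in> carrier G" "h' \<in> carrier G" using E h h' by auto
    define s where "s = inv h \<otimes> h'"
    have "dist (\<phi> h x) (\<phi> h' x) \<le> 2 * R + 1"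
      using dist_triangle[of "\<phi> h x" "\<phi> h' x" y] dist_triangle[of y "\<phi> h' x" z] h(2) h'(2) \<open>\<not> 1 \<le> dist y z\<close>
      by (simp add: dist_commute)
    then have s: "s \<in> S" "h \<otimes> s = h'"
      using c by (auto simp: S_def s_def act_mult dist_act_inv mult_inv_cancel)
    then obtain w f where w: "w \<in> ZG" "f \<in> F s" "f \<in> carrier G" "h = w \<otimes> f"
      using F[of s] h(1) h'(1) by (auto simp: S_def)
    have "dist (\<phi> h x) (\<phi> w x) = dist x (\<phi> f x)"
      using w ZGc by (simp add: act_mult dist_commute)
    then have "dist y (\<phi> w x) \<le> R'"
      using dist_triangle[of y "\<phi> w x" "\<phi> h x"] h(2) M(2)[OF s(1) w(2)] by (simp add: R'_def)
    then show False using y w(1) by (auto simp: B_def)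
  qed
  have sep': "dist y z \<ge> 1" if "y \<in> A E2 - B" "z \<in> A E1 - B" for y z
    using sep[OF that(2,1)] by (simp add: dist_commute)
  have AE: "\<phi> h x \<in> A E" if "h \<in> E" for h E using that R(1) unfolding A_def by force
  obtain \<eta> C where \<eta>: "\<eta> \<in> sigma_rays \<sigma>" "\<eta> 0 = p"
    "\<And>n::nat. dist (\<eta> (real n * l)) (\<phi> (g [^] (1 * int n)) x) \<le> C"
    using axis_ray[of 1 p] by blast
  obtain \<eta>' C' where \<eta>': "\<eta>' \<in> sigma_rays \<sigma>" "\<eta>' 0 = p"
    "\<And>n::nat. dist (\<eta>' (real n * l)) (\<phi> (g [^] (-1 * int n)) x) \<le> C'"
    using axis_ray[of "-1" p] by blast
  have large: "\<exists>n::nat. real n * l > a" for a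
    using ex_less_of_nat_mult[OF l_pos] by blast
  have "\<eta> \<noteq> \<eta>'"
  proof
    assume eq: "\<eta> = \<eta>'"
    obtain n :: nat where n: "real n * l > C + C'" using large by blast
    have "dist (\<phi> (g [^] (1 * int n)) x) (\<phi> (g [^] (-1 * int n)) x) \<le> C + C'"
      using dist_triangle[of "\<phi> (g [^] (1 * int n)) x" "\<phi> (g [^] (-1 * int n)) x" "\<eta> (real n * l)"]
        \<eta>(3)[of n] \<eta>'(3)[of n] eq by (simp add: dist_commute)
    moreover have "dist (\<phi> (g [^] (1 * int n)) x) (\<phi> (g [^] (-1 * int n)) x) = 2 * (real n * l)"
      using axis_dist[of "1 * int n" "-1 * int n"] by simp
    moreover have "0 \<le> real n * l" using l_pos by simp
    ultimately show False using n by linarith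
  qed
  obtain M0 where M0: "M0 \<ge> 0" "\<And>f. f \<in> F0 \<Longrightarrow> dist x (\<phi> f x) \<le> M0" using bound[OF F0(1)] by blast
  \<comment> \<open>\<open>Q\<close> bounds the distance from a point \<open>y\<close> of
    \<open>B\<close> to an axis ray at some time \<open>n * l\<close>; passing to time
    \<open>dist p y\<close> costs at most another \<open>Q\<close>, hence \<open>2 * Q\<close>
    below.\<close>
  define Q where "Q = R' + M0 + max C C'"
  have near: "dist (\<sigma> p y (T / dist p y)) (\<eta> T) \<le> 2 * Q \<or> dist (\<sigma> p y (T / dist p y)) (\<eta>' T) \<le> 2 * Q"
    if y: "y \<in> B" and T: "0 \<le> T" "T \<le> dist p y" for y T
  proof -
    obtain w where w: "w \<in> ZG" "dist y (\<phi> w x) \<le> R'" using y by (auto simp: B_def)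
    obtain k f where kf: "f \<in> F0" "w = g [^] (k::int) \<otimes> f" using F0(3)[OF w(1)] by blast
    have fc: "f \<in> carrier G" using kf(1) F0(2) by blast
    have "dist (\<phi> w x) (\<phi> (g [^] k) x) = dist x (\<phi> f x)"
      using kf(2) fc g by (simp add: act_mult dist_commute)
    then have yk: "dist y (\<phi> (g [^] k) x) \<le> R' + M0"
      using dist_triangle[of y "\<phi> (g [^] k) x" "\<phi> w x"] w(2) M0(2)[OF kf(1)] by simp
    have main: "dist (\<sigma> p y (T / dist p y)) (\<zeta> T) \<le> 2 * Q"
      if \<zeta>: "\<zeta> \<in> sigma_rays \<sigma>" "\<zeta> 0 = p" and close: "dist (\<zeta> (real n * l)) (\<phi> (g [^] k) x) \<le> max C C'"
      for \<zeta> and n :: nat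
    proof -
      have Q: "dist y (\<zeta> (real n * l)) \<le> Q"
        using dist_triangle[of y "\<zeta> (real n * l)" "\<phi> (g [^] k) x"] yk close by (simp add: Q_def dist_commute)
      then have Q0: "Q \<ge> 0" using zero_le_dist order_trans by blast
      have nl: "real n * l \<ge> 0" using l_pos by simp
      have pn: "dist p (\<zeta> (real n * l)) = real n * l" using raysD(2)[OF \<zeta>(1), of 0 "real n * l"] \<zeta>(2) nl by simp
      have "\<bar>real n * l - dist p y\<bar> \<le> Q"
        using dist_triangle[of p "\<zeta> (real n * l)" y] dist_triangle[of p y "\<zeta> (real n * l)"] Q pn
        by (simp add: dist_commute)
      moreover have "dist (\<zeta> (real n * l)) (\<zeta> (dist p y)) = \<bar>real n * l - dist p y\<bar>"
        using raysD(2)[OF \<zeta>(1) nl, of "dist p y"] by simp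
      ultimately have yd: "dist y (\<zeta> (dist p y)) \<le> 2 * Q"
        using dist_triangle[of y "\<zeta> (dist p y)" "\<zeta> (real n * l)"] Q by linarith
      show ?thesis
      proof (cases "dist p y = 0")
        case True
        then show ?thesis using T \<zeta>(2) Q0 by simp
      next
        case False
        then have t: "0 \<le> T / dist p y" "T / dist p y \<le> 1" using T by (auto simp: divide_le_eq_1)
        have "\<zeta> T = \<sigma> p (\<zeta> (dist p y)) (T / dist p y)"
          using raysD(3)[OF \<zeta>(1) _ t, of "dist p y"] \<zeta>(2) False by simp
        then have "dist (\<sigma> p y (T / dist p y)) (\<zeta> T) \<le> T / dist p y * dist y (\<zeta> (dist p y))"
          using dist_sigma_from_le[OF t, of p y "\<zeta> (dist p y)"] by simp
        also have "\<dots> \<le> 1 * dist y (\<zeta> (dist p y))" using t by (intro mult_right_mono) auto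
        finally show ?thesis using yd by simp
      qed
    qed
    show ?thesis
    proof (cases "k \<ge> 0")
      case True
      then have "dist (\<eta> (real (nat k) * l)) (\<phi> (g [^] k) x) \<le> max C C'" using \<eta>(3)[of "nat k"] by simp
      then show ?thesis using main[OF \<eta>(1,2)] by blast
    next
      case False
      then have "dist (\<eta>' (real (nat (- k)) * l)) (\<phi> (g [^] k) x) \<le> max C C'" using \<eta>'(3)[of "nat (- k)"] by simp
      then show ?thesis using main[OF \<eta>'(1,2)] by blast
    qed
  qed
  \<comment> \<open>A side ray leaves the \<open>ZG\<close> orbit at linear speed, while an axis ray
    is within a constant of it at all times \<open>n * l\<close>.\<close>
  have differ: "\<xi> \<noteq> \<zeta>"
    if \<xi>: "\<And>t z. t \<ge> 0 \<Longrightarrow> z \<in> ZG \<Longrightarrow> dist (\<xi> t) (\<phi> z x) \<ge> t - 1 - dist p x"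
      and \<zeta>: "\<And>n::nat. dist (\<zeta> (real n * l)) (\<phi> (g [^] (s * int n)) x) \<le> D" for \<xi> \<zeta> D and s :: int
  proof
    assume eq: "\<xi> = \<zeta>"
    obtain n :: nat where n: "real n * l > D + 1 + dist p x" using large by blast
    have "dist (\<xi> (real n * l)) (\<phi> (g [^] (s * int n)) x) \<ge> real n * l - 1 - dist p x"
      by (rule \<xi>[OF _ powZ]) (use l_pos in simp)
    then show False using \<zeta>[of n] n eq by simp
  qed
  obtain \<xi>1 T1 where \<xi>1: "\<xi>1 \<in> sigma_rays \<sigma>" "\<xi>1 0 = p" "\<And>t. t \<ge> T1 \<Longrightarrow> \<xi>1 t \<in> A E1 - B"
    "\<And>t z. t \<ge> 0 \<Longrightarrow> z \<in> ZG \<Longrightarrow> dist (\<xi>1 t) (\<phi> z x) \<ge> t - 1 - dist p x"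
    using side_ray[OF ZG E(1) ZE1 deep1 AE B_def cover sep] by blast
  have cover': "- B \<subseteq> A E2 \<union> A E1" using cover by blast
  obtain \<xi>2 T2 where \<xi>2: "\<xi>2 \<in> sigma_rays \<sigma>" "\<xi>2 0 = p" "\<And>t. t \<ge> T2 \<Longrightarrow> \<xi>2 t \<in> A E2 - B"
    "\<And>t z. t \<ge> 0 \<Longrightarrow> z \<in> ZG \<Longrightarrow> dist (\<xi>2 t) (\<phi> z x) \<ge> t - 1 - dist p x"
    using side_ray[OF ZG E(2) ZE2 deep2 AE B_def cover' sep'] by blast
  show ?thesis
    by (rule boundary_pair_separates[OF \<eta>(1,2) \<eta>'(1,2) \<open>\<eta> \<noteq> \<eta>'\<close> near cover sep
      \<xi>1(1,2) differ[OF \<xi>1(4) \<eta>(3)] differ[OF \<xi>1(4) \<eta>'(3)] \<xi>1(3)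
      \<xi>2(1,2) differ[OF \<xi>2(4) \<eta>(3)] differ[OF \<xi>2(4) \<eta>'(3)] \<xi>2(3)])
qed

end

section \<open>Amalgams over virtually cyclic groups\<close>

theorem proposition7:
  fixes G1 :: "'a monoid" and G2 :: "'b monoid" and Z :: "'c monoid" and G :: "'g monoid"
    and i1 :: "'c \<Rightarrow> 'a" and i2 :: "'c \<Rightarrow> 'b"
    and \<phi> :: "'g \<Rightarrow> 'x \<Rightarrow> 'x::metric_space"
    and \<sigma> :: "'x \<Rightarrow> 'x \<Rightarrow> real \<Rightarrow> 'x"
    and p :: 'x
  assumes "group G1" and "group G2" and "group Z" and "group G"
    and "i1 \<in> mon Z G1" and "i2 \<in> mon Z G2"
    and "i1 ` carrier Z \<noteq> carrier G1" and "i2 ` carrier Z \<noteq> carrier G2"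
    and "virtually_Z Z"
    and "G \<cong> amalgamated_product G1 G2 Z i1 i2"
    and "proper_space TYPE('x)"
    and "geometric_action G \<phi>"
    and "bicombing \<sigma>" and "consistent \<sigma>" and "conical \<sigma>" and "reversible \<sigma>"
    and "equivariant G \<phi> \<sigma>"
  shows "\<exists>a \<in> sigma_boundary \<sigma>. \<exists>b \<in> sigma_boundary \<sigma>. a \<noteq> b \<and>
    \<not> connected_space (subtopology (boundary_topology \<sigma> p) (sigma_boundary \<sigma> - {a, b}))"
proof -
  interpret amalgam G1 G2 Z i1 i2
    using assms by (simp add: amalgam_def amalgam_axioms_def)
  interpret A: geometric_bicombed_space \<sigma> G \<phi>
    using assms by (simp add: geometric_bicombed_space_def geometric_bicombed_space_axioms_def bicombed_space_def)
  show ?thesis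
  proof (rule splitting[OF assms(4,10,7,8)])
    fix j E1 E2
    assume j: "j \<in> mon Z G" and parts: "carrier G = j ` carrier Z \<union> E1 \<union> E2"
      and ZE1: "\<And>z h. z \<in> carrier Z \<Longrightarrow> h \<in> E1 \<Longrightarrow> j z \<otimes>\<^bsub>G\<^esub> h \<in> E1"
      and ZE2: "\<And>z h. z \<in> carrier Z \<Longrightarrow> h \<in> E2 \<Longrightarrow> j z \<otimes>\<^bsub>G\<^esub> h \<in> E2"
      and cross: "\<And>s. s \<in> carrier G \<Longrightarrow> \<exists>F. finite F \<and> F \<subseteq> carrier G \<and>
        (\<forall>h\<in>E1. h \<otimes>\<^bsub>G\<^esub> s \<in> E2 \<longrightarrow> (\<exists>z\<in>carrier Z. \<exists>f\<in>F. h = j z \<otimes>\<^bsub>G\<^esub> f))"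
      and deep1: "\<And>F. finite F \<Longrightarrow> F \<subseteq> carrier G \<Longrightarrow> \<exists>h\<in>E1. \<forall>z\<in>carrier Z. \<forall>f\<in>F. h \<noteq> j z \<otimes>\<^bsub>G\<^esub> f"
      and deep2: "\<And>F. finite F \<Longrightarrow> F \<subseteq> carrier G \<Longrightarrow> \<exists>h\<in>E2. \<forall>z\<in>carrier Z. \<forall>f\<in>F. h \<noteq> j z \<otimes>\<^bsub>G\<^esub> f"
    interpret j: group_hom Z G j
      using j by unfold_locales (simp add: mon_def)
    have j_inj: "inj_on j (carrier Z)" using j by (simp add: mon_def)
    obtain C where C: "subgroup C Z" "cyclic_group (Z\<lparr>carrier := C\<rparr>)" "infinite C" "finite (rcosets\<^bsub>Z\<^esub> C)"
      using assms(9) unfolding virtually_Z_def by blast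
    have "group (Z\<lparr>carrier := C\<rparr>)" by (rule Z.subgroup_imp_group[OF C(1)])
    from group.cyclic_group[OF this] C(2) obtain c
      where c: "c \<in> C" "C = range (\<lambda>n::int. c [^]\<^bsub>Z\<lparr>carrier := C\<rparr>\<^esub> n)"
      by auto
    have Cc: "C = range (\<lambda>n::int. c [^]\<^bsub>Z\<^esub> n)"
      using c(2) Z.int_pow_consistent[OF C(1) c(1)] by simp
    have cZ: "c \<in> carrier Z" using subgroup.subset[OF C(1)] c(1) by blast
    define g where "g = j c"
    have gpow: "g [^]\<^bsub>G\<^esub> n = j (c [^]\<^bsub>Z\<^esub> n)" for n :: int
      unfolding g_def by (rule j.hom_int_pow[OF cZ, symmetric])
    have gG: "g \<in> carrier G" unfolding g_def using cZ by simp
    have "infinite (range (\<lambda>n::int. g [^]\<^bsub>G\<^esub> n))"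
    proof -
      have "range (\<lambda>n::int. g [^]\<^bsub>G\<^esub> n) = j ` C" unfolding gpow Cc by (simp add: image_image)
      moreover have "inj_on j C" using j_inj subgroup.subset[OF C(1)] inj_on_subset by blast
      ultimately show ?thesis using C(3) by (simp add: finite_image_iff)
    qed
    from A.axis[OF gG this] obtain x l where l: "l > 0"
      and ax: "\<forall>i k. dist (\<phi> (g [^]\<^bsub>G\<^esub> (i::int)) x) (\<phi> (g [^]\<^bsub>G\<^esub> (k::int)) x) = real_of_int \<bar>i - k\<bar> * l"
      by blast
    interpret X: axis_space \<sigma> G \<phi> g x l
      by unfold_locales (use gG l ax in auto)
    \<comment> \<open>Right cosets of \<open>C\<close> give decompositions
      \<open>z = b \<otimes> r\<close> with \<open>b\<close> a power of \<open>c\<close> and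
      \<open>r\<close> in a finite set \<open>Q\<close>, whose image under \<open>j\<close> becomes
      \<open>F0\<close> in \<open>coarse_splitting_separates\<close>.\<close>
    have "rcosets\<^bsub>Z\<^esub> C = (\<lambda>r. C #>\<^bsub>Z\<^esub> r) ` carrier Z" by (auto simp: RCOSETS_def)
    then obtain Q where Q: "Q \<subseteq> carrier Z" "finite Q" "rcosets\<^bsub>Z\<^esub> C = (\<lambda>r. C #>\<^bsub>Z\<^esub> r) ` Q"
      using finite_subset_image[OF C(4), of "\<lambda>r. C #>\<^bsub>Z\<^esub> r" "carrier Z"] by auto
    show ?thesis
    proof (rule X.coarse_splitting_separates[of "j ` carrier Z" "j ` Q" E1 E2])
      show "subgroup (j ` carrier Z) G" by (rule j.img_is_subgroup)
      show "g \<in> j ` carrier Z" unfolding g_def using cZ by blast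
      show "finite (j ` Q)" "j ` Q \<subseteq> carrier G" using Q by auto
      show "carrier G = j ` carrier Z \<union> E1 \<union> E2" by (rule parts)
      show "\<exists>k::int. \<exists>f\<in>j ` Q. w = g [^]\<^bsub>G\<^esub> k \<otimes>\<^bsub>G\<^esub> f" if w: "w \<in> j ` carrier Z" for w
      proof -
        obtain z where z: "z \<in> carrier Z" "w = j z" using w by blast
        have "C #>\<^bsub>Z\<^esub> z \<in> rcosets\<^bsub>Z\<^esub> C" using z(1) by (auto simp: RCOSETS_def)
        then obtain r where r: "r \<in> Q" "C #>\<^bsub>Z\<^esub> z = C #>\<^bsub>Z\<^esub> r" using Q(3) by auto
        have "z \<in> C #>\<^bsub>Z\<^esub> r" using Z.rcos_self[OF z(1) C(1)] r(2) by simp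
        then obtain b where b: "b \<in> C" "z = b \<otimes>\<^bsub>Z\<^esub> r" by (auto simp: r_coset_def)
        then obtain n :: int where n: "b = c [^]\<^bsub>Z\<^esub> n" using Cc by blast
        have "w = g [^]\<^bsub>G\<^esub> n \<otimes>\<^bsub>G\<^esub> j r"
          unfolding z(2) b(2) gpow n[symmetric]
          by (rule j.hom_mult) (use b(1) r(1) Q(1) subgroup.subset[OF C(1)] in auto)
        then show ?thesis using r(1) by blast
      qed
      show "z \<otimes>\<^bsub>G\<^esub> h \<in> E1" if "z \<in> j ` carrier Z" "h \<in> E1" for z h using ZE1 that by blast
      show "z \<otimes>\<^bsub>G\<^esub> h \<in> E2" if "z \<in> j ` carrier Z" "h \<in> E2" for z h using ZE2 that by blast
      show "\<exists>F. finite F \<and> F \<subseteq> carrier G \<and>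
        (\<forall>h\<in>E1. h \<otimes>\<^bsub>G\<^esub> s \<in> E2 \<longrightarrow> (\<exists>z\<in>j ` carrier Z. \<exists>f\<in>F. h = z \<otimes>\<^bsub>G\<^esub> f))"
        if "s \<in> carrier G" for s using cross[OF that] by simp
      show "\<exists>h\<in>E1. \<forall>z\<in>j ` carrier Z. \<forall>f\<in>F. h \<noteq> z \<otimes>\<^bsub>G\<^esub> f" if "finite F" "F \<subseteq> carrier G" for F
        using deep1[OF that] by simp
      show "\<exists>h\<in>E2. \<forall>z\<in>j ` carrier Z. \<forall>f\<in>F. h \<noteq> z \<otimes>\<^bsub>G\<^esub> f" if "finite F" "F \<subseteq> carrier G" for F
        using deep2[OF that] by simp
    qed
  qed
qed

end
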